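(* Let $H$ be a complex 2-step nilpotent Lie group and $q$ a left invariant holomorphic Riemannian metric on $T^{1,0}H$. Then $q$ is $\mathbb C$-complete.
   Context: A holomorphic Riemannian metric on a complex manifold is a holomorphic, symmetric, nondegenerate complex bilinear form on the holomorphic tangent bundle $T^{1,0}H$. It has a unique holomorphic Levi-Civita connection $\mathfrak D$ on $T^{1,0}H$ (torsion free and metric). The metric $q$ is $\mathbb C$-complete if all holomorphic $\mathfrak D$-geodesics are defined over $\mathbb C$, i.e. for each $w\in T^{1,0}H$ there is a holomorphic $\mathfrak D$-geodesic $\Gamma_w:\mathbb C\to H$ with $\dot\Gamma_w^{1,0}(0)=w$. *)

theory Defs
  imports "HOL-Analysis.Analysis" "HOL-Algebra.Group"
begin

section \<open>Holomorphic functions of several variables\<close>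

definition holo_fun_on :: "(complex^'n \<Rightarrow> complex) \<Rightarrow> (complex^'n) set \<Rightarrow> bool" where
  "holo_fun_on f S \<longleftrightarrow>
     (\<forall>x\<in>S. \<exists>f'. (f has_derivative f') (at x) \<and> (\<forall>k v. f' (k *s v) = k * f' v))"

definition holo_vec_on :: "(complex^'n \<Rightarrow> complex^'m) \<Rightarrow> (complex^'n) set \<Rightarrow> bool" where
  "holo_vec_on f S \<longleftrightarrow> (\<forall>i. holo_fun_on (\<lambda>x. f x $ i) S)"

section \<open>Complex manifolds\<close>

text \<open>A complex manifold is an entire Hausdorff, second countable type together with a
  holomorphic atlas.  A chart is a pair of its domain and its coordinate map, the values of
  the latter outside the domain being irrelevant.\<close>

type_synonym ('a, 'n) chart = "'a set \<times> ('a \<Rightarrow> complex^'n)"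

abbreviation chart_inv :: "('a, 'n) chart \<Rightarrow> complex^'n \<Rightarrow> 'a" where
  "chart_inv c \<equiv> inv_into (fst c) (snd c)"

definition complex_atlas :: "('a::{t2_space, second_countable_topology}, 'n::finite) chart set \<Rightarrow> bool" where
  "complex_atlas A \<longleftrightarrow>
     (\<Union>c\<in>A. fst c) = UNIV \<and>
     (\<forall>c\<in>A. open (fst c) \<and> open (snd c ` fst c) \<and>
        homeomorphism (fst c) (snd c ` fst c) (snd c) (chart_inv c)) \<and>
     (\<forall>c\<in>A. \<forall>d\<in>A. holo_vec_on (snd d \<circ> chart_inv c) (snd c ` (fst c \<inter> fst d)))"

definition charts_at :: "('a, 'n::finite) chart set \<Rightarrow> 'a \<Rightarrow> ('a, 'n) chart set" where
  "charts_at A p = {c \<in> A. p \<in> fst c}"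

definition chart_at :: "('a, 'n::finite) chart set \<Rightarrow> 'a \<Rightarrow> ('a, 'n) chart" where
  "chart_at A p = (SOME c. c \<in> charts_at A p)"

definition prod_atlas ::
    "('a, 'n::finite) chart set \<Rightarrow> ('b, 'm::finite) chart set \<Rightarrow> ('a \<times> 'b, 'n + 'm) chart set" where
  "prod_atlas A B =
     {(fst c \<times> fst d,
       \<lambda>(p, r). \<chi> k. case k of Inl i \<Rightarrow> snd c p $ i | Inr j \<Rightarrow> snd d r $ j) | c d. c \<in> A \<and> d \<in> B}"

definition holo_map ::
    "('a::topological_space, 'n::finite) chart set \<Rightarrow> ('b::topological_space, 'm::finite) chart set
     \<Rightarrow> ('a \<Rightarrow> 'b) \<Rightarrow> bool" where
  "holo_map A B f \<longleftrightarrow> continuous_on UNIV f \<and>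
     (\<forall>c\<in>A. \<forall>d\<in>B. holo_vec_on (snd d \<circ> f \<circ> chart_inv c) (snd c ` (fst c \<inter> f -` fst d)))"

definition holo_function_on ::
    "('a, 'n::finite) chart set \<Rightarrow> 'a set \<Rightarrow> ('a \<Rightarrow> complex) \<Rightarrow> bool" where
  "holo_function_on A W f \<longleftrightarrow> (\<forall>c\<in>A. holo_fun_on (f \<circ> chart_inv c) (snd c ` (fst c \<inter> W)))"

section \<open>The holomorphic tangent bundle\<close>

text \<open>A vector in the fibre at \<open>p\<close> of the holomorphic tangent bundle \<open>T\<^sup>1\<^sup>,\<^sup>0\<close> is represented
  by its components with respect to the frames \<open>\<partial>/\<partial>z\<^sub>1, \<dots>, \<partial>/\<partial>z\<^sub>n\<close> of all charts at \<open>p\<close>; these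
  families transform by the Jacobians of the coordinate changes.  The value is 0 on everything
  that is not a chart at \<open>p\<close>, so that equality of tangent vectors is equality of functions.
  The vector space operations are the pointwise ones.\<close>

type_synonym ('a, 'n) tvec = "('a, 'n) chart \<Rightarrow> complex^'n"

definition tangent_space :: "('a, 'n::finite) chart set \<Rightarrow> 'a \<Rightarrow> ('a, 'n) tvec set" where
  "tangent_space A p =
     {v. (\<forall>c. c \<notin> charts_at A p \<longrightarrow> v c = 0) \<and>
         (\<forall>c\<in>charts_at A p. \<forall>d\<in>charts_at A p.
            v d = frechet_derivative (snd d \<circ> chart_inv c) (at (snd c p)) (v c))}"

text \<open>The coordinate vector field of the chart \<open>c\<close> with constant components \<open>x\<close>,
  to be used on the domain of \<open>c\<close> only.\<close>

definition coord_field ::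
    "('a, 'n::finite) chart set \<Rightarrow> ('a, 'n) chart \<Rightarrow> complex^'n \<Rightarrow> 'a \<Rightarrow> ('a, 'n) tvec" where
  "coord_field A c x p =
     (\<lambda>d. if d \<in> charts_at A p
          then frechet_derivative (snd d \<circ> chart_inv c) (at (snd c p)) x else 0)"

text \<open>In the next two definitions the choice of the chart \<open>chart_at A p\<close> is immaterial, by the
  chain rule.\<close>

definition vec_deriv ::
    "('a, 'n::finite) chart set \<Rightarrow> 'a \<Rightarrow> ('a, 'n) tvec \<Rightarrow> ('a \<Rightarrow> complex) \<Rightarrow> complex" where
  "vec_deriv A p v f =
     (let c = chart_at A p in frechet_derivative (f \<circ> chart_inv c) (at (snd c p)) (v c))"

definition differential ::
    "('a, 'n::finite) chart set \<Rightarrow> ('b, 'm::finite) chart set \<Rightarrow> ('a \<Rightarrow> 'b) \<Rightarrow> 'a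
     \<Rightarrow> ('a, 'n) tvec \<Rightarrow> ('b, 'm) tvec" where
  "differential A B f p v =
     (\<lambda>d. if d \<in> charts_at B (f p)
          then let c = chart_at A p
               in frechet_derivative (snd d \<circ> f \<circ> chart_inv c) (at (snd c p)) (v c)
          else 0)"

definition holo_vector_field_on ::
    "('a, 'n::finite) chart set \<Rightarrow> 'a set \<Rightarrow> ('a \<Rightarrow> ('a, 'n) tvec) \<Rightarrow> bool" where
  "holo_vector_field_on A W X \<longleftrightarrow>
     (\<forall>p\<in>W. X p \<in> tangent_space A p) \<and>
     (\<forall>c\<in>A. holo_vec_on (\<lambda>u. X (chart_inv c u) c) (snd c ` (fst c \<inter> W)))"

definition lie_bracket ::
    "('a, 'n::finite) chart set \<Rightarrow> ('a \<Rightarrow> ('a, 'n) tvec) \<Rightarrow> ('a \<Rightarrow> ('a, 'n) tvec)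
     \<Rightarrow> 'a \<Rightarrow> ('a, 'n) tvec" where
  "lie_bracket A X Y p =
     (\<lambda>c. if c \<in> charts_at A p
          then frechet_derivative (\<lambda>u. Y (chart_inv c u) c) (at (snd c p)) (X p c)
             - frechet_derivative (\<lambda>u. X (chart_inv c u) c) (at (snd c p)) (Y p c)
          else 0)"

section \<open>Holomorphic Riemannian metrics and their Levi-Civita connections\<close>

definition holo_riemannian_metric ::
    "('a::topological_space, 'n::finite) chart set
     \<Rightarrow> ('a \<Rightarrow> ('a, 'n) tvec \<Rightarrow> ('a, 'n) tvec \<Rightarrow> complex) \<Rightarrow> bool" where
  "holo_riemannian_metric A q \<longleftrightarrow>
     (\<forall>p. \<forall>u\<in>tangent_space A p. \<forall>v\<in>tangent_space A p. \<forall>w\<in>tangent_space A p. \<forall>k.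
        q p (\<lambda>c. u c + v c) w = q p u w + q p v w \<and>
        q p (\<lambda>c. k *s v c) w = k * q p v w) \<and>
     (\<forall>p. \<forall>v\<in>tangent_space A p. \<forall>w\<in>tangent_space A p. q p v w = q p w v) \<and>
     (\<forall>p. \<forall>v\<in>tangent_space A p. (\<forall>w\<in>tangent_space A p. q p v w = 0) \<longrightarrow> v = (\<lambda>c. 0)) \<and>
     (\<forall>W X Y. open W \<longrightarrow> holo_vector_field_on A W X \<longrightarrow> holo_vector_field_on A W Y \<longrightarrow>
        holo_function_on A W (\<lambda>p. q p (X p) (Y p)))"

text \<open>A holomorphic connection on the holomorphic tangent bundle is an operator taking a
  point \<open>p\<close>, a tangent vector at \<open>p\<close> and a holomorphic vector field defined near \<open>p\<close>.
  Since there may be few global holomorphic fields, the axioms are about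
  fields on arbitrary open sets \<open>W\<close>; the values of fields outside \<open>W\<close> are junk.\<close>

definition holo_connection ::
    "('a::topological_space, 'n::finite) chart set
     \<Rightarrow> ('a \<Rightarrow> ('a, 'n) tvec \<Rightarrow> ('a \<Rightarrow> ('a, 'n) tvec) \<Rightarrow> ('a, 'n) tvec) \<Rightarrow> bool" where
  "holo_connection A D \<longleftrightarrow>
     \<comment> \<open>values are tangent vectors, depending on the germ of the field only\<close>
     (\<forall>W Y. open W \<longrightarrow> holo_vector_field_on A W Y \<longrightarrow>
        (\<forall>p\<in>W. \<forall>v\<in>tangent_space A p. D p v Y \<in> tangent_space A p)) \<and>
     (\<forall>W Y Z. open W \<longrightarrow> holo_vector_field_on A W Y \<longrightarrow> (\<forall>p\<in>W. Y p = Z p) \<longrightarrow>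
        (\<forall>p\<in>W. \<forall>v\<in>tangent_space A p. D p v Y = D p v Z)) \<and>
     \<comment> \<open>complex linearity in the direction\<close>
     (\<forall>W Y. open W \<longrightarrow> holo_vector_field_on A W Y \<longrightarrow>
        (\<forall>p\<in>W. \<forall>v\<in>tangent_space A p. \<forall>w\<in>tangent_space A p. \<forall>k.
           D p (\<lambda>c. v c + w c) Y = (\<lambda>c. D p v Y c + D p w Y c) \<and>
           D p (\<lambda>c. k *s v c) Y = (\<lambda>c. k *s D p v Y c))) \<and>
     \<comment> \<open>additivity and Leibniz rule in the field\<close>
     (\<forall>W Y Z. open W \<longrightarrow> holo_vector_field_on A W Y \<longrightarrow> holo_vector_field_on A W Z \<longrightarrow>
        (\<forall>p\<in>W. \<forall>v\<in>tangent_space A p.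
           D p v (\<lambda>r c. Y r c + Z r c) = (\<lambda>c. D p v Y c + D p v Z c))) \<and>
     (\<forall>W f Y. open W \<longrightarrow> holo_function_on A W f \<longrightarrow> holo_vector_field_on A W Y \<longrightarrow>
        (\<forall>p\<in>W. \<forall>v\<in>tangent_space A p.
           D p v (\<lambda>r c. f r *s Y r c) = (\<lambda>c. vec_deriv A p v f *s Y p c + f p *s D p v Y c))) \<and>
     \<comment> \<open>holomorphy\<close>
     (\<forall>W X Y. open W \<longrightarrow> holo_vector_field_on A W X \<longrightarrow> holo_vector_field_on A W Y \<longrightarrow>
        holo_vector_field_on A W (\<lambda>p. D p (X p) Y))"

definition torsion_free ::
    "('a::topological_space, 'n::finite) chart set
     \<Rightarrow> ('a \<Rightarrow> ('a, 'n) tvec \<Rightarrow> ('a \<Rightarrow> ('a, 'n) tvec) \<Rightarrow> ('a, 'n) tvec) \<Rightarrow> bool" where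
  "torsion_free A D \<longleftrightarrow>
     (\<forall>W X Y. open W \<longrightarrow> holo_vector_field_on A W X \<longrightarrow> holo_vector_field_on A W Y \<longrightarrow>
        (\<forall>p\<in>W. (\<lambda>c. D p (X p) Y c - D p (Y p) X c) = lie_bracket A X Y p))"

definition metric_connection ::
    "('a::topological_space, 'n::finite) chart set
     \<Rightarrow> ('a \<Rightarrow> ('a, 'n) tvec \<Rightarrow> ('a, 'n) tvec \<Rightarrow> complex)
     \<Rightarrow> ('a \<Rightarrow> ('a, 'n) tvec \<Rightarrow> ('a \<Rightarrow> ('a, 'n) tvec) \<Rightarrow> ('a, 'n) tvec) \<Rightarrow> bool" where
  "metric_connection A q D \<longleftrightarrow>
     (\<forall>W Y Z. open W \<longrightarrow> holo_vector_field_on A W Y \<longrightarrow> holo_vector_field_on A W Z \<longrightarrow>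
        (\<forall>p\<in>W. \<forall>v\<in>tangent_space A p.
           vec_deriv A p v (\<lambda>r. q r (Y r) (Z r)) = q p (D p v Y) (Z p) + q p (Y p) (D p v Z)))"

definition levi_civita ::
    "('a::topological_space, 'n::finite) chart set
     \<Rightarrow> ('a \<Rightarrow> ('a, 'n) tvec \<Rightarrow> ('a, 'n) tvec \<Rightarrow> complex)
     \<Rightarrow> ('a \<Rightarrow> ('a, 'n) tvec \<Rightarrow> ('a \<Rightarrow> ('a, 'n) tvec) \<Rightarrow> ('a, 'n) tvec) \<Rightarrow> bool" where
  "levi_civita A q D \<longleftrightarrow> holo_connection A D \<and> torsion_free A D \<and> metric_connection A q D"

section \<open>Geodesics and completeness\<close>

definition holo_curve ::
    "('a::topological_space, 'n::finite) chart set \<Rightarrow> (complex \<Rightarrow> 'a) \<Rightarrow> bool" where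
  "holo_curve A \<gamma> \<longleftrightarrow> continuous_on UNIV \<gamma> \<and>
     (\<forall>c\<in>A. \<forall>i. (\<lambda>t. snd c (\<gamma> t) $ i) holomorphic_on (\<gamma> -` fst c))"

text \<open>The (1,0)-part of the velocity of a holomorphic curve.\<close>

definition velocity ::
    "('a, 'n::finite) chart set \<Rightarrow> (complex \<Rightarrow> 'a) \<Rightarrow> complex \<Rightarrow> ('a, 'n) tvec" where
  "velocity A \<gamma> z =
     (\<lambda>c. if c \<in> charts_at A (\<gamma> z) then \<chi> i. deriv (\<lambda>t. snd c (\<gamma> t) $ i) z else 0)"

text \<open>The geodesic equation \<open>x'' + \<Gamma>(x', x') = 0\<close> in local coordinates.  In a chart \<open>c\<close> the
  Christoffel term \<open>\<Gamma>(x', x') = \<Sum>\<^sub>i\<^sub>j x'\<^sub>i x'\<^sub>j D\<^bsub>\<partial>i\<^esub> \<partial>\<^sub>j\<close> is the covariant derivative, in the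
  direction of the velocity, of the coordinate field whose constant components are those
  of the velocity.\<close>

definition geodesic ::
    "('a::topological_space, 'n::finite) chart set
     \<Rightarrow> ('a \<Rightarrow> ('a, 'n) tvec \<Rightarrow> ('a \<Rightarrow> ('a, 'n) tvec) \<Rightarrow> ('a, 'n) tvec)
     \<Rightarrow> (complex \<Rightarrow> 'a) \<Rightarrow> bool" where
  "geodesic A D \<gamma> \<longleftrightarrow> holo_curve A \<gamma> \<and>
     (\<forall>z. \<forall>c\<in>charts_at A (\<gamma> z).
        (\<chi> i. deriv (deriv (\<lambda>t. snd c (\<gamma> t) $ i)) z)
          + D (\<gamma> z) (velocity A \<gamma> z) (coord_field A c (velocity A \<gamma> z c)) c = 0)"

text \<open>The Levi-Civita connection exists and is unique on holomorphic vector fields.  As \<open>D\<close> is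
  a total function, it is unspecified on other arguments, hence the existential quantifier.
  Geodesics are not affected by this.\<close>

definition C_complete ::
    "('a::topological_space, 'n::finite) chart set
     \<Rightarrow> ('a \<Rightarrow> ('a, 'n) tvec \<Rightarrow> ('a, 'n) tvec \<Rightarrow> complex) \<Rightarrow> bool" where
  "C_complete A q \<longleftrightarrow>
     (\<exists>D. levi_civita A q D \<and>
        (\<forall>p. \<forall>w\<in>tangent_space A p. \<exists>\<gamma>. geodesic A D \<gamma> \<and> \<gamma> 0 = p \<and> velocity A \<gamma> 0 = w))"

section \<open>Complex Lie groups\<close>

definition complex_lie_group ::
    "('a::{t2_space, second_countable_topology}) monoid \<Rightarrow> ('a, 'n::finite) chart set \<Rightarrow> bool" where
  "complex_lie_group G A \<longleftrightarrow>
     complex_atlas A \<and> group G \<and> carrier G = UNIV \<and>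
     holo_map (prod_atlas A A) A (\<lambda>(x, y). x \<otimes>\<^bsub>G\<^esub> y) \<and>
     holo_map A A (\<lambda>x. inv\<^bsub>G\<^esub> x)"

definition lie_algebra ::
    "'a monoid \<Rightarrow> ('a, 'n::finite) chart set \<Rightarrow> ('a \<Rightarrow> ('a, 'n) tvec) set" where
  "lie_algebra G A =
     {X. holo_vector_field_on A UNIV X \<and>
         (\<forall>g p. X (g \<otimes>\<^bsub>G\<^esub> p) = differential A A (\<lambda>x. g \<otimes>\<^bsub>G\<^esub> x) p (X p))}"

text \<open>Nilpotency of a Lie group refers to its Lie algebra.  Abelian algebras are
  admitted as a degenerate case.\<close>

definition two_step_nilpotent :: "'a monoid \<Rightarrow> ('a, 'n::finite) chart set \<Rightarrow> bool" where
  "two_step_nilpotent G A \<longleftrightarrow>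
     (\<forall>X\<in>lie_algebra G A. \<forall>Y\<in>lie_algebra G A. \<forall>Z\<in>lie_algebra G A.
        lie_bracket A X (lie_bracket A Y Z) = (\<lambda>p c. 0))"

definition left_invariant ::
    "'a monoid \<Rightarrow> ('a, 'n::finite) chart set
     \<Rightarrow> ('a \<Rightarrow> ('a, 'n) tvec \<Rightarrow> ('a, 'n) tvec \<Rightarrow> complex) \<Rightarrow> bool" where
  "left_invariant G A q \<longleftrightarrow>
     (\<forall>g p. \<forall>v\<in>tangent_space A p. \<forall>w\<in>tangent_space A p.
        q (g \<otimes>\<^bsub>G\<^esub> p) (differential A A (\<lambda>x. g \<otimes>\<^bsub>G\<^esub> x) p v)
                    (differential A A (\<lambda>x. g \<otimes>\<^bsub>G\<^esub> x) p w) = q p v w)"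

end

theory Submission
  imports Defs "HOL-Complex_Analysis.Cauchy_Integral_Formula"
begin

text \<open>Fix a basis of the Lie algebra and extend it to left invariant vector fields; this trivialises
the holomorphic tangent bundle. In this frame the metric, the brackets and hence, by the Koszul
formula, the Levi-Civita connection have constant coefficients. A curve \<open>\<gamma>\<close> whose velocity has
frame coordinates \<open>u\<close> is then a geodesic exactly when \<open>u' = - \<nabla>\<^sub>u u\<close>, that is, when
\<open>g(u', z) = g(u, [u, z])\<close> for all \<open>z\<close>. So completeness over the complex numbers amounts to two
things: this Euler equation must have entire solutions, and every entire \<open>u\<close> must be the left
logarithmic derivative of a curve defined on the whole plane.

The first is where 2-step nilpotency enters. All brackets are central, so for a bracket \<open>z\<close> the
right hand side vanishes and \<open>g(u, z)\<close> is constant along a solution. Hence \<open>g(u, [u, z])\<close> may be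
replaced by \<open>g(u(0), [u, z])\<close>, which is linear in \<open>u\<close>. The quadratic equation becomes a linear
one with constant coefficients, whose solution is an exponential series. Conversely the solution
of the linear equation has the same constants of motion, hence solves the Euler equation; this is
the lemma \<open>euler_solution\<close>.

The second holds on every complex Lie group. Locally it is a holomorphic differential equation,
solved by Picard iteration on a disc. Since the equation is left invariant, every solution can be
translated to start at any point of the group, so the radius of the disc depends only on a bound
for \<open>u\<close> and not on the starting point. Solutions on a disc can therefore be prolonged by a fixed
amount as long as \<open>u\<close> stays bounded, and uniqueness glues them to a solution on the plane
(\<open>local_solution\<close>, \<open>extend_solution\<close>, \<open>global_solution\<close>).

The underlying facts about holomorphic maps of several variables are derived from one complex
variable by restriction to complex lines: partial derivatives are holomorphic, second derivatives
are symmetric, and holomorphic maps are locally Lipschitz. Symmetry of second derivatives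
gives naturality of brackets of vector fields, which makes brackets of left invariant
fields left invariant.\<close>

section \<open>Holomorphic maps between complex coordinate spaces\<close>

abbreviation fd :: "('a::real_normed_vector \<Rightarrow> 'b::real_normed_vector) \<Rightarrow> 'a \<Rightarrow> 'a \<Rightarrow> 'b" where
  "fd f x \<equiv> frechet_derivative f (at x)"

abbreviation clin :: "(complex^'n \<Rightarrow> complex^'m) \<Rightarrow> bool" where
  "clin f \<equiv> Vector_Spaces.linear (*s) (*s) f"

lemma clinI: "(\<And>x y. f (x + y) = f x + f y) \<Longrightarrow> (\<And>k x. f (k *s x) = k *s f x) \<Longrightarrow> clin f"
  by (intro Vector_Spaces.linear_iff[THEN iffD2] conjI vec.vector_space_axioms allI)

lemma clin_simps:
  assumes "clin f"
  shows "f (x + y) = f x + f y" "f (k *s x) = k *s f x" "f (x - y) = f x - f y" "f 0 = 0" "f (- x) = - f x"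
    "f (sum h S) = (\<Sum>i\<in>S. f (h i))"
  using assms
  by (simp_all add: vec.linear_add vec.linear_scale vec.linear_diff vec.linear_0 vec.linear_neg vec.linear_sum)

lemma clin_expand:
  assumes "clin f"
  shows "f x = (\<Sum>i\<in>UNIV. x $ i *s f (axis i 1))"
proof -
  have "f x = f (\<Sum>i\<in>UNIV. x $ i *s axis i 1)"
    by (simp add: basis_expansion)
  then show ?thesis
    using assms by (simp add: clin_simps)
qed

lemma norm_vector_scale: "norm (k *s (v::complex^'n)) = norm k * norm v"
  by (simp add: norm_vec_def L2_set_def norm_mult power_mult_distrib real_sqrt_mult
      flip: sum_distrib_left)

lemma scaleR_vector_scale: "r *\<^sub>R (v::complex^'n) = complex_of_real r *s v"
  unfolding vec_eq_iff by (simp add: scaleR_conv_of_real[where 'a = complex])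

lemma bounded_linear_vector_scale: "bounded_linear (\<lambda>k. k *s (v::complex^'n))"
  by (rule bounded_linear_intro[where K = "norm v"])
     (auto simp: vec_eq_iff algebra_simps norm_vector_scale)

text \<open>Components with respect to \<open>Basis\<close> are real; this is the version for the
  complex components of a vector.\<close>

lemma has_derivative_vec_iff:
  fixes f :: "'a::real_normed_vector \<Rightarrow> complex^'m"
  shows "(f has_derivative f') F \<longleftrightarrow> (\<forall>i. ((\<lambda>x. f x $ i) has_derivative (\<lambda>x. f' x $ i)) F)"
proof
  assume "(f has_derivative f') F"
  then show "\<forall>i. ((\<lambda>x. f x $ i) has_derivative (\<lambda>x. f' x $ i)) F"
    using bounded_linear.has_derivative[OF bounded_linear_vec_nth] by blast
next
  assume *: "\<forall>i. ((\<lambda>x. f x $ i) has_derivative (\<lambda>x. f' x $ i)) F"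
  have "((\<lambda>x. \<Sum>i\<in>UNIV. f x $ i *s axis i 1) has_derivative (\<lambda>x. \<Sum>i\<in>UNIV. f' x $ i *s axis i 1)) F"
    using * by (auto intro!: has_derivative_sum bounded_linear.has_derivative[OF bounded_linear_vector_scale])
  then show "(f has_derivative f') F"
    by (simp add: basis_expansion)
qed

lemma holo_fun_onD:
  assumes "holo_fun_on f S" "x \<in> S"
  shows "(f has_derivative fd f x) (at x)" "fd f x (k *s v) = k * fd f x v"
    "f differentiable at x"
proof -
  obtain f' where f': "(f has_derivative f') (at x)" "\<forall>k v. f' (k *s v) = k * f' v"
    using assms unfolding holo_fun_on_def by blast
  then have "f' = fd f x"
    using frechet_derivative_at by blast
  then show "(f has_derivative fd f x) (at x)" "fd f x (k *s v) = k * fd f x v"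
    using f' by auto
  then show "f differentiable at x"
    unfolding differentiable_def by blast
qed

lemma holo_vec_onD:
  assumes "holo_vec_on f S" "x \<in> S"
  shows "(f has_derivative fd f x) (at x)" "clin (fd f x)" "f differentiable at x"
    "fd f x v $ i = fd (\<lambda>y. f y $ i) x v"
proof -
  have h: "holo_fun_on (\<lambda>y. f y $ i) S" for i
    using assms(1) unfolding holo_vec_on_def by blast
  have *: "(f has_derivative (\<lambda>v. \<chi> i. fd (\<lambda>y. f y $ i) x v)) (at x)"
    unfolding has_derivative_vec_iff using holo_fun_onD(1)[OF h assms(2)] by (simp add: eta_contract_eq)
  then have eq: "fd f x = (\<lambda>v. \<chi> i. fd (\<lambda>y. f y $ i) x v)"
    using frechet_derivative_at by metis
  show d: "(f has_derivative fd f x) (at x)"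
    using * eq by simp
  then show "f differentiable at x"
    unfolding differentiable_def by blast
  show "fd f x v $ i = fd (\<lambda>y. f y $ i) x v"
    by (simp add: eq)
  show "clin (fd f x)"
  proof (rule clinI)
    show "fd f x (k *s w) = k *s fd f x w" for k w
      by (simp add: eq vec_eq_iff holo_fun_onD(2)[OF h assms(2)])
    show "fd f x (u + w) = fd f x u + fd f x w" for u w
      using has_derivative_linear[OF d] by (simp add: linear_add)
  qed
qed

lemma holo_fun_on_subset: "holo_fun_on f S \<Longrightarrow> T \<subseteq> S \<Longrightarrow> holo_fun_on f T"
  unfolding holo_fun_on_def by blast

lemma holo_vec_on_subset: "holo_vec_on f S \<Longrightarrow> T \<subseteq> S \<Longrightarrow> holo_vec_on f T"
  unfolding holo_vec_on_def using holo_fun_on_subset by blast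

lemma holo_fun_on_cong:
  assumes "holo_fun_on f S" "open S" "\<And>x. x \<in> S \<Longrightarrow> f x = g x"
  shows "holo_fun_on g S"
  unfolding holo_fun_on_def
  using assms has_derivative_transform_within_open[of f _ _ _ S g] unfolding holo_fun_on_def by metis

lemma holo_vec_on_cong:
  assumes "holo_vec_on f S" "open S" "\<And>x. x \<in> S \<Longrightarrow> f x = g x"
  shows "holo_vec_on g S"
  unfolding holo_vec_on_def
proof
  fix i
  show "holo_fun_on (\<lambda>x. g x $ i) S"
    by (rule holo_fun_on_cong[of "\<lambda>x. f x $ i"]) (use assms in \<open>auto simp: holo_vec_on_def\<close>)
qed

text \<open>The derivative is a choice among candidates that depend only on the germ of the
  function, so germ equality suffices.\<close>

lemma fd_cong:
  assumes "open S" "x \<in> S" "\<And>y. y \<in> S \<Longrightarrow> f y = g y"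
  shows "fd f x = fd g x"
proof -
  have "(f has_derivative d) (at x) \<longleftrightarrow> (g has_derivative d) (at x)" for d
    using has_derivative_transform_within_open[of f d x UNIV S g]
      has_derivative_transform_within_open[of g d x UNIV S f] assms by auto
  then show ?thesis
    unfolding frechet_derivative_def by simp
qed

lemma holo_fun_on_continuous: "holo_fun_on f S \<Longrightarrow> continuous_on S f"
  by (meson holo_fun_onD(1) has_derivative_continuous continuous_at_imp_continuous_on)

lemma holo_vec_on_continuous: "holo_vec_on f S \<Longrightarrow> continuous_on S f"
  by (meson holo_vec_onD(1) has_derivative_continuous continuous_at_imp_continuous_on)

lemma holo_fun_on_const: "holo_fun_on (\<lambda>x. c) S"
  unfolding holo_fun_on_def by (auto intro!: exI[of _ "\<lambda>_. 0"])

lemma holo_fun_on_nth: "holo_fun_on (\<lambda>x. x $ i) S"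
  unfolding holo_fun_on_def
  by (auto intro!: exI[of _ "\<lambda>x. x $ i"] bounded_linear_imp_has_derivative bounded_linear_vec_nth)

lemma holo_fun_on_add:
  assumes "holo_fun_on f S" "holo_fun_on g S"
  shows "holo_fun_on (\<lambda>x. f x + g x) S"
  unfolding holo_fun_on_def
proof
  fix x assume x: "x \<in> S"
  show "\<exists>d. ((\<lambda>x. f x + g x) has_derivative d) (at x) \<and> (\<forall>k v. d (k *s v) = k * d v)"
    using holo_fun_onD[OF assms(1) x] holo_fun_onD[OF assms(2) x]
    by (intro exI[of _ "\<lambda>v. fd f x v + fd g x v"]) (auto intro!: has_derivative_add simp: algebra_simps)
qed

lemma holo_fun_on_mult:
  assumes "holo_fun_on f S" "holo_fun_on g S"
  shows "holo_fun_on (\<lambda>x. f x * g x) S"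
  unfolding holo_fun_on_def
proof
  fix x assume x: "x \<in> S"
  show "\<exists>d. ((\<lambda>x. f x * g x) has_derivative d) (at x) \<and> (\<forall>k v. d (k *s v) = k * d v)"
    using holo_fun_onD[OF assms(1) x] holo_fun_onD[OF assms(2) x]
    by (intro exI[of _ "\<lambda>v. f x * fd g x v + fd f x v * g x"] conjI has_derivative_mult)
       (simp_all add: algebra_simps)
qed

lemma holo_fun_on_inverse:
  assumes "holo_fun_on f S" "\<And>x. x \<in> S \<Longrightarrow> f x \<noteq> 0"
  shows "holo_fun_on (\<lambda>x. inverse (f x)) S"
  unfolding holo_fun_on_def
proof
  fix x assume x: "x \<in> S"
  show "\<exists>d. ((\<lambda>x. inverse (f x)) has_derivative d) (at x) \<and> (\<forall>k v. d (k *s v) = k * d v)"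
    using holo_fun_onD[OF assms(1) x] assms(2)[OF x]
    by (intro exI[of _ "\<lambda>v. - (inverse (f x) * fd f x v * inverse (f x))"] conjI Deriv.has_derivative_inverse)
       (simp_all add: algebra_simps)
qed

lemma holo_fun_on_sum: "(\<And>i. i \<in> I \<Longrightarrow> holo_fun_on (f i) S) \<Longrightarrow> holo_fun_on (\<lambda>x. \<Sum>i\<in>I. f i x) S"
  by (induction I rule: infinite_finite_induct) (auto intro: holo_fun_on_add holo_fun_on_const)

lemma holo_fun_on_prod: "(\<And>i. i \<in> I \<Longrightarrow> holo_fun_on (f i) S) \<Longrightarrow> holo_fun_on (\<lambda>x. \<Prod>i\<in>I. f i x) S"
  by (induction I rule: infinite_finite_induct) (auto intro: holo_fun_on_mult holo_fun_on_const)

lemmas holo_fun_on_intros = holo_fun_on_const holo_fun_on_nth holo_fun_on_add holo_fun_on_mult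
  holo_fun_on_inverse holo_fun_on_sum holo_fun_on_prod

lemma holo_vec_on_const: "holo_vec_on (\<lambda>x. c) S"
  unfolding holo_vec_on_def by (simp add: holo_fun_on_const)

lemma holo_vec_on_add: "holo_vec_on f S \<Longrightarrow> holo_vec_on g S \<Longrightarrow> holo_vec_on (\<lambda>x. f x + g x) S"
  unfolding holo_vec_on_def by (auto intro: holo_fun_on_add)

lemma holo_vec_on_scale: "holo_fun_on f S \<Longrightarrow> holo_vec_on g S \<Longrightarrow> holo_vec_on (\<lambda>x. f x *s g x) S"
  unfolding holo_vec_on_def by (auto intro: holo_fun_on_mult)

lemma holo_vec_on_sum: "(\<And>i. i \<in> I \<Longrightarrow> holo_vec_on (f i) S) \<Longrightarrow> holo_vec_on (\<lambda>x. \<Sum>i\<in>I. f i x) S"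
  by (induction I rule: infinite_finite_induct) (auto intro: holo_vec_on_add holo_vec_on_const)

lemma holo_fun_on_compose:
  assumes "holo_fun_on f T" "holo_vec_on g S" "\<And>x. x \<in> S \<Longrightarrow> g x \<in> T"
  shows "holo_fun_on (\<lambda>x. f (g x)) S"
  unfolding holo_fun_on_def
proof
  fix x assume x: "x \<in> S"
  then have gx: "g x \<in> T" using assms by blast
  have "((f \<circ> g) has_derivative (fd f (g x) \<circ> fd g x)) (at x)"
    by (intro diff_chain_at holo_vec_onD(1)[OF assms(2) x] holo_fun_onD(1)[OF assms(1) gx])
  then show "\<exists>d. ((\<lambda>x. f (g x)) has_derivative d) (at x) \<and> (\<forall>k v. d (k *s v) = k * d v)"
    using holo_fun_onD(2)[OF assms(1) gx] clin_simps(2)[OF holo_vec_onD(2)[OF assms(2) x]]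
    by (intro exI[of _ "fd f (g x) \<circ> fd g x"]) (auto simp: o_def)
qed

lemma holo_vec_on_compose:
  assumes "holo_vec_on f T" "holo_vec_on g S" "\<And>x. x \<in> S \<Longrightarrow> g x \<in> T"
  shows "holo_vec_on (\<lambda>x. f (g x)) S"
  unfolding holo_vec_on_def
  using assms holo_fun_on_compose[OF _ assms(2,3)] by (auto simp: holo_vec_on_def)

lemma fd_compose:
  assumes "f differentiable at (g x)" "g differentiable at x"
  shows "fd (\<lambda>x. f (g x)) x v = fd f (g x) (fd g x v)"
  using frechet_derivative_compose[OF assms(2,1)] by (simp add: o_def)

text \<open>Componentwise complex derivatives keep the one-variable library applicable to each
  component; \<open>curve_deriv_iff\<close> is the equivalent vector form.\<close>

definition curve_deriv :: "(complex \<Rightarrow> complex^'n) \<Rightarrow> complex^'n \<Rightarrow> complex \<Rightarrow> bool" where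
  "curve_deriv c v t \<longleftrightarrow> (\<forall>i. ((\<lambda>t. c t $ i) has_field_derivative v $ i) (at t))"

lemma curve_deriv_iff: "curve_deriv c v t \<longleftrightarrow> (c has_derivative (\<lambda>h. h *s v)) (at t)"
proof -
  have "(*) (v $ i) = (\<lambda>h. h * v $ i)" for i
    by (auto simp: fun_eq_iff)
  then show ?thesis
    unfolding curve_deriv_def has_derivative_vec_iff has_field_derivative_def by simp
qed

lemma curve_deriv_line: "curve_deriv (\<lambda>t. x + t *s v) v t"
  unfolding curve_deriv_def by (auto intro!: derivative_eq_intros)

lemma curve_chain_fun:
  assumes "holo_fun_on f S" "c t \<in> S" "curve_deriv c v t"
  shows "((\<lambda>t. f (c t)) has_field_derivative fd f (c t) v) (at t)"
proof -
  have "((f \<circ> c) has_derivative (fd f (c t) \<circ> (\<lambda>h. h *s v))) (at t)"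
    using assms by (intro diff_chain_at) (auto simp: curve_deriv_iff holo_fun_onD)
  then show ?thesis
    using holo_fun_onD(2)[OF assms(1,2)] unfolding has_field_derivative_def o_def
    by (simp add: mult.commute[of _ "fd f (c t) v"])
qed

lemma curve_chain:
  assumes "holo_vec_on f S" "c t \<in> S" "curve_deriv c v t"
  shows "curve_deriv (\<lambda>t. f (c t)) (fd f (c t) v) t"
  unfolding curve_deriv_def
proof
  fix i
  have "((\<lambda>t. f (c t) $ i) has_field_derivative fd (\<lambda>y. f y $ i) (c t) v) (at t)"
    by (rule curve_chain_fun[OF _ assms(2,3)]) (use assms(1) in \<open>simp add: holo_vec_on_def\<close>)
  then show "((\<lambda>t. f (c t) $ i) has_field_derivative fd f (c t) v $ i) (at t)"
    by (simp add: holo_vec_onD(4)[OF assms(1,2)])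
qed

section \<open>Cauchy estimates and higher derivatives\<close>

lemma fd_zero_direction:
  assumes "holo_fun_on f S" "x \<in> S"
  shows "fd f x 0 = 0"
  using holo_fun_onD(2)[OF assms, of 0 0] by simp

text \<open>Restricted to the complex line through \<open>x\<close> in direction \<open>v\<close> the function is
  holomorphic on a disc of radius \<open>\<rho> / \<parallel>v\<parallel>\<close>, and the one-variable Cauchy inequality applies.\<close>

lemma cauchy_estimate_fd:
  assumes f: "holo_fun_on f S" and sub: "cball x \<rho> \<subseteq> S" and \<rho>: "0 < \<rho>"
    and M: "\<And>y. y \<in> cball x \<rho> \<Longrightarrow> norm (f y) \<le> M"
  shows "norm (fd f x v) \<le> M * norm v / \<rho>"
proof (cases "v = 0")
  case True
  have "x \<in> S" using sub \<rho> by auto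
  then show ?thesis using fd_zero_direction[OF f] True by simp
next
  case False
  define r where "r = \<rho> / norm v"
  have r: "r > 0" using False \<rho> by (simp add: r_def)
  define g where "g = (\<lambda>t. f (x + t *s v))"
  have inb: "x + t *s v \<in> cball x \<rho>" if "t \<in> cball 0 r" for t
  proof -
    have "norm t * norm v \<le> r * norm v" using that by (intro mult_right_mono) auto
    then show ?thesis using False by (simp add: dist_norm norm_vector_scale r_def)
  qed
  have der: "(g has_field_derivative fd f (x + t *s v) v) (at t)" if "t \<in> cball 0 r" for t
    unfolding g_def by (rule curve_chain_fun[OF f _ curve_deriv_line]) (use inb[OF that] sub in blast)
  have "norm ((deriv ^^ 1) g 0) \<le> fact 1 * M / r ^ 1"
  proof (rule Cauchy_inequality)
    show "g holomorphic_on ball 0 r"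
      unfolding holomorphic_on_open[OF open_ball] using der by (meson ball_subset_cball subsetD)
    show "continuous_on (cball 0 r) g"
      using der by (meson DERIV_continuous continuous_at_imp_continuous_on)
    show "norm (g t) \<le> M" if "norm (0 - t) = r" for t
      unfolding g_def using that by (intro M inb) auto
  qed (use r in auto)
  moreover have "deriv g 0 = fd f x v"
    using DERIV_imp_deriv[OF der[of 0]] r by simp
  ultimately show ?thesis
    by (simp add: r_def field_simps)
qed

lemma holo_fun_lipschitz:
  assumes f: "holo_fun_on f S" and sub: "cball x (2 * \<rho>) \<subseteq> S" and \<rho>: "0 < \<rho>"
    and M: "\<And>y. y \<in> cball x (2 * \<rho>) \<Longrightarrow> norm (f y) \<le> M"
    and y: "y \<in> cball x \<rho>" and z: "z \<in> cball x \<rho>"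
  shows "norm (f y - f z) \<le> M / \<rho> * norm (y - z)"
proof (rule differentiable_bound[OF convex_cball, of x \<rho> f "fd f"])
  fix a assume a: "a \<in> cball x \<rho>"
  have in2: "cball a \<rho> \<subseteq> cball x (2 * \<rho>)"
  proof
    fix b assume "b \<in> cball a \<rho>"
    then show "b \<in> cball x (2 * \<rho>)"
      using a dist_triangle[of x b a] by simp
  qed
  have "a \<in> S" using sub a \<rho> by auto
  then show "(f has_derivative fd f a) (at a within cball x \<rho>)"
    using holo_fun_onD(1)[OF f] has_derivative_at_withinI by blast
  show "onorm (fd f a) \<le> M / \<rho>"
  proof (rule onorm_le)
    fix v
    show "norm (fd f a v) \<le> M / \<rho> * norm v"
      using cauchy_estimate_fd[OF f subset_trans[OF in2 sub] \<rho> M, of v] in2 by (simp add: subset_iff)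
  qed
qed (use y z in auto)

text \<open>Taylor's formula of order two on a complex line, with the second derivative
  bounded by the Cauchy inequality on discs of radius \<open>\<epsilon>\<close>. It makes difference quotients
  converge uniformly to the directional derivative.\<close>

lemma line_taylor_bound:
  assumes f: "holo_fun_on f S" and sub: "cball x (2 * \<epsilon> * norm v) \<subseteq> S" and \<epsilon>: "0 < \<epsilon>"
    and M: "\<And>y. y \<in> cball x (2 * \<epsilon> * norm v) \<Longrightarrow> norm (f y) \<le> M"
    and h: "norm h \<le> \<epsilon>"
  shows "norm (f (x + h *s v) - f x - h * fd f x v) \<le> 2 * M / \<epsilon>\<^sup>2 * norm h ^ 2"
proof -
  define \<phi> where "\<phi> = (\<lambda>t. f (x + t *s v))"
  have inb: "x + t *s v \<in> cball x (2 * \<epsilon> * norm v)" if "norm t \<le> 2 * \<epsilon>" for t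
    using that by (simp add: dist_norm norm_vector_scale mult_right_mono)
  have der: "(\<phi> has_field_derivative fd f (x + t *s v) v) (at t)" if "norm t \<le> 2 * \<epsilon>" for t
    unfolding \<phi>_def by (rule curve_chain_fun[OF f _ curve_deriv_line]) (use inb[OF that] sub in blast)
  have hol: "\<phi> holomorphic_on ball 0 (2 * \<epsilon>)"
    unfolding holomorphic_on_open[OF open_ball]
  proof
    fix t :: complex assume "t \<in> ball 0 (2 * \<epsilon>)"
    then have "norm t \<le> 2 * \<epsilon>" by simp
    from der[OF this] show "\<exists>f'. (\<phi> has_field_derivative f') (at t)" ..
  qed
  have d0: "deriv \<phi> 0 = fd f x v"
    using DERIV_imp_deriv[OF der[of 0]] \<epsilon> by simp
  have "norm ((deriv ^^ 0) \<phi> h - (\<Sum>i\<le>1. (deriv ^^ i) \<phi> 0 * (h - 0) ^ i / fact i))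
      \<le> 2 * M / \<epsilon>\<^sup>2 * norm (h - 0) ^ Suc 1 / fact 1"
  proof (rule complex_Taylor[of "cball 0 \<epsilon>" 1 "\<lambda>i. (deriv ^^ i) \<phi>"])
    fix i :: nat and t :: complex assume "t \<in> cball 0 \<epsilon>" "i \<le> 1"
    then have "t \<in> ball 0 (2 * \<epsilon>)" using \<epsilon> by auto
    then show "((deriv ^^ i) \<phi> has_field_derivative (deriv ^^ Suc i) \<phi> t) (at t within cball 0 \<epsilon>)"
      using holomorphic_derivI[OF holomorphic_higher_deriv[OF hol, of i]]
      by (auto intro: has_field_derivative_at_within)
  next
    fix t :: complex assume t: "t \<in> cball 0 \<epsilon>"
    have le2: "norm s \<le> 2 * \<epsilon>" if "s \<in> cball t \<epsilon>" for s
    proof -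
      have "norm s \<le> norm t + norm (s - t)" by (metis add.commute diff_add_cancel norm_triangle_ineq)
      then show ?thesis using t that by (simp add: dist_norm norm_minus_commute)
    qed
    have "norm ((deriv ^^ 2) \<phi> t) \<le> fact 2 * M / \<epsilon> ^ 2"
    proof (rule Cauchy_inequality)
      show "\<phi> holomorphic_on ball t \<epsilon>"
        unfolding holomorphic_on_open[OF open_ball] using der le2 by (meson ball_subset_cball subsetD)
      show "continuous_on (cball t \<epsilon>) \<phi>"
        using der le2 by (meson DERIV_continuous continuous_at_imp_continuous_on)
      show "norm (\<phi> s) \<le> M" if "norm (t - s) = \<epsilon>" for s
        unfolding \<phi>_def using that by (intro M inb le2) (simp add: dist_norm)
    qed (use \<epsilon> in auto)
    then show "norm ((deriv ^^ Suc 1) \<phi> t) \<le> 2 * M / \<epsilon>\<^sup>2"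
      by (simp add: numeral_2_eq_2)
  qed (use h \<epsilon> in auto)
  moreover have "(deriv ^^ 0) \<phi> h - (\<Sum>i\<le>1. (deriv ^^ i) \<phi> 0 * (h - 0) ^ i / fact i)
      = f (x + h *s v) - f x - h * fd f x v"
    by (simp add: d0) (simp add: \<phi>_def)
  ultimately show ?thesis
    by (simp add: power2_eq_square)
qed

text \<open>The difference quotients of \<open>f\<close> in direction \<open>v\<close> are
  holomorphic and converge uniformly near \<open>x0\<close>; by Cauchy estimates their derivatives converge
  uniformly as well. Hence the limit is differentiable, with derivative the limit of the
  derivatives. That derivative is given as an explicit limit because both its complex
  linearity and the symmetry of second derivatives can be read off from the limit.\<close>

lemma directional_derivative_differentiable:
  assumes f: "holo_fun_on f S" and S: "open S" "x0 \<in> S"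
  obtains G h where "h \<longlonglongrightarrow> 0" "\<And>k. h k \<noteq> (0::complex)"
    "((\<lambda>x. fd f x v) has_derivative G) (at x0)"
    "\<And>w. (\<lambda>k. (fd f (x0 + h k *s v) w - fd f x0 w) / h k) \<longlonglongrightarrow> G w"
proof -
  obtain e where e: "e > 0" "cball x0 e \<subseteq> S"
    using S open_contains_cball by blast
  \<comment> \<open>One \<open>\<rho>\<close> for the final ball, one for Cauchy estimates around its points, two for the line segments in the Taylor bound.\<close>
  define \<rho> where "\<rho> = e / 4"
  have \<rho>: "\<rho> > 0" "cball x0 (4 * \<rho>) \<subseteq> S" using e by (auto simp: \<rho>_def)
  have "compact (f ` cball x0 (4 * \<rho>))"
    using \<rho> by (intro compact_continuous_image holo_fun_on_continuous holo_fun_on_subset[OF f]) auto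
  then have "\<exists>M. \<forall>z \<in> f ` cball x0 (4 * \<rho>). norm z \<le> M"
    using compact_imp_bounded bounded_iff by blast
  then obtain M where M: "\<And>y. y \<in> cball x0 (4 * \<rho>) \<Longrightarrow> norm (f y) \<le> M"
    by blast
  have M0: "M \<ge> 0" using order_trans[OF norm_ge_zero M[of x0]] \<rho> by simp
  \<comment> \<open>The summand 1 avoids a division by zero for \<open>v = 0\<close>.\<close>
  define \<epsilon> where "\<epsilon> = \<rho> / (norm v + 1)"
  have \<epsilon>: "\<epsilon> > 0" "\<epsilon> * norm v \<le> \<rho>"
  proof -
    have pos: "norm v + 1 > 0" by (simp add: add_nonneg_pos)
    then show "\<epsilon> > 0" using \<rho> by (simp add: \<epsilon>_def)
    show "\<epsilon> * norm v \<le> \<rho>" using \<rho> pos by (simp add: \<epsilon>_def divide_le_eq algebra_simps)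
  qed
  define h where "h = (\<lambda>k. complex_of_real (\<epsilon> / real (Suc k)))"
  have hn: "norm (h k) = \<epsilon> / real (Suc k)" for k
    using \<epsilon> by (simp add: h_def norm_divide del: of_nat_Suc)
  have h0: "h k \<noteq> 0" for k using \<epsilon> by (simp add: h_def del: of_nat_Suc)
  have hle: "norm (h k) \<le> \<epsilon>" for k unfolding hn using \<epsilon> by (simp add: field_simps)
  have hmono: "norm (h l) \<le> norm (h k)" if "k \<le> l" for k l
    unfolding hn using \<epsilon> that by (simp add: frac_le)
  have hlim: "(\<lambda>k. norm (h k)) \<longlonglongrightarrow> 0"
    unfolding hn using LIMSEQ_Suc[OF lim_const_over_n[of \<epsilon>]] by simp
  define C where "C = 2 * M / \<epsilon>\<^sup>2"
  have C: "C \<ge> 0" using M0 by (simp add: C_def)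
  define q where "q = (\<lambda>k x. (f (x + h k *s v) - f x) / h k)"
  have near: "norm (q k x - fd f x v) \<le> C * norm (h k)" if x: "x \<in> cball x0 (2 * \<rho>)" for k x
  proof -
    have sub: "cball x (2 * \<epsilon> * norm v) \<subseteq> cball x0 (4 * \<rho>)"
    proof
      fix y assume "y \<in> cball x (2 * \<epsilon> * norm v)"
      then show "y \<in> cball x0 (4 * \<rho>)"
        using x \<epsilon>(2) dist_triangle[of x0 y x] by simp
    qed
    have "norm (f (x + h k *s v) - f x - h k * fd f x v) \<le> C * norm (h k) ^ 2"
      unfolding C_def by (rule line_taylor_bound[OF f _ \<epsilon>(1)]) (use sub \<rho> M hle in auto)
    moreover have "q k x - fd f x v = (f (x + h k *s v) - f x - h k * fd f x v) / h k"
      using h0[of k] by (simp add: q_def diff_divide_distrib)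
    ultimately show ?thesis
      using h0[of k] by (simp add: norm_divide divide_le_eq power2_eq_square mult.assoc)
  qed
  have shift: "x + h k *s v \<in> S" "x \<in> S" if "x \<in> ball x0 (3 * \<rho>)" for k x
  proof -
    have "norm (h k *s v) \<le> \<epsilon> * norm v"
      using hle[of k] by (simp add: norm_vector_scale mult_right_mono)
    then have "dist x0 (x + h k *s v) \<le> 4 * \<rho>"
      using that \<epsilon>(2) dist_triangle[of x0 "x + h k *s v" x] by (simp add: dist_norm)
    then show "x + h k *s v \<in> S" using \<rho> by auto
    show "x \<in> S" using that \<rho> by (auto simp: subset_eq)
  qed
  define Q where "Q = (\<lambda>k x w. (fd f (x + h k *s v) w - fd f x w) / h k)"
  have qder: "(q k has_derivative Q k x) (at x)" if "x \<in> ball x0 (3 * \<rho>)" for k x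
  proof -
    have 1: "((\<lambda>x. f (x + h k *s v)) has_derivative fd f (x + h k *s v)) (at x)"
    proof (rule has_derivative_compose[of "\<lambda>x. x + h k *s v" "\<lambda>w. w" x UNIV f])
      show "((\<lambda>x. x + h k *s v) has_derivative (\<lambda>w. w)) (at x)"
        by (auto intro!: derivative_eq_intros)
      show "(f has_derivative fd f (x + h k *s v)) (at (x + h k *s v))"
        by (rule holo_fun_onD(1)[OF f shift(1)[OF that]])
    qed
    show ?thesis
      unfolding q_def Q_def divide_inverse
      by (intro has_derivative_mult_left has_derivative_diff 1 holo_fun_onD(1)[OF f shift(2)[OF that]])
  qed
  have Qhom: "Q k x (c *s w) = c * Q k x w" if "x \<in> ball x0 (3 * \<rho>)" for k x c w
    using holo_fun_onD(2)[OF f shift(1)[OF that]] holo_fun_onD(2)[OF f shift(2)[OF that]]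
    by (simp add: Q_def algebra_simps)
  have close: "norm (Q k x w - Q l x w) \<le> 2 * C * norm (h k) * norm w / \<rho>"
    if x: "x \<in> ball x0 \<rho>" and kl: "k \<le> l" for k l x w
  proof -
    have sub: "cball x \<rho> \<subseteq> ball x0 (2 * \<rho>)"
    proof
      fix y assume "y \<in> cball x \<rho>"
      then show "y \<in> ball x0 (2 * \<rho>)"
        using x dist_triangle[of x0 y x] by simp
    qed
    have x3: "y \<in> ball x0 (3 * \<rho>)" if "y \<in> ball x0 (2 * \<rho>)" for y using that \<rho> by simp
    have hol: "holo_fun_on (\<lambda>x. q k x - q l x) (ball x0 (2 * \<rho>))"
      unfolding holo_fun_on_def
    proof (intro ballI exI conjI allI)
      fix y assume y: "y \<in> ball x0 (2 * \<rho>)"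
      show "((\<lambda>x. q k x - q l x) has_derivative (\<lambda>w. Q k y w - Q l y w)) (at y)"
        by (intro has_derivative_diff qder x3 y)
      show "Q k y (c *s w) - Q l y (c *s w) = c * (Q k y w - Q l y w)" for c w
        by (simp add: Qhom[OF x3[OF y]] algebra_simps)
    qed
    have "norm (q k y - q l y) \<le> 2 * C * norm (h k)" if "y \<in> cball x \<rho>" for y
    proof -
      have y: "y \<in> cball x0 (2 * \<rho>)" using sub that by auto
      have "norm (q k y - q l y) \<le> norm (q k y - fd f y v) + norm (q l y - fd f y v)"
        by (metis norm_triangle_ineq4 diff_diff_eq2 diff_add_cancel)
      also have "\<dots> \<le> C * norm (h k) + C * norm (h l)"
        using near[OF y] by (intro add_mono)
      also have "\<dots> \<le> C * norm (h k) + C * norm (h k)"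
        using C hmono[OF kl] by (intro add_left_mono mult_left_mono)
      finally show ?thesis by simp
    qed
    from cauchy_estimate_fd[OF hol sub \<rho>(1) this]
    have "norm (fd (\<lambda>x. q k x - q l x) x w) \<le> 2 * C * norm (h k) * norm w / \<rho>" .
    moreover have "fd (\<lambda>x. q k x - q l x) x = (\<lambda>w. Q k x w - Q l x w)"
      using x \<rho> by (intro frechet_derivative_at[symmetric] has_derivative_diff qder) auto
    ultimately show ?thesis by simp
  qed
  define K where "K = (\<lambda>k. 2 * C * norm (h k) / \<rho>)"
  have K0: "K \<longlonglongrightarrow> 0"
    unfolding K_def using tendsto_mult_right[OF hlim, of "2 * C / \<rho>"] by (simp add: mult.commute mult.left_commute)
  have close': "norm (Q k x w - Q l x w) \<le> K k * norm w" if "x \<in> ball x0 \<rho>" "k \<le> l" for k l x w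
    using close[OF that, of w] by (simp add: K_def)
  have Qlim: "(\<lambda>k. Q k x w) \<longlonglongrightarrow> lim (\<lambda>k. Q k x w)" if x: "x \<in> ball x0 \<rho>" for x w
  proof -
    have "Cauchy (\<lambda>k. Q k x w)"
      unfolding Cauchy_altdef2
    proof (intro allI impI)
      fix e :: real assume "e > 0"
      have "(\<lambda>k. K k * norm w) \<longlonglongrightarrow> 0" using tendsto_mult_right[OF K0, of "norm w"] by (simp add: mult.commute)
      then have "\<forall>\<^sub>F k in sequentially. K k * norm w < e"
        using \<open>e > 0\<close> by (rule order_tendstoD(2))
      then obtain N where "K N * norm w < e" by (auto simp: eventually_sequentially)
      then show "\<exists>N. \<forall>n\<ge>N. dist (Q n x w) (Q N x w) < e"
        using close'[OF x] by (metis dist_norm norm_minus_commute order_le_less_trans)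
    qed
    then show ?thesis using Cauchy_convergent convergent_LIMSEQ_iff by blast
  qed
  define G where "G = (\<lambda>x w. lim (\<lambda>k. Q k x w))"
  have Gclose: "norm (Q k x w - G x w) \<le> K k * norm w" if x: "x \<in> ball x0 \<rho>" for k x w
  proof (rule Lim_norm_ubound[OF sequentially_bot])
    show "(\<lambda>l. Q k x w - Q l x w) \<longlonglongrightarrow> Q k x w - G x w"
      unfolding G_def by (intro tendsto_intros Qlim x)
    show "\<forall>\<^sub>F l in sequentially. norm (Q k x w - Q l x w) \<le> K k * norm w"
      using close'[OF x] eventually_sequentially by blast
  qed
  have qlim: "(\<lambda>k. q k x) \<longlonglongrightarrow> fd f x v" if "x \<in> cball x0 (2 * \<rho>)" for x
  proof -
    have "(\<lambda>k. C * norm (h k)) \<longlonglongrightarrow> 0" using tendsto_mult_left[OF hlim, of C] by simp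
    then have "(\<lambda>k. q k x - fd f x v) \<longlonglongrightarrow> 0"
      by (rule Lim_null_comparison[rotated]) (use near[OF that] in auto)
    then show ?thesis using LIM_zero_iff by blast
  qed
  have "\<exists>g. \<forall>x\<in>ball x0 \<rho>. (\<lambda>k. q k x) \<longlonglongrightarrow> g x \<and> (g has_derivative G x) (at x within ball x0 \<rho>)"
  proof (rule has_derivative_sequence[where f = q and f' = Q and g' = G and S = "ball x0 \<rho>"
          and ?x0.0 = x0 and l = "fd f x0 v", OF convex_ball])
    show "(q n has_derivative Q n x) (at x within ball x0 \<rho>)" if "x \<in> ball x0 \<rho>" for n x
      by (rule has_derivative_at_withinI, rule qder) (use that \<rho> in auto)
    show "\<forall>\<^sub>F n in sequentially. \<forall>x\<in>ball x0 \<rho>. \<forall>w. norm (Q n x w - G x w) \<le> e * norm w" if "e > 0" for e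
    proof -
      have "\<forall>\<^sub>F k in sequentially. K k < e" using K0 that by (rule order_tendstoD(2))
      then show ?thesis
      proof eventually_elim
        case (elim k)
        have "K k * norm w \<le> e * norm w" for w :: "complex^'a" using elim by (intro mult_right_mono) auto
        then show ?case using Gclose[of _ k] order_trans by blast
      qed
    qed
    show "x0 \<in> ball x0 \<rho>" "(\<lambda>k. q k x0) \<longlonglongrightarrow> fd f x0 v" using \<rho> qlim[of x0] by auto
  qed
  then obtain g where g: "\<And>x. x \<in> ball x0 \<rho> \<Longrightarrow> (\<lambda>k. q k x) \<longlonglongrightarrow> g x"
    "\<And>x. x \<in> ball x0 \<rho> \<Longrightarrow> (g has_derivative G x) (at x within ball x0 \<rho>)" by blast
  have gx: "g x = fd f x v" if "x \<in> ball x0 \<rho>" for x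
    using LIMSEQ_unique[OF g(1)[OF that] qlim] that \<rho> by auto
  have x0: "x0 \<in> ball x0 \<rho>" using \<rho> by simp
  have "(g has_derivative G x0) (at x0)"
    using g(2)[OF x0] at_within_open[OF x0 open_ball] by simp
  then have "((\<lambda>x. fd f x v) has_derivative G x0) (at x0)"
    by (rule has_derivative_transform_within_open[OF _ open_ball x0]) (rule gx)
  moreover have "(\<lambda>k. (fd f (x0 + h k *s v) w - fd f x0 w) / h k) \<longlonglongrightarrow> G x0 w" for w
    using Qlim[OF x0, of w] unfolding G_def Q_def .
  moreover have "h \<longlonglongrightarrow> 0" using hlim tendsto_norm_zero_iff by blast
  ultimately show ?thesis using that h0 by blast
qed

lemma holo_fun_directional_derivative:
  assumes f: "holo_fun_on f S" and S: "open S"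
  shows "holo_fun_on (\<lambda>x. fd f x v) S"
  unfolding holo_fun_on_def
proof
  fix x assume x: "x \<in> S"
  obtain G h where h: "h \<longlonglongrightarrow> 0" "\<And>k. h k \<noteq> 0" and G: "((\<lambda>x. fd f x v) has_derivative G) (at x)"
    and lim: "\<And>w. (\<lambda>k. (fd f (x + h k *s v) w - fd f x w) / h k) \<longlonglongrightarrow> G w"
    by (rule directional_derivative_differentiable[OF f S x, of v]) blast
  have ev: "\<forall>\<^sub>F k in sequentially. x + h k *s v \<in> S"
  proof -
    have "(\<lambda>k. h k *s v) \<longlonglongrightarrow> 0 *s v"
      by (rule bounded_linear.tendsto[OF bounded_linear_vector_scale h(1)])
    then have "(\<lambda>k. x + h k *s v) \<longlonglongrightarrow> x"
      using tendsto_add[OF tendsto_const[of x]] by fastforce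
    then show ?thesis using S x topological_tendstoD by blast
  qed
  have "G (c *s w) = c * G w" for c w
  proof (rule LIMSEQ_unique[OF lim[of "c *s w"]])
    have *: "(\<lambda>k. c * ((fd f (x + h k *s v) w - fd f x w) / h k)) \<longlonglongrightarrow> c * G w"
      by (intro tendsto_intros lim)
    show "(\<lambda>k. (fd f (x + h k *s v) (c *s w) - fd f x (c *s w)) / h k) \<longlonglongrightarrow> c * G w"
      by (rule Lim_transform_eventually[OF *])
        (use ev in eventually_elim, simp add: holo_fun_onD(2)[OF f] x algebra_simps)
  qed
  then show "\<exists>f'. ((\<lambda>x. fd f x v) has_derivative f') (at x) \<and> (\<forall>k v. f' (k *s v) = k * f' v)"
    using G by blast
qed

text \<open>The derivative of \<open>\<partial>\<^sub>v f\<close> in direction \<open>w\<close> is the limit of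
  the difference quotients of \<open>\<partial>\<^sub>w f\<close> in direction \<open>v\<close>, and that limit is the derivative of
  \<open>\<partial>\<^sub>w f\<close> in direction \<open>v\<close>.\<close>

lemma holo_fun_second_derivative_symmetric:
  assumes f: "holo_fun_on f S" and S: "open S" and x: "x \<in> S"
  shows "fd (\<lambda>y. fd f y v) x w = fd (\<lambda>y. fd f y w) x v"
proof -
  obtain G h where h: "h \<longlonglongrightarrow> 0" "\<And>k. h k \<noteq> 0" and G: "((\<lambda>x. fd f x v) has_derivative G) (at x)"
    and lim: "\<And>w. (\<lambda>k. (fd f (x + h k *s v) w - fd f x w) / h k) \<longlonglongrightarrow> G w"
    by (rule directional_derivative_differentiable[OF f S x, of v]) blast
  have "((\<lambda>t. fd f (x + t *s v) w) has_field_derivative fd (\<lambda>y. fd f y w) x v) (at 0)"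
    using curve_chain_fun[OF holo_fun_directional_derivative[OF f S, of w] _ curve_deriv_line, of x 0 v] x by simp
  then have "((\<lambda>t. (fd f (x + t *s v) w - fd f x w) / t) \<longlongrightarrow> fd (\<lambda>y. fd f y w) x v) (at 0)"
    by (simp add: has_field_derivative_iff)
  moreover have "filterlim h (at 0) sequentially"
    using h by (simp add: filterlim_at)
  ultimately have "(\<lambda>k. (fd f (x + h k *s v) w - fd f x w) / h k) \<longlonglongrightarrow> fd (\<lambda>y. fd f y w) x v"
    by (rule filterlim_compose)
  then have "G w = fd (\<lambda>y. fd f y w) x v"
    using lim LIMSEQ_unique by blast
  then show ?thesis
    using frechet_derivative_at[OF G] by simp
qed

lemma holo_vec_directional_derivative:
  assumes f: "holo_vec_on f S" and S: "open S"
  shows "holo_vec_on (\<lambda>x. fd f x v) S"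
  unfolding holo_vec_on_def
proof
  fix i
  have "holo_fun_on (\<lambda>x. fd (\<lambda>y. f y $ i) x v) S"
    using f S by (intro holo_fun_directional_derivative) (auto simp: holo_vec_on_def)
  then show "holo_fun_on (\<lambda>x. fd f x v $ i) S"
    by (rule holo_fun_on_cong[OF _ S]) (simp add: holo_vec_onD(4)[OF f])
qed

lemma holo_vec_second_derivative_symmetric:
  assumes f: "holo_vec_on f S" and S: "open S" and x: "x \<in> S"
  shows "fd (\<lambda>y. fd f y v) x w = fd (\<lambda>y. fd f y w) x v"
proof -
  have "fd (\<lambda>y. fd f y v) x w $ i = fd (\<lambda>y. fd f y w) x v $ i" for i
  proof -
    have fi: "holo_fun_on (\<lambda>y. f y $ i) S" using f by (simp add: holo_vec_on_def)
    have *: "fd (\<lambda>y. fd f y v) x w $ i = fd (\<lambda>y. fd (\<lambda>y. f y $ i) y v) x w" for v w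
      unfolding holo_vec_onD(4)[OF holo_vec_directional_derivative[OF f S] x]
      by (rule arg_cong[of _ _ "\<lambda>g. g w"], rule fd_cong[OF S x]) (simp add: holo_vec_onD(4)[OF f])
    show ?thesis
      unfolding * by (rule holo_fun_second_derivative_symmetric[OF fi S x])
  qed
  then show ?thesis by (simp add: vec_eq_iff)
qed

lemma holo_vec_locally_lipschitz:
  fixes f :: "complex^'n \<Rightarrow> complex^'m"
  assumes f: "holo_vec_on f S" and S: "open S" and x: "x \<in> S"
  obtains R L where "R > 0" "L \<ge> 0" "cball x R \<subseteq> S"
    "\<And>y z. y \<in> cball x R \<Longrightarrow> z \<in> cball x R \<Longrightarrow> norm (f y - f z) \<le> L * norm (y - z)"
proof -
  obtain e where e: "e > 0" "cball x e \<subseteq> S"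
    using S x open_contains_cball by blast
  have "compact (f ` cball x e)"
    using e by (intro compact_continuous_image holo_vec_on_continuous holo_vec_on_subset[OF f]) auto
  then have "\<exists>M. \<forall>z \<in> f ` cball x e. norm z \<le> M"
    using compact_imp_bounded bounded_iff by blast
  then obtain M where M: "\<And>y. y \<in> cball x e \<Longrightarrow> norm (f y) \<le> M"
    by blast
  have M0: "M \<ge> 0" using order_trans[OF norm_ge_zero M[of x]] e by simp
  have Mi: "norm (f y $ i) \<le> M" if "y \<in> cball x e" for y i
    using M[OF that] Finite_Cartesian_Product.norm_nth_le[of "f y" i] by linarith
  have fi: "norm (f y $ i - f z $ i) \<le> M / (e / 2) * norm (y - z)"
    if "y \<in> cball x (e / 2)" "z \<in> cball x (e / 2)" for y z i
    by (rule holo_fun_lipschitz[of "\<lambda>y. f y $ i" S x "e / 2"])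
      (use that e Mi f in \<open>auto simp: holo_vec_on_def\<close>)
  have "norm (f y - f z) \<le> (real CARD('m) * (M / (e / 2))) * norm (y - z)"
    if "y \<in> cball x (e / 2)" "z \<in> cball x (e / 2)" for y z
  proof -
    have "norm (f y - f z) \<le> (\<Sum>i\<in>UNIV. norm ((f y - f z) $ i))"
      by (simp add: norm_vec_def L2_set_le_sum)
    also have "\<dots> \<le> (\<Sum>i\<in>(UNIV::'m set). M / (e / 2) * norm (y - z))"
      using fi[OF that] by (intro sum_mono) simp
    finally show ?thesis by simp
  qed
  then show ?thesis
    using that[of "e / 2" "real CARD('m) * (M / (e / 2))"] e M0 by fastforce
qed

section \<open>Holomorphic families of linear maps and brackets of vector fields\<close>

lemma bounded_bilinear_vector_scale: "bounded_bilinear (\<lambda>k (v::complex^'n). k *s v)"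
proof
  show "\<exists>K. \<forall>a (b::complex^'n). norm (a *s b) \<le> norm a * norm b * K"
    by (intro exI[of _ 1]) (simp add: norm_vector_scale)
qed (simp_all add: vec_eq_iff algebra_simps)

text \<open>Expanding the argument in the standard basis turns an application of a varying linear map
  into a finite sum of products of holomorphic functions. The derivative therefore obeys a product
  rule: one term differentiates the map with its argument held fixed, the other the argument.\<close>

lemma
  assumes \<Phi>: "\<And>w. holo_vec_on (\<lambda>y. \<Phi> y w) S" "\<And>y. y \<in> S \<Longrightarrow> clin (\<Phi> y)"
    and \<eta>: "holo_vec_on \<eta> S" and S: "open S"
  shows holo_linear_family: "holo_vec_on (\<lambda>y. \<Phi> y (\<eta> y)) S"
    and fd_linear_family: "x \<in> S \<Longrightarrow>
      fd (\<lambda>y. \<Phi> y (\<eta> y)) x v = fd (\<lambda>y. \<Phi> y (\<eta> x)) x v + \<Phi> x (fd \<eta> x v)"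
proof -
  have ex: "(\<Sum>i\<in>UNIV. \<eta> y $ i *s \<Phi> y (axis i 1)) = \<Phi> y (\<eta> y)" if "y \<in> S" for y
    using clin_expand[OF \<Phi>(2)[OF that], of "\<eta> y"] by simp
  have "holo_vec_on (\<lambda>y. \<Sum>i\<in>UNIV. \<eta> y $ i *s \<Phi> y (axis i 1)) S"
    using \<eta> by (intro holo_vec_on_sum holo_vec_on_scale \<Phi>) (simp add: holo_vec_on_def)
  then show "holo_vec_on (\<lambda>y. \<Phi> y (\<eta> y)) S"
    by (rule holo_vec_on_cong[OF _ S]) (rule ex)
  assume x: "x \<in> S"
  have der: "((\<lambda>y. \<Phi> y (h y)) has_derivative
      (\<lambda>v. (\<Sum>i\<in>UNIV. h x $ i *s fd (\<lambda>y. \<Phi> y (axis i 1)) x v) + \<Phi> x (fd h x v))) (at x)"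
    if h: "holo_vec_on h S" for h
  proof -
    have ex: "(\<Sum>i\<in>UNIV. h y $ i *s \<Phi> y (axis i 1)) = \<Phi> y (h y)" if "y \<in> S" for y
      using clin_expand[OF \<Phi>(2)[OF that], of "h y"] by simp
    have ex': "(\<Sum>i\<in>UNIV. fd h x v $ i *s \<Phi> x (axis i 1)) = \<Phi> x (fd h x v)" for v
      using clin_expand[OF \<Phi>(2)[OF x], of "fd h x v"] by simp
    have comp: "((\<lambda>y. h y $ i) has_derivative (\<lambda>v. fd h x v $ i)) (at x)" for i
      using holo_vec_onD(1)[OF h x] by (simp add: has_derivative_vec_iff)
    have "((\<lambda>y. \<Sum>i\<in>UNIV. h y $ i *s \<Phi> y (axis i 1)) has_derivative
      (\<lambda>v. \<Sum>i\<in>UNIV. h x $ i *s fd (\<lambda>y. \<Phi> y (axis i 1)) x v + fd h x v $ i *s \<Phi> x (axis i 1))) (at x)"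
      by (intro has_derivative_sum bounded_bilinear.FDERIV[OF bounded_bilinear_vector_scale]
          comp holo_vec_onD(1)[OF \<Phi>(1) x])
    then show ?thesis
      unfolding sum.distrib ex'
      by (rule has_derivative_transform_within_open[OF _ S x]) (rule ex)
  qed
  have 1: "fd (\<lambda>y. \<Phi> y (\<eta> y)) x v =
      (\<Sum>i\<in>UNIV. \<eta> x $ i *s fd (\<lambda>y. \<Phi> y (axis i 1)) x v) + \<Phi> x (fd \<eta> x v)"
    using frechet_derivative_at[OF der[OF \<eta>], symmetric] by simp
  have 2: "fd (\<lambda>y. \<Phi> y (\<eta> x)) x v = (\<Sum>i\<in>UNIV. \<eta> x $ i *s fd (\<lambda>y. \<Phi> y (axis i 1)) x v)"
    using frechet_derivative_at[OF der[OF holo_vec_on_const[of "\<eta> x"]], symmetric] clin_simps(4)[OF \<Phi>(2)[OF x]]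
    by simp
  show "fd (\<lambda>y. \<Phi> y (\<eta> y)) x v = fd (\<lambda>y. \<Phi> y (\<eta> x)) x v + \<Phi> x (fd \<eta> x v)"
    by (simp add: 1 2)
qed

lemma holo_fun_on_det:
  assumes "\<And>i j. holo_fun_on (\<lambda>y. M y $ i $ j) S"
  shows "holo_fun_on (\<lambda>y. det (M y)) S"
  unfolding det_def by (intro holo_fun_on_intros assms)

text \<open>By Cramer's rule the solution of a linear system is a quotient of determinants,
  which are polynomials in the holomorphic entries.\<close>

lemma holo_linear_solve:
  fixes \<Phi> :: "complex^'m \<Rightarrow> complex^'n \<Rightarrow> complex^'n"
  assumes \<Phi>: "\<And>w. holo_vec_on (\<lambda>y. \<Phi> y w) S" "\<And>y. y \<in> S \<Longrightarrow> clin (\<Phi> y)"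
    and inj: "\<And>y. y \<in> S \<Longrightarrow> inj (\<Phi> y)"
    and Y: "holo_vec_on Y S" and S: "open S"
    and sol: "\<And>y. y \<in> S \<Longrightarrow> \<Phi> y (\<theta> y) = Y y"
  shows "holo_vec_on \<theta> S"
proof -
  define M where "M = (\<lambda>y. matrix (\<Phi> y))"
  have M: "M y *v w = \<Phi> y w" if "y \<in> S" for y w
    unfolding M_def by (rule matrix_works[OF \<Phi>(2)[OF that]])
  have det: "det (M y) \<noteq> 0" if "y \<in> S" for y
  proof -
    have "inj ((*v) (M y))" using inj[OF that] M[OF that] by (simp add: inj_def)
    then show ?thesis
      using matrix_left_invertible_injective[of "M y"] invertible_left_inverse[of "M y"] invertible_det_nz[of "M y"]
      by blast
  qed
  have ent: "holo_fun_on (\<lambda>y. M y $ i $ j) S" for i j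
    using \<Phi>(1)[of "axis j 1"] by (simp add: M_def matrix_def holo_vec_on_def)
  have "holo_fun_on (\<lambda>y. \<theta> y $ k) S" for k
  proof (rule holo_fun_on_cong[OF _ S])
    show "holo_fun_on (\<lambda>y. det (\<chi> i j. if j = k then Y y $ i else M y $ i $ j) * inverse (det (M y))) S"
    proof (intro holo_fun_on_mult holo_fun_on_inverse holo_fun_on_det ent det)
      fix i j
      show "holo_fun_on (\<lambda>y. (\<chi> i j. if j = k then Y y $ i else M y $ i $ j) $ i $ j) S"
        using Y ent by (cases "j = k") (auto simp: holo_vec_on_def)
    qed
    fix y assume y: "y \<in> S"
    have "M y *v \<theta> y = Y y" using M[OF y] sol[OF y] by simp
    then have "\<theta> y = (\<chi> k. det (\<chi> i j. if j = k then Y y $ i else M y $ i $ j) / det (M y))"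
      using cramer[OF det[OF y]] by blast
    then show "det (\<chi> i j. if j = k then Y y $ i else M y $ i $ j) * inverse (det (M y)) = \<theta> y $ k"
      by (simp add: divide_inverse)
  qed
  then show ?thesis by (simp add: holo_vec_on_def)
qed

definition vf_bracket :: "(complex^'n \<Rightarrow> complex^'n) \<Rightarrow> (complex^'n \<Rightarrow> complex^'n) \<Rightarrow> complex^'n \<Rightarrow> complex^'n" where
  "vf_bracket X Y x = fd Y x (X x) - fd X x (Y x)"

text \<open>The relation \<open>Y' \<circ> \<phi> = D\<phi>(Y)\<close> is differentiated on both sides,
  by the chain rule on the left and the product rule for linear families on the right.\<close>

lemma holo_pushforward_derivative:
  assumes \<phi>: "holo_vec_on \<phi> S" "open S" "\<And>y. y \<in> S \<Longrightarrow> \<phi> y \<in> T"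
    and Y: "holo_vec_on Y S" "holo_vec_on Y' T" "\<And>y. y \<in> S \<Longrightarrow> Y' (\<phi> y) = fd \<phi> y (Y y)"
    and x: "x \<in> S"
  shows "fd Y' (\<phi> x) (fd \<phi> x v) = fd (\<lambda>y. fd \<phi> y (Y x)) x v + fd \<phi> x (fd Y x v)"
proof -
  have "fd Y' (\<phi> x) (fd \<phi> x v) = fd (\<lambda>y. Y' (\<phi> y)) x v"
    by (rule fd_compose[symmetric]) (use holo_vec_onD(3)[OF Y(2) \<phi>(3)] holo_vec_onD(3)[OF \<phi>(1)] x in auto)
  also have "\<dots> = fd (\<lambda>y. fd \<phi> y (Y y)) x v"
    by (rule arg_cong[of _ _ "\<lambda>g. g v"], rule fd_cong[OF \<phi>(2) x]) (rule Y(3))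
  also have "\<dots> = fd (\<lambda>y. fd \<phi> y (Y x)) x v + fd \<phi> x (fd Y x v)"
    by (rule fd_linear_family[OF holo_vec_directional_derivative[OF \<phi>(1,2)] holo_vec_onD(2)[OF \<phi>(1)] Y(1) \<phi>(2) x])
  finally show ?thesis .
qed

text \<open>The terms with second derivatives of \<open>\<phi>\<close> cancel because these are symmetric.
  With \<open>\<phi>\<close> a coordinate change this is chart independence of the bracket; with \<open>\<phi>\<close> a left
  translation it shows that left invariant fields are closed under brackets.\<close>

lemma vf_bracket_natural:
  assumes \<phi>: "holo_vec_on \<phi> S" "open S" "\<And>y. y \<in> S \<Longrightarrow> \<phi> y \<in> T"
    and X: "holo_vec_on X S" "holo_vec_on X' T" "\<And>y. y \<in> S \<Longrightarrow> X' (\<phi> y) = fd \<phi> y (X y)"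
    and Y: "holo_vec_on Y S" "holo_vec_on Y' T" "\<And>y. y \<in> S \<Longrightarrow> Y' (\<phi> y) = fd \<phi> y (Y y)"
    and x: "x \<in> S"
  shows "vf_bracket X' Y' (\<phi> x) = fd \<phi> x (vf_bracket X Y x)"
  using holo_pushforward_derivative[OF \<phi> Y x, of "X x"] holo_pushforward_derivative[OF \<phi> X x, of "Y x"]
    holo_vec_second_derivative_symmetric[OF \<phi>(1,2) x, of "Y x" "X x"]
    clin_simps(3)[OF holo_vec_onD(2)[OF \<phi>(1) x]]
  by (simp add: vf_bracket_def X(3)[OF x] Y(3)[OF x])

lemma fd_family_clin:
  assumes \<Phi>: "\<And>w. holo_vec_on (\<lambda>y. \<Phi> y w) S" "\<And>y. y \<in> S \<Longrightarrow> clin (\<Phi> y)"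
    and S: "open S" "x \<in> S"
  shows "clin (\<lambda>w. fd (\<lambda>y. \<Phi> y w) x v)"
proof (rule clinI)
  fix a b
  have "((\<lambda>y. \<Phi> y a + \<Phi> y b) has_derivative (\<lambda>v. fd (\<lambda>y. \<Phi> y a) x v + fd (\<lambda>y. \<Phi> y b) x v)) (at x)"
    by (intro has_derivative_add holo_vec_onD(1)[OF \<Phi>(1) S(2)])
  then have "((\<lambda>y. \<Phi> y (a + b)) has_derivative (\<lambda>v. fd (\<lambda>y. \<Phi> y a) x v + fd (\<lambda>y. \<Phi> y b) x v)) (at x)"
    by (rule has_derivative_transform_within_open[OF _ S]) (simp add: clin_simps(1)[OF \<Phi>(2)])
  from fun_cong[OF frechet_derivative_at[OF this], of v]
  show "fd (\<lambda>y. \<Phi> y (a + b)) x v = fd (\<lambda>y. \<Phi> y a) x v + fd (\<lambda>y. \<Phi> y b) x v" by (rule sym)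
next
  fix k a
  have "((\<lambda>y. k *s \<Phi> y a) has_derivative (\<lambda>v. k *s fd (\<lambda>y. \<Phi> y a) x v)) (at x)"
    using holo_vec_onD(1)[OF \<Phi>(1) S(2), of a] unfolding has_derivative_vec_iff
    by (auto intro!: has_derivative_mult_right)
  then have "((\<lambda>y. \<Phi> y (k *s a)) has_derivative (\<lambda>v. k *s fd (\<lambda>y. \<Phi> y a) x v)) (at x)"
    by (rule has_derivative_transform_within_open[OF _ S]) (simp add: clin_simps(2)[OF \<Phi>(2)])
  from fun_cong[OF frechet_derivative_at[OF this], of v]
  show "fd (\<lambda>y. \<Phi> y (k *s a)) x v = k *s fd (\<lambda>y. \<Phi> y a) x v" by (rule sym)
qed

lemma curve_deriv_cong:
  assumes "curve_deriv c v t" "open U" "t \<in> U" "\<And>s. s \<in> U \<Longrightarrow> c s = d s"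
  shows "curve_deriv d v t"
  using assms has_derivative_transform_within_open unfolding curve_deriv_iff by blast

lemma curve_linear_family:
  assumes \<Phi>: "\<And>w. holo_vec_on (\<lambda>y. \<Phi> y w) S" "\<And>y. y \<in> S \<Longrightarrow> clin (\<Phi> y)"
    and S: "open S" and U: "open U" "t \<in> U" "\<And>s. s \<in> U \<Longrightarrow> y s \<in> S"
    and y: "curve_deriv y y' t" and u: "curve_deriv u u' t"
  shows "curve_deriv (\<lambda>t. \<Phi> (y t) (u t)) (fd (\<lambda>z. \<Phi> z (u t)) (y t) y' + \<Phi> (y t) u') t"
proof -
  have yt: "y t \<in> S" using U by blast
  have ex: "(\<Sum>j\<in>UNIV. u s $ j *s \<Phi> (y s) (axis j 1)) = \<Phi> (y s) (u s)" if "s \<in> U" for s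
    by (rule clin_expand[OF \<Phi>(2)[OF U(3)[OF that]], symmetric])
  have ex': "(\<Sum>j\<in>UNIV. u' $ j *s \<Phi> (y t) (axis j 1)) = \<Phi> (y t) u'"
    by (rule clin_expand[OF \<Phi>(2)[OF yt], symmetric])
  have ex2: "(\<Sum>j\<in>UNIV. u t $ j *s fd (\<lambda>z. \<Phi> z (axis j 1)) (y t) y') = fd (\<lambda>z. \<Phi> z (u t)) (y t) y'"
    by (rule clin_expand[OF fd_family_clin[OF \<Phi> S yt], symmetric])
  have c: "curve_deriv (\<lambda>t. \<Phi> (y t) (axis j 1)) (fd (\<lambda>z. \<Phi> z (axis j 1)) (y t) y') t" for j
    by (rule curve_chain[OF \<Phi>(1) yt y])
  have "curve_deriv (\<lambda>t. \<Sum>j\<in>UNIV. u t $ j *s \<Phi> (y t) (axis j 1))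
     (\<Sum>j\<in>UNIV. u t $ j *s fd (\<lambda>z. \<Phi> z (axis j 1)) (y t) y' + u' $ j *s \<Phi> (y t) (axis j 1)) t"
    unfolding curve_deriv_def
  proof
    fix i
    have "((\<lambda>t. \<Sum>j\<in>UNIV. u t $ j * \<Phi> (y t) (axis j 1) $ i) has_field_derivative
       (\<Sum>j\<in>UNIV. u' $ j * \<Phi> (y t) (axis j 1) $ i + fd (\<lambda>z. \<Phi> z (axis j 1)) (y t) y' $ i * u t $ j)) (at t)"
      using c u unfolding curve_deriv_def by (intro DERIV_sum DERIV_mult) auto
    then show "((\<lambda>t. (\<Sum>j\<in>UNIV. u t $ j *s \<Phi> (y t) (axis j 1)) $ i) has_field_derivative
       (\<Sum>j\<in>UNIV. u t $ j *s fd (\<lambda>z. \<Phi> z (axis j 1)) (y t) y' + u' $ j *s \<Phi> (y t) (axis j 1)) $ i) (at t)"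
      by (simp add: add.commute mult.commute)
  qed
  then have "curve_deriv (\<lambda>t. \<Sum>j\<in>UNIV. u t $ j *s \<Phi> (y t) (axis j 1))
     (fd (\<lambda>z. \<Phi> z (u t)) (y t) y' + \<Phi> (y t) u') t"
    unfolding sum.distrib ex' ex2 .
  then show ?thesis
    by (rule curve_deriv_cong[OF _ U(1,2)]) (rule ex)
qed

lemma curve_holomorphicD:
  assumes "\<And>i. (\<lambda>t. y t $ i) holomorphic_on U" "open U" "t \<in> U"
  shows "curve_deriv y (\<chi> i. deriv (\<lambda>t. y t $ i) t) t"
  unfolding curve_deriv_def using holomorphic_derivI[OF assms(1,2,3)] by simp

text \<open>The bounds hold for the finitely many basis vectors by
  \<open>holo_vec_locally_lipschitz\<close> and extend linearly. Writing the dependence on \<open>w\<close> explicitly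
  lets one choice of constants serve all bounded right hand sides of the differential equation.\<close>

lemma linear_family_lipschitz:
  fixes \<Phi> :: "complex^'m \<Rightarrow> complex^'n \<Rightarrow> complex^'k"
  assumes \<Phi>: "\<And>w. holo_vec_on (\<lambda>y. \<Phi> y w) S" "\<And>y. y \<in> S \<Longrightarrow> clin (\<Phi> y)"
    and S: "open S" "x \<in> S"
  shows "\<exists>R K L. R > 0 \<and> K \<ge> 0 \<and> L \<ge> 0 \<and> cball x R \<subseteq> S \<and>
    (\<forall>y w. y \<in> cball x R \<longrightarrow> norm (\<Phi> y w) \<le> K * norm w) \<and>
    (\<forall>y z w. y \<in> cball x R \<longrightarrow> z \<in> cball x R \<longrightarrow> norm (\<Phi> y w - \<Phi> z w) \<le> L * norm w * norm (y - z))"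
proof -
  have "\<exists>R L. R > 0 \<and> L \<ge> 0 \<and> cball x R \<subseteq> S \<and>
      (\<forall>y\<in>cball x R. \<forall>z\<in>cball x R. norm (\<Phi> y (axis j 1) - \<Phi> z (axis j 1)) \<le> L * norm (y - z))" for j
    by (rule holo_vec_locally_lipschitz[OF \<Phi>(1) S, of "axis j 1"]) blast
  then obtain R L where RL: "\<And>j. R j > 0" "\<And>j. L j \<ge> 0" "\<And>j. cball x (R j) \<subseteq> S"
    "\<And>j y z. y \<in> cball x (R j) \<Longrightarrow> z \<in> cball x (R j) \<Longrightarrow> norm (\<Phi> y (axis j 1) - \<Phi> z (axis j 1)) \<le> L j * norm (y - z)"
    by metis
  \<comment> \<open>The index type is finite, so one radius serves all basis vectors.\<close>
  define R0 where "R0 = Min (range R)"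
  have R0: "R0 > 0" "\<And>j. R0 \<le> R j" unfolding R0_def using RL(1) by auto
  have sub: "cball x R0 \<subseteq> cball x (R j)" for j using R0(2)[of j] by auto
  have subS: "cball x R0 \<subseteq> S" using sub RL(3) by blast
  define K where "K = (\<Sum>j\<in>UNIV. norm (\<Phi> x (axis j 1)) + L j * R0)"
  define L0 where "L0 = (\<Sum>j\<in>UNIV. L j)"
  have xR: "x \<in> cball x R0" using R0 by simp
  show ?thesis
  proof (rule exI[of _ R0], rule exI[of _ K], rule exI[of _ L0], intro conjI allI impI)
    show "R0 > 0" by (rule R0)
    show "K \<ge> 0" unfolding K_def using R0 RL by (intro sum_nonneg add_nonneg_nonneg mult_nonneg_nonneg) auto
    show "L0 \<ge> 0" unfolding L0_def using RL by (intro sum_nonneg) auto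
    show "cball x R0 \<subseteq> S" by (rule subS)
    show "norm (\<Phi> y w) \<le> K * norm w" if y: "y \<in> cball x R0" for y w
    proof -
      have "norm (\<Phi> y w) = norm (\<Sum>j\<in>UNIV. w $ j *s \<Phi> y (axis j 1))"
        using clin_expand[OF \<Phi>(2), of y w] y subS by auto
      also have "\<dots> \<le> (\<Sum>j\<in>UNIV. norm (w $ j) * norm (\<Phi> y (axis j 1)))"
        by (rule sum_norm_le) (simp add: norm_vector_scale)
      also have "\<dots> \<le> (\<Sum>j\<in>UNIV. norm w * (norm (\<Phi> x (axis j 1)) + L j * R0))"
      proof (rule sum_mono)
        fix j
        have "norm (\<Phi> y (axis j 1) - \<Phi> x (axis j 1)) \<le> L j * norm (y - x)"
          by (rule RL(4)[OF subsetD[OF sub y] subsetD[OF sub xR]])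
        also have "\<dots> \<le> L j * R0"
          using y RL(2) by (intro mult_left_mono) (auto simp: dist_norm norm_minus_commute)
        finally have "norm (\<Phi> y (axis j 1)) \<le> norm (\<Phi> x (axis j 1)) + L j * R0"
          using norm_triangle_ineq2[of "\<Phi> y (axis j 1)" "\<Phi> x (axis j 1)"] by linarith
        then show "norm (w $ j) * norm (\<Phi> y (axis j 1)) \<le> norm w * (norm (\<Phi> x (axis j 1)) + L j * R0)"
          by (intro mult_mono Finite_Cartesian_Product.norm_nth_le) auto
      qed
      finally show ?thesis by (simp add: K_def sum_distrib_left mult.commute)
    qed
    show "norm (\<Phi> y w - \<Phi> z w) \<le> L0 * norm w * norm (y - z)" if yz: "y \<in> cball x R0" "z \<in> cball x R0" for y z w
    proof -
      have "\<Phi> y w - \<Phi> z w = (\<Sum>j\<in>UNIV. w $ j *s (\<Phi> y (axis j 1) - \<Phi> z (axis j 1)))"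
        using clin_expand[OF \<Phi>(2)[OF subsetD[OF subS yz(1)]], of w]
          clin_expand[OF \<Phi>(2)[OF subsetD[OF subS yz(2)]], of w]
        by (simp add: vec.scale_right_diff_distrib sum_subtractf)
      also have "norm \<dots> \<le> (\<Sum>j\<in>UNIV. norm (w $ j) * norm (\<Phi> y (axis j 1) - \<Phi> z (axis j 1)))"
        by (rule sum_norm_le) (simp only: norm_vector_scale order_refl)
      also have "\<dots> \<le> (\<Sum>j\<in>UNIV. norm w * (L j * norm (y - z)))"
        by (intro sum_mono mult_mono Finite_Cartesian_Product.norm_nth_le
            RL(4)[OF subsetD[OF sub yz(1)] subsetD[OF sub yz(2)]]) auto
      finally show ?thesis
        by (simp add: L0_def sum_distrib_left sum_distrib_right mult.commute mult.left_commute)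
    qed
  qed
qed

section \<open>Holomorphic ordinary differential equations\<close>

lemma curve_bound:
  assumes "convex S" "\<And>t. t \<in> S \<Longrightarrow> curve_deriv z (z' t) t" "\<And>t. t \<in> S \<Longrightarrow> norm (z' t) \<le> K"
    and "s \<in> S" "t \<in> S"
  shows "norm (z s - z t) \<le> K * norm (s - t)"
proof (rule differentiable_bound[OF assms(1), of z "\<lambda>t h. h *s z' t"])
  fix t assume t: "t \<in> S"
  show "(z has_derivative (\<lambda>h. h *s z' t)) (at t within S)"
    using assms(2)[OF t] curve_deriv_iff has_derivative_at_withinI by blast
  show "onorm (\<lambda>h. h *s z' t) \<le> K"
    by (rule onorm_le) (use mult_left_mono[OF assms(3)[OF t] norm_ge_zero] in \<open>simp add: norm_vector_scale mult.commute\<close>)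
qed (use assms in auto)

lemma curve_primitive:
  assumes S: "convex S" "open S" "s \<in> S" and y: "\<And>i. (\<lambda>t. y t $ i) holomorphic_on S"
  obtains z where "z s = c" "\<And>t. t \<in> S \<Longrightarrow> curve_deriv z (y t) t"
proof -
  have "\<exists>g. \<forall>t\<in>S. (g has_field_derivative y t $ i) (at t)" for i
  proof -
    obtain g where g: "\<And>x. x \<in> S \<Longrightarrow> (g has_field_derivative y x $ i) (at x within S)"
      using holomorphic_convex_primitive'[OF S(1,2) y] by blast
    then show ?thesis using at_within_open[OF _ S(2)] by (metis (no_types))
  qed
  then obtain g where g: "\<And>i t. t \<in> S \<Longrightarrow> (g i has_field_derivative y t $ i) (at t)"
    by metis
  show ?thesis
  proof (rule that[of "\<lambda>t. \<chi> i. g i t - g i s + c $ i"])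
    show "(\<chi> i. g i s - g i s + c $ i) = c" by (simp add: vec_eq_iff)
    show "curve_deriv (\<lambda>t. \<chi> i. g i t - g i s + c $ i) (y t) t" if "t \<in> S" for t
      unfolding curve_deriv_def using g[OF that] by (auto intro!: derivative_eq_intros)
  qed
qed

lemma curve_deriv_holomorphic:
  assumes "\<And>t. t \<in> S \<Longrightarrow> curve_deriv z (z' t) t" "open S"
  shows "(\<lambda>t. z t $ i) holomorphic_on S"
  unfolding holomorphic_on_open[OF assms(2)] using assms(1) by (auto simp: curve_deriv_def)

text \<open>Instead of integrating, each iterate is the primitive of the previous right hand
  side, which exists because a disc is convex. The smallness of \<open>r\<close> keeps the iterates in the ball
  and makes the step a contraction by one half in the supremum norm. A uniform limit of
  holomorphic curves is holomorphic, so one more step may be applied to the limit; the result agrees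
  with the limit on the disc and solves the equation.\<close>

lemma picard_disc:
  fixes G :: "complex \<Rightarrow> complex^'n \<Rightarrow> complex^'n"
  assumes r: "r > 0" "r * K \<le> R" "r * L \<le> 1/2" "L \<ge> 0" "R > 0"
    and bd: "\<And>t y. t \<in> ball t0 r \<Longrightarrow> y \<in> cball y0 R \<Longrightarrow> norm (G t y) \<le> K"
    and lip: "\<And>t y z. t \<in> ball t0 r \<Longrightarrow> y \<in> cball y0 R \<Longrightarrow> z \<in> cball y0 R \<Longrightarrow>
        norm (G t y - G t z) \<le> L * norm (y - z)"
    and hol: "\<And>y i. (\<And>t. t \<in> ball t0 r \<Longrightarrow> y t \<in> cball y0 R) \<Longrightarrow>
        (\<And>i. (\<lambda>t. y t $ i) holomorphic_on ball t0 r) \<Longrightarrow> (\<lambda>t. G t (y t) $ i) holomorphic_on ball t0 r"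
  obtains y where "y t0 = y0" "\<And>t. t \<in> ball t0 r \<Longrightarrow> y t \<in> cball y0 R"
    "\<And>t. t \<in> ball t0 r \<Longrightarrow> curve_deriv y (G t (y t)) t"
proof -
  define good where "good = (\<lambda>y. (\<forall>t\<in>ball t0 r. y t \<in> cball y0 R) \<and> (\<forall>i. (\<lambda>t. y t $ i) holomorphic_on ball t0 r))"
  define P where "P = (\<lambda>y z. z t0 = y0 \<and> (\<forall>t\<in>ball t0 r. curve_deriv z (G t (y t)) t))"
  have t0: "t0 \<in> ball t0 r" using r by simp
  have "\<exists>z. P y z" if "good y" for y
  proof -
    have hy: "(\<lambda>t. G t (y t) $ i) holomorphic_on ball t0 r" for i
      using that by (intro hol) (auto simp: good_def)
    obtain z where "z t0 = y0" "\<And>t. t \<in> ball t0 r \<Longrightarrow> curve_deriv z (G t (y t)) t"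
      by (rule curve_primitive[OF convex_ball open_ball t0 hy, where c = y0]) blast
    then show ?thesis unfolding P_def by blast
  qed
  then obtain T where T: "\<And>y. good y \<Longrightarrow> P y (T y)" by metis
  have goodT: "good z" if "good y" "P y z" for y z
    unfolding good_def
  proof (intro conjI ballI allI)
    fix t assume t: "t \<in> ball t0 r"
    have "norm (z t - z t0) \<le> K * norm (t - t0)"
      by (rule curve_bound[of "ball t0 r" z "\<lambda>t. G t (y t)"])
        (use that bd t r in \<open>auto simp: good_def P_def\<close>)
    also have "\<dots> \<le> K * r"
    proof (intro mult_left_mono)
      have "norm (G t (y t)) \<le> K" using that t by (intro bd) (auto simp: good_def)
      then show "0 \<le> K" using norm_ge_zero order_trans by blast
    qed (use t in \<open>simp add: dist_norm norm_minus_commute\<close>)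
    finally show "z t \<in> cball y0 R"
      using r(2) that(2) by (simp add: P_def dist_norm norm_minus_commute mult.commute)
  next
    fix i show "(\<lambda>t. z t $ i) holomorphic_on ball t0 r"
      using that(2) by (intro curve_deriv_holomorphic) (auto simp: P_def)
  qed
  have contr: "norm (z t - z' t) \<le> \<delta> / 2"
    if y: "good y" "P y z" "good y'" "P y' z'" and \<delta>: "\<And>t. t \<in> ball t0 r \<Longrightarrow> norm (y t - y' t) \<le> \<delta>"
      and t: "t \<in> ball t0 r" for y y' z z' \<delta> t
  proof -
    have \<delta>0: "\<delta> \<ge> 0" using \<delta>[OF t] norm_ge_zero order_trans by blast
    have "norm ((z t - z' t) - (z t0 - z' t0)) \<le> (L * \<delta>) * norm (t - t0)"
    proof (rule curve_bound[OF convex_ball _ _ t t0])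
      fix s assume s: "s \<in> ball t0 r"
      show "curve_deriv (\<lambda>t. z t - z' t) (G s (y s) - G s (y' s)) s"
        using y s unfolding curve_deriv_def P_def by (auto intro!: derivative_intros)
      have "norm (G s (y s) - G s (y' s)) \<le> L * norm (y s - y' s)"
        using y s by (intro lip) (auto simp: good_def)
      also have "\<dots> \<le> L * \<delta>" using \<delta>[OF s] r by (intro mult_left_mono)
      finally show "norm (G s (y s) - G s (y' s)) \<le> L * \<delta>" .
    qed
    also have "\<dots> \<le> (L * \<delta>) * r"
      using t \<delta>0 r by (intro mult_left_mono) (auto simp: dist_norm norm_minus_commute)
    also have "\<dots> = (r * L) * \<delta>" by simp
    also have "\<dots> \<le> 1 / 2 * \<delta>" using r \<delta>0 by (intro mult_right_mono)
    finally show ?thesis using y by (simp add: P_def)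
  qed
  define Y where "Y = (\<lambda>n. (T ^^ n) (\<lambda>_. y0))"
  have YS: "Y (Suc n) = T (Y n)" for n by (simp add: Y_def)
  have gY: "good (Y n)" for n
  proof (induction n)
    case 0 show ?case using r by (simp add: Y_def good_def)
  next
    case (Suc n) then show ?case unfolding YS using goodT T by blast
  qed
  have PY: "P (Y n) (Y (Suc n))" for n unfolding YS by (rule T[OF gY])
  have step: "norm (Y (Suc n) t - Y n t) \<le> R / 2 ^ n" if "t \<in> ball t0 r" for n t
    using that
  proof (induction n arbitrary: t)
    case 0 then show ?case using gY[of 1] by (simp add: good_def Y_def dist_norm norm_minus_commute)
  next
    case (Suc n)
    have "norm (Y (Suc (Suc n)) t - Y (Suc n) t) \<le> (R / 2 ^ n) / 2"
      by (rule contr[OF gY PY gY PY Suc.IH Suc.prems])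
    then show ?case by simp
  qed
  have tele: "norm (Y (n + k) t - Y n t) \<le> 2 * R / 2 ^ n - 2 * R / 2 ^ (n + k)" if t: "t \<in> ball t0 r" for n k t
  proof (induction k)
    case (Suc k)
    have "norm (Y (n + Suc k) t - Y n t) \<le> norm (Y (Suc (n + k)) t - Y (n + k) t) + norm (Y (n + k) t - Y n t)"
      using norm_triangle_ineq[of "Y (Suc (n + k)) t - Y (n + k) t" "Y (n + k) t - Y n t"] by simp
    also have "\<dots> \<le> R / 2 ^ (n + k) + (2 * R / 2 ^ n - 2 * R / 2 ^ (n + k))"
      using step[OF t, of "n + k"] Suc by linarith
    also have "\<dots> = 2 * R / 2 ^ n - 2 * R / 2 ^ (n + Suc k)" by (simp add: field_simps)
    finally show ?case .
  qed simp
  have tele': "norm (Y m t - Y n t) \<le> 2 * R / 2 ^ n" if "t \<in> ball t0 r" "n \<le> m" for n m t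
  proof -
    have "norm (Y m t - Y n t) \<le> 2 * R / 2 ^ n - 2 * R / 2 ^ m"
      using tele[OF that(1), of n "m - n"] that(2) by simp
    moreover have "0 \<le> 2 * R / 2 ^ m" using r(5) by simp
    ultimately show ?thesis by linarith
  qed
  have R0: "(\<lambda>n. 2 * R / 2 ^ n) \<longlonglongrightarrow> 0"
    using tendsto_mult_left[OF LIMSEQ_inverse_realpow_zero[of 2], of "2 * R"] by (simp add: divide_inverse)
  have conv: "(\<lambda>n. Y n t) \<longlonglongrightarrow> lim (\<lambda>n. Y n t)" if t: "t \<in> ball t0 r" for t
  proof -
    have "Cauchy (\<lambda>n. Y n t)"
      unfolding Cauchy_altdef2
    proof (intro allI impI)
      fix e :: real assume "e > 0"
      then have "\<forall>\<^sub>F n in sequentially. 2 * R / 2 ^ n < e" using R0 order_tendstoD(2) by blast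
      then obtain N where "2 * R / 2 ^ N < e" by (auto simp: eventually_sequentially)
      then show "\<exists>N. \<forall>n\<ge>N. dist (Y n t) (Y N t) < e"
        using tele'[OF t] unfolding dist_norm by (meson order_le_less_trans)
    qed
    then show ?thesis using Cauchy_convergent convergent_LIMSEQ_iff by blast
  qed
  define y where "y = (\<lambda>t. lim (\<lambda>n. Y n t))"
  have yclose: "norm (y t - Y n t) \<le> 2 * R / 2 ^ n" if t: "t \<in> ball t0 r" for n t
  proof (rule Lim_norm_ubound[OF sequentially_bot])
    show "(\<lambda>m. Y m t - Y n t) \<longlonglongrightarrow> y t - Y n t"
      unfolding y_def by (intro tendsto_intros conv t)
    show "\<forall>\<^sub>F m in sequentially. norm (Y m t - Y n t) \<le> 2 * R / 2 ^ n"
      using tele'[OF t] eventually_sequentially by blast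
  qed
  have gy: "good y"
    unfolding good_def
  proof (intro conjI ballI allI)
    fix t assume t: "t \<in> ball t0 r"
    show "y t \<in> cball y0 R"
      unfolding y_def by (rule closed_sequentially[OF closed_cball _ conv[OF t]]) (use gY t in \<open>auto simp: good_def\<close>)
  next
    fix i
    show "(\<lambda>t. y t $ i) holomorphic_on ball t0 r"
    proof (rule holomorphic_uniform_sequence[OF open_ball])
      show "(\<lambda>t. Y n t $ i) holomorphic_on ball t0 r" for n using gY by (auto simp: good_def)
      fix t assume t: "t \<in> ball t0 r"
      obtain d where d: "d > 0" "cball t d \<subseteq> ball t0 r" using t open_contains_cball open_ball by blast
      have "uniform_limit (cball t d) (\<lambda>n t. Y n t $ i) (\<lambda>t. y t $ i) sequentially"
        unfolding uniform_limit_iff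
      proof (intro allI impI)
        fix e :: real assume "e > 0"
        then have "\<forall>\<^sub>F n in sequentially. 2 * R / 2 ^ n < e" using R0 order_tendstoD(2) by blast
        then show "\<forall>\<^sub>F n in sequentially. \<forall>s\<in>cball t d. dist (Y n s $ i) (y s $ i) < e"
        proof eventually_elim
          case (elim n)
          show ?case
          proof
            fix s assume "s \<in> cball t d"
            then have s: "s \<in> ball t0 r" using d by blast
            have "dist (Y n s $ i) (y s $ i) \<le> norm (y s - Y n s)"
              using Finite_Cartesian_Product.norm_nth_le[of "y s - Y n s" i] by (simp add: dist_norm norm_minus_commute)
            then show "dist (Y n s $ i) (y s $ i) < e" using yclose[OF s, of n] elim by linarith
          qed
        qed
      qed
      then show "\<exists>d>0. cball t d \<subseteq> ball t0 r \<and> uniform_limit (cball t d) (\<lambda>n t. Y n t $ i) (\<lambda>t. y t $ i) sequentially"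
        using d by blast
    qed
  qed
  define z where "z = T y"
  have Pz: "P y z" unfolding z_def by (rule T[OF gy])
  have zy: "z t = y t" if t: "t \<in> ball t0 r" for t
  proof (rule LIMSEQ_unique)
    show "(\<lambda>n. Y n t) \<longlonglongrightarrow> y t" unfolding y_def by (rule conv[OF t])
    have b: "norm (z t - Y (Suc n) t) \<le> (2 * R / 2 ^ n) / 2" for n
      by (rule contr[OF gy Pz gY PY yclose t])
    have "(\<lambda>n. Y (Suc n) t - z t) \<longlonglongrightarrow> 0"
      by (rule Lim_null_comparison[OF _ tendsto_divide_zero[OF R0, of 2]])
        (use b in \<open>auto simp: norm_minus_commute\<close>)
    then show "(\<lambda>n. Y n t) \<longlonglongrightarrow> z t"
      using LIM_zero_iff filterlim_sequentially_Suc by blast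
  qed
  show ?thesis
  proof (rule that[of z])
    show "z t0 = y0" using Pz by (simp add: P_def)
    show "z t \<in> cball y0 R" if "t \<in> ball t0 r" for t using zy[OF that] gy that by (simp add: good_def)
    show "curve_deriv z (G t (z t)) t" if "t \<in> ball t0 r" for t using zy[OF that] Pz that by (simp add: P_def)
  qed
qed

text \<open>Two solutions differ by at most \<open>2R\<close>, and the contraction of the Picard step
  halves any such bound.\<close>

lemma ode_unique_disc:
  fixes G :: "complex \<Rightarrow> complex^'n \<Rightarrow> complex^'n"
  assumes r: "r > 0" "r * L \<le> 1/2" "L \<ge> 0"
    and lip: "\<And>t y z. t \<in> ball t0 r \<Longrightarrow> y \<in> cball y0 R \<Longrightarrow> z \<in> cball y0 R \<Longrightarrow>
        norm (G t y - G t z) \<le> L * norm (y - z)"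
    and y: "\<And>t. t \<in> ball t0 r \<Longrightarrow> y t \<in> cball y0 R" "\<And>t. t \<in> ball t0 r \<Longrightarrow> curve_deriv y (G t (y t)) t"
    and z: "\<And>t. t \<in> ball t0 r \<Longrightarrow> z t \<in> cball y0 R" "\<And>t. t \<in> ball t0 r \<Longrightarrow> curve_deriv z (G t (z t)) t"
    and eq: "y t0 = z t0" and t: "t \<in> ball t0 r"
  shows "y t = z t"
proof -
  have t0: "t0 \<in> ball t0 r" using r by simp
  have bound: "norm (y t - z t) \<le> 2 * R / 2 ^ n" if "t \<in> ball t0 r" for n t
    using that
  proof (induction n arbitrary: t)
    case 0
    have "dist (y t) (z t) \<le> R + R" using y(1)[OF 0] z(1)[OF 0] dist_triangle3[of "y t" "z t" y0] by simp
    then show ?case by (simp add: dist_norm)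
  next
    case (Suc n)
    have R: "0 \<le> 2 * R / 2 ^ n" using Suc.IH[OF t0] norm_ge_zero order_trans by blast
    have "norm ((y t - z t) - (y t0 - z t0)) \<le> (L * (2 * R / 2 ^ n)) * norm (t - t0)"
    proof (rule curve_bound[OF convex_ball _ _ Suc.prems t0])
      fix s assume s: "s \<in> ball t0 r"
      show "curve_deriv (\<lambda>t. y t - z t) (G s (y s) - G s (z s)) s"
        using y(2)[OF s] z(2)[OF s] unfolding curve_deriv_def by (auto intro!: derivative_intros)
      have "norm (G s (y s) - G s (z s)) \<le> L * norm (y s - z s)"
        using y z s by (intro lip) auto
      also have "\<dots> \<le> L * (2 * R / 2 ^ n)" using Suc.IH[OF s] r by (intro mult_left_mono)
      finally show "norm (G s (y s) - G s (z s)) \<le> L * (2 * R / 2 ^ n)" .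
    qed
    also have "\<dots> \<le> (L * (2 * R / 2 ^ n)) * r"
    proof (rule mult_left_mono)
      show "norm (t - t0) \<le> r" using Suc.prems by (simp add: dist_norm norm_minus_commute)
      show "0 \<le> L * (2 * R / 2 ^ n)" using R r by (rule_tac mult_nonneg_nonneg)
    qed
    also have "\<dots> = (r * L) * (2 * R / 2 ^ n)" by simp
    also have "\<dots> \<le> 1 / 2 * (2 * R / 2 ^ n)" using r R by (intro mult_right_mono)
    finally show ?case using eq by simp
  qed
  have R0: "(\<lambda>n. 2 * R / 2 ^ n) \<longlonglongrightarrow> 0"
    using tendsto_mult_left[OF LIMSEQ_inverse_realpow_zero[of 2], of "2 * R"] by (simp add: divide_inverse)
  have "norm (y t - z t) \<le> 0"
    by (rule LIMSEQ_le_const[OF R0]) (use bound[OF t] in auto)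
  then show ?thesis by simp
qed

text \<open>The components of \<open>exp (t l) u0\<close> are power series whose coefficients grow at
  most like those of an exponential function, hence entire.\<close>

lemma linear_flow_exists:
  fixes l :: "complex^'n \<Rightarrow> complex^'n"
  assumes l: "clin l"
  obtains u where "u 0 = u0" "\<And>t. curve_deriv u (l (u t)) t"
proof -
  have lin: "linear l"
    by (rule linearI) (simp_all add: clin_simps[OF l] scaleR_vector_scale)
  obtain K where K: "\<And>x. norm (l x) \<le> norm x * K" "K > 0"
    using bounded_linear.pos_bounded[OF linear_conv_bounded_linear[THEN iffD1, OF lin]] by blast
  define a where "a = (\<lambda>k. (l ^^ k) u0)"
  have aS: "a (Suc k) = l (a k)" for k by (simp add: a_def)
  have an: "norm (a k) \<le> norm u0 * K ^ k" for k
  proof (induction k)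
    case (Suc k)
    have "norm (a (Suc k)) \<le> norm (a k) * K" unfolding aS by (rule K)
    also have "\<dots> \<le> norm u0 * K ^ k * K" using Suc K by (intro mult_right_mono) auto
    finally show ?case by (simp add: mult.commute mult.left_commute)
  qed (simp add: a_def)
  define c where "c = (\<lambda>i k. a k $ i / fact k)"
  have sm: "summable (\<lambda>k. c i k * y ^ k)" for i and y :: complex
  proof (rule summable_comparison_test')
    show "summable (\<lambda>k. norm u0 * (inverse (fact k) * (K * norm y) ^ k))"
      by (intro summable_mult summable_exp)
    show "norm (c i k * y ^ k) \<le> norm u0 * (inverse (fact k) * (K * norm y) ^ k)" for k
    proof -
      have "norm (a k $ i) \<le> norm u0 * K ^ k"
        using an[of k] Finite_Cartesian_Product.norm_nth_le[of "a k" i] by linarith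
      then have "norm (a k $ i) * (norm y ^ k / fact k) \<le> (norm u0 * K ^ k) * (norm y ^ k / fact k)"
        by (rule mult_right_mono) simp
      then show ?thesis
        by (simp add: c_def norm_mult norm_divide norm_power power_mult_distrib field_simps)
    qed
  qed
  define u where "u = (\<lambda>t. \<chi> i. \<Sum>k. c i k * t ^ k)"
  have "u 0 $ i = c i 0" for i
    unfolding u_def by (simp only: vec_lambda_beta powser_zero)
  then have u0: "u 0 = u0"
    by (simp add: vec_eq_iff c_def a_def)
  have dc: "diffs (c i) k = (\<Sum>j\<in>UNIV. l (axis j 1) $ i * c j k)" for i k
  proof -
    have "diffs (c i) k = a (Suc k) $ i / fact k"
      by (simp add: diffs_def c_def del: of_nat_Suc)
    also have "a (Suc k) $ i = (\<Sum>j\<in>UNIV. a k $ j * l (axis j 1) $ i)"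
      unfolding aS using arg_cong[OF clin_expand[OF l, of "a k"], of "\<lambda>x. x $ i"] by simp
    finally show ?thesis by (simp add: c_def sum_divide_distrib mult.commute)
  qed
  have "curve_deriv u (l (u t)) t" for t
    unfolding curve_deriv_def
  proof
    fix i
    have "(\<Sum>k. diffs (c i) k * t ^ k) = (\<Sum>k. \<Sum>j\<in>UNIV. l (axis j 1) $ i * (c j k * t ^ k))"
      by (simp add: dc sum_distrib_right mult.assoc)
    also have "\<dots> = (\<Sum>j\<in>UNIV. \<Sum>k. l (axis j 1) $ i * (c j k * t ^ k))"
      by (intro suminf_sum summable_mult sm)
    also have "\<dots> = (\<Sum>j\<in>UNIV. l (axis j 1) $ i * u t $ j)"
      by (simp add: u_def suminf_mult[OF sm])
    also have "\<dots> = l (u t) $ i"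
      using arg_cong[OF clin_expand[OF l, of "u t"], of "\<lambda>x. x $ i"] by (simp add: mult.commute)
    finally have "(\<Sum>k. diffs (c i) k * t ^ k) = l (u t) $ i" .
    then show "((\<lambda>t. u t $ i) has_field_derivative l (u t) $ i) (at t)"
      using termdiffs_strong_converges_everywhere[OF sm, of i t] by (simp add: u_def)
  qed
  then show ?thesis using u0 that by blast
qed

section \<open>Complex Lie groups in charts\<close>

text \<open>The coordinates of a point in a chart of \<open>prod_atlas\<close>.\<close>

definition join_vec :: "complex^'n \<Rightarrow> complex^'m \<Rightarrow> complex^('n + 'm)" where
  "join_vec u y = (\<chi> k. case k of Inl i \<Rightarrow> u $ i | Inr j \<Rightarrow> y $ j)"

abbreviation fst_vec :: "complex^('n::finite + 'm::finite) \<Rightarrow> complex^'n" where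
  "fst_vec w \<equiv> (\<chi> i. w $ Inl i)"

abbreviation snd_vec :: "complex^('n::finite + 'm::finite) \<Rightarrow> complex^'m" where
  "snd_vec w \<equiv> (\<chi> j. w $ Inr j)"

lemma join_vec_simps [simp]:
  "fst_vec (join_vec u y) = u" "snd_vec (join_vec u y) = y" "join_vec (fst_vec w) (snd_vec w) = w"
  by (auto simp: join_vec_def vec_eq_iff split: sum.split)

lemma holo_join_vec:
  assumes "holo_vec_on f S" "holo_vec_on g S"
  shows "holo_vec_on (\<lambda>x. join_vec (f x) (g x)) S"
  unfolding holo_vec_on_def
proof
  fix k show "holo_fun_on (\<lambda>x. join_vec (f x) (g x) $ k) S"
    using assms by (cases k) (auto simp: join_vec_def holo_vec_on_def)
qed

lemma holo_vec_on_id: "holo_vec_on (\<lambda>x. x) S"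
  by (simp add: holo_vec_on_def holo_fun_on_nth)

lemma fd_join_vec_right: "fd (\<lambda>y. join_vec u y) x v = join_vec 0 (v::complex^'m)"
proof -
  have "((\<lambda>y. join_vec u y) has_derivative (\<lambda>v. join_vec 0 v)) (at x)"
    unfolding has_derivative_vec_iff
  proof
    fix k :: "'a + 'm"
    show "((\<lambda>y. join_vec u y $ k) has_derivative (\<lambda>v. join_vec 0 v $ k)) (at x)"
      by (cases k) (auto simp: join_vec_def intro!: bounded_linear_imp_has_derivative bounded_linear_vec_nth)
  qed
  then show ?thesis using frechet_derivative_at by metis
qed

locale complex_lie =
  fixes H :: "('a::{t2_space, second_countable_topology}) monoid"
    and A :: "('a, 'n::finite) chart set"
  assumes lie: "complex_lie_group H A"
begin

abbreviation mul (infixl "\<odot>" 70) where "x \<odot> y \<equiv> x \<otimes>\<^bsub>H\<^esub> y"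
abbreviation e where "e \<equiv> \<one>\<^bsub>H\<^esub>"
abbreviation iv where "iv x \<equiv> inv\<^bsub>H\<^esub> x"

lemma mul_simps [simp]:
  "(x \<odot> y) \<odot> z = x \<odot> (y \<odot> z)" "e \<odot> x = x" "x \<odot> e = x" "iv x \<odot> x = e" "x \<odot> iv x = e"
  "iv x \<odot> (x \<odot> y) = y" "x \<odot> (iv x \<odot> y) = y"
proof -
  interpret group H using lie by (simp add: complex_lie_group_def)
  have C: "z \<in> carrier H" for z using lie by (simp add: complex_lie_group_def)
  show "(x \<odot> y) \<odot> z = x \<odot> (y \<odot> z)" "e \<odot> x = x" "x \<odot> e = x" "iv x \<odot> x = e" "x \<odot> iv x = e"
    by (simp_all add: C m_assoc)
  show "iv x \<odot> (x \<odot> y) = y" "x \<odot> (iv x \<odot> y) = y"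
    by (simp_all add: C m_assoc[symmetric])
qed

abbreviation im where "im c \<equiv> snd c ` fst c"

lemma chart_cover: "\<exists>c\<in>A. p \<in> fst c"
  using lie unfolding complex_lie_group_def complex_atlas_def by blast

lemma chart_open:
  assumes "c \<in> A"
  shows "open (fst c)" "open (im c)" "homeomorphism (fst c) (im c) (snd c) (chart_inv c)"
  using lie assms unfolding complex_lie_group_def complex_atlas_def by auto

lemma chart_inv_simps [simp]:
  assumes "c \<in> A"
  shows "p \<in> fst c \<Longrightarrow> chart_inv c (snd c p) = p"
    "u \<in> im c \<Longrightarrow> snd c (chart_inv c u) = u"
    "u \<in> im c \<Longrightarrow> chart_inv c u \<in> fst c"
  using chart_open(3)[OF assms] unfolding homeomorphism_def by auto

lemma charts_atD: "c \<in> charts_at A p \<longleftrightarrow> c \<in> A \<and> p \<in> fst c"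
  by (simp add: charts_at_def)

lemma chart_at: "chart_at A p \<in> A" "p \<in> fst (chart_at A p)"
proof -
  have "\<exists>c. c \<in> charts_at A p" using chart_cover[of p] by (auto simp: charts_at_def)
  then have "chart_at A p \<in> charts_at A p"
    unfolding chart_at_def by (rule someI_ex)
  then show "chart_at A p \<in> A" "p \<in> fst (chart_at A p)" by (auto simp: charts_atD)
qed

lemma chart_image_iff:
  assumes "c \<in> A"
  shows "u \<in> snd c ` (fst c \<inter> W) \<longleftrightarrow> u \<in> im c \<and> chart_inv c u \<in> W"
  using chart_inv_simps[OF assms] by fastforce

lemma chart_image_open:
  assumes "c \<in> A" "open W"
  shows "open (snd c ` (fst c \<inter> W))"
proof -
  have "snd c ` (fst c \<inter> W) = im c \<inter> chart_inv c -` W"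
    using chart_image_iff[OF assms(1)] by blast
  moreover have "continuous_on (im c) (chart_inv c)"
    using chart_open(3)[OF assms(1)] by (simp add: homeomorphism_def)
  ultimately show ?thesis
    using continuous_open_preimage chart_open(2) assms by metis
qed

definition mult_chart :: "('a, 'n) chart \<Rightarrow> ('a, 'n) chart \<Rightarrow> ('a, 'n) chart \<Rightarrow> complex^('n + 'n) \<Rightarrow> complex^'n" where
  "mult_chart b c d w = snd d (chart_inv b (fst_vec w) \<odot> chart_inv c (snd_vec w))"

definition mult_dom :: "('a, 'n) chart \<Rightarrow> ('a, 'n) chart \<Rightarrow> ('a, 'n) chart \<Rightarrow> (complex^('n + 'n)) set" where
  "mult_dom b c d = {w. fst_vec w \<in> im b \<and> snd_vec w \<in> im c \<and> chart_inv b (fst_vec w) \<odot> chart_inv c (snd_vec w) \<in> fst d}"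

lemma mult_continuous: "continuous_on UNIV (\<lambda>(x, y). x \<odot> y)"
  using lie by (simp add: complex_lie_group_def holo_map_def)

lemma mult_dom_open:
  assumes "b \<in> A" "c \<in> A" "d \<in> A"
  shows "open (mult_dom b c d)"
proof -
  define U where "U = {w :: complex^('n+'n). fst_vec w \<in> im b \<and> snd_vec w \<in> im c}"
  have cl: "continuous_on UNIV (\<lambda>w::complex^('n+'n). fst_vec w)" and cr: "continuous_on UNIV (\<lambda>w::complex^('n+'n). snd_vec w)"
    by (intro continuous_intros)+
  have "U = (\<lambda>w. fst_vec w) -` im b \<inter> (\<lambda>w. snd_vec w) -` im c" by (auto simp: U_def)
  then have U: "open U"
    using open_vimage[OF chart_open(2)[OF assms(1)] cl] open_vimage[OF chart_open(2)[OF assms(2)] cr] by auto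
  have "continuous_on U (\<lambda>w. (\<lambda>(x, y). x \<odot> y) (chart_inv b (fst_vec w), chart_inv c (snd_vec w)))"
  proof (rule continuous_on_compose2[OF mult_continuous])
    show "continuous_on U (\<lambda>w. (chart_inv b (fst_vec w), chart_inv c (snd_vec w)))"
    proof (intro continuous_on_Pair)
      show "continuous_on U (\<lambda>w. chart_inv b (fst_vec w))"
        by (rule continuous_on_compose2[OF _ continuous_on_subset[OF cl]])
          (use chart_open(3)[OF assms(1)] in \<open>auto simp: homeomorphism_def U_def\<close>)
      show "continuous_on U (\<lambda>w. chart_inv c (snd_vec w))"
        by (rule continuous_on_compose2[OF _ continuous_on_subset[OF cr]])
          (use chart_open(3)[OF assms(2)] in \<open>auto simp: homeomorphism_def U_def\<close>)
    qed
  qed auto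
  then have "open (U \<inter> (\<lambda>w. (\<lambda>(x, y). x \<odot> y) (chart_inv b (fst_vec w), chart_inv c (snd_vec w))) -` fst d)"
    by (rule continuous_open_preimage[OF _ U chart_open(1)[OF assms(3)]])
  moreover have "U \<inter> (\<lambda>w. (\<lambda>(x, y). x \<odot> y) (chart_inv b (fst_vec w), chart_inv c (snd_vec w))) -` fst d = mult_dom b c d"
    by (auto simp: U_def mult_dom_def)
  ultimately show ?thesis by simp
qed

text \<open>A product chart is injective, so its chosen inverse is the pair of the inverses;
  this rewrites holomorphy of the multiplication into an explicit form.\<close>

lemma mult_chart_holo:
  assumes "b \<in> A" "c \<in> A" "d \<in> A"
  shows "holo_vec_on (mult_chart b c d) (mult_dom b c d)"
proof -
  define pc where "pc = (fst b \<times> fst c, \<lambda>(p, r). join_vec (snd b p) (snd c r))"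
  have pc: "pc \<in> prod_atlas A A"
    unfolding prod_atlas_def pc_def join_vec_def using assms by blast
  have fpc: "fst pc = fst b \<times> fst c" and spc: "snd pc = (\<lambda>(p, r). join_vec (snd b p) (snd c r))"
    by (simp_all add: pc_def)
  have inj: "inj_on (snd pc) (fst pc)"
  proof (rule inj_onI)
    fix x y assume xy: "x \<in> fst pc" "y \<in> fst pc" "snd pc x = snd pc y"
    obtain p r p' r' where x: "x = (p, r)" and y: "y = (p', r')" by (metis surj_pair)
    have "fst_vec (snd pc x) = fst_vec (snd pc y)" "snd_vec (snd pc x) = snd_vec (snd pc y)"
      using xy(3) by simp_all
    then have "snd b p = snd b p'" "snd c r = snd c r'" by (simp_all add: spc x y)
    then show "x = y"
      using xy chart_inv_simps(1)[OF assms(1)] chart_inv_simps(1)[OF assms(2)]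
      by (simp add: x y fpc) metis
  qed
  have inv: "chart_inv pc w = (chart_inv b (fst_vec w), chart_inv c (snd_vec w))"
    if "fst_vec w \<in> im b" "snd_vec w \<in> im c" for w
  proof (rule inv_into_f_eq[OF inj])
    show "(chart_inv b (fst_vec w), chart_inv c (snd_vec w)) \<in> fst pc"
      using that assms by (simp add: fpc)
    show "snd pc (chart_inv b (fst_vec w), chart_inv c (snd_vec w)) = w"
      using that assms by (simp add: spc)
  qed
  have "holo_vec_on (snd d \<circ> (\<lambda>(x, y). x \<odot> y) \<circ> chart_inv pc) (snd pc ` (fst pc \<inter> (\<lambda>(x, y). x \<odot> y) -` fst d))"
    using lie pc assms unfolding complex_lie_group_def holo_map_def by blast
  then have "holo_vec_on (snd d \<circ> (\<lambda>(x, y). x \<odot> y) \<circ> chart_inv pc) (mult_dom b c d)"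
  proof (rule holo_vec_on_subset)
    show "mult_dom b c d \<subseteq> snd pc ` (fst pc \<inter> (\<lambda>(x, y). x \<odot> y) -` fst d)"
    proof
      fix w assume w: "w \<in> mult_dom b c d"
      show "w \<in> snd pc ` (fst pc \<inter> (\<lambda>(x, y). x \<odot> y) -` fst d)"
        by (rule image_eqI[of _ _ "(chart_inv b (fst_vec w), chart_inv c (snd_vec w))"])
          (use w assms in \<open>simp_all add: mult_dom_def spc fpc\<close>)
    qed
  qed
  then show ?thesis
    by (rule holo_vec_on_cong[OF _ mult_dom_open[OF assms]]) (auto simp: mult_dom_def mult_chart_def inv)
qed

text \<open>Left translations read in charts. Since \<open>ltrans e c d\<close> is the coordinate change from \<open>c\<close>
  to \<open>d\<close>, every statement below about left translations contains the one about coordinate changes.\<close>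

definition ltrans :: "'a \<Rightarrow> ('a, 'n) chart \<Rightarrow> ('a, 'n) chart \<Rightarrow> complex^'n \<Rightarrow> complex^'n" where
  "ltrans g c d u = snd d (g \<odot> chart_inv c u)"

definition ltrans_dom :: "'a \<Rightarrow> ('a, 'n) chart \<Rightarrow> ('a, 'n) chart \<Rightarrow> (complex^'n) set" where
  "ltrans_dom g c d = {u \<in> im c. g \<odot> chart_inv c u \<in> fst d}"

lemma ltrans_holo:
  assumes "c \<in> A" "d \<in> A"
  shows "open (ltrans_dom g c d)" "holo_vec_on (ltrans g c d) (ltrans_dom g c d)"
proof -
  obtain b where b: "b \<in> A" "g \<in> fst b" using chart_cover by blast
  have sb: "chart_inv b (snd b g) = g" "snd b g \<in> im b" using b by auto
  have join: "holo_vec_on (join_vec (snd b g)) S" for S :: "(complex^'n) set"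
    by (intro holo_join_vec[of "\<lambda>_. snd b g" _ "\<lambda>x. x", simplified] holo_vec_on_const holo_vec_on_id)
  have eq: "ltrans_dom g c d = join_vec (snd b g) -` mult_dom b c d"
    by (auto simp: ltrans_dom_def mult_dom_def sb)
  show op: "open (ltrans_dom g c d)"
    unfolding eq by (intro open_vimage mult_dom_open b assms holo_vec_on_continuous join)
  have "holo_vec_on (\<lambda>u. mult_chart b c d (join_vec (snd b g) u)) (ltrans_dom g c d)"
    by (rule holo_vec_on_compose[OF mult_chart_holo[OF b(1) assms] join]) (simp add: eq)
  then show "holo_vec_on (ltrans g c d) (ltrans_dom g c d)"
    by (rule holo_vec_on_cong[OF _ op]) (simp add: mult_chart_def ltrans_def sb)
qed

definition jac :: "'a \<Rightarrow> 'a \<Rightarrow> ('a, 'n) chart \<Rightarrow> ('a, 'n) chart \<Rightarrow> complex^'n \<Rightarrow> complex^'n" where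
  "jac g p c d = fd (ltrans g c d) (snd c p)"

lemma ltrans_dom_point: "c \<in> A \<Longrightarrow> p \<in> fst c \<Longrightarrow> g \<odot> p \<in> fst d \<Longrightarrow> snd c p \<in> ltrans_dom g c d"
  by (simp add: ltrans_dom_def)

lemma jac_clin:
  assumes "c \<in> A" "d \<in> A" "p \<in> fst c" "g \<odot> p \<in> fst d"
  shows "clin (jac g p c d)"
  unfolding jac_def using holo_vec_onD(2)[OF ltrans_holo(2) ltrans_dom_point] assms by blast

text \<open>The chain rule for the composition of two left translations. Tangency, left
  invariance and chart independence below are all instances of this relation.\<close>

lemma jac_cocycle:
  assumes "c \<in> A" "d \<in> A" "k \<in> A" "p \<in> fst c" "g \<odot> p \<in> fst d" "h \<odot> (g \<odot> p) \<in> fst k"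
  shows "jac h (g \<odot> p) d k (jac g p c d v) = jac (h \<odot> g) p c k v"
proof -
  let ?S = "ltrans_dom g c d \<inter> ltrans_dom (h \<odot> g) c k"
  have sc: "snd c p \<in> ltrans_dom g c d" "snd c p \<in> ltrans_dom (h \<odot> g) c k"
    using assms by (auto intro!: ltrans_dom_point)
  have tp: "ltrans g c d (snd c p) = snd d (g \<odot> p)" using assms by (simp add: ltrans_def)
  have sd: "snd d (g \<odot> p) \<in> ltrans_dom h d k" using assms by (intro ltrans_dom_point) auto
  have "jac h (g \<odot> p) d k (jac g p c d v) = fd (\<lambda>u. ltrans h d k (ltrans g c d u)) (snd c p) v"
    unfolding jac_def tp[symmetric]
    by (rule fd_compose[symmetric])
      (use holo_vec_onD(3)[OF ltrans_holo(2)[OF assms(2,3)] sd] holo_vec_onD(3)[OF ltrans_holo(2)[OF assms(1,2)] sc(1)] tp in auto)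
  also have "fd (\<lambda>u. ltrans h d k (ltrans g c d u)) (snd c p) = fd (ltrans (h \<odot> g) c k) (snd c p)"
  proof (rule fd_cong[of ?S])
    show "open ?S" using ltrans_holo(1) assms by blast
    show "snd c p \<in> ?S" using sc by blast
    show "ltrans h d k (ltrans g c d u) = ltrans (h \<odot> g) c k u" if "u \<in> ?S" for u
      using that assms by (simp add: ltrans_def ltrans_dom_def)
  qed
  finally show ?thesis by (simp add: jac_def)
qed

lemma jac_id:
  assumes "c \<in> A" "p \<in> fst c"
  shows "jac e p c c v = v"
proof -
  have "fd (ltrans e c c) (snd c p) = fd (\<lambda>u. u) (snd c p)"
    by (rule fd_cong[OF ltrans_holo(1)[OF assms(1) assms(1), of e]]) (use assms in \<open>auto simp: ltrans_dom_def ltrans_def\<close>)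
  then show ?thesis by (simp add: jac_def)
qed

lemma ltrans_eq: "ltrans g c d = snd d \<circ> (\<lambda>x. g \<odot> x) \<circ> chart_inv c" "ltrans e c d = snd d \<circ> chart_inv c"
  by (auto simp: ltrans_def)

lemma tangent_space_iff:
  "v \<in> tangent_space A p \<longleftrightarrow> (\<forall>c. c \<notin> charts_at A p \<longrightarrow> v c = 0) \<and>
     (\<forall>c\<in>charts_at A p. \<forall>d\<in>charts_at A p. v d = jac e p c d (v c))"
  by (simp add: tangent_space_def jac_def ltrans_eq(2))

lemma tangentD:
  assumes "v \<in> tangent_space A p"
  shows "c \<notin> charts_at A p \<Longrightarrow> v c = 0"
    "c \<in> A \<Longrightarrow> p \<in> fst c \<Longrightarrow> d \<in> A \<Longrightarrow> p \<in> fst d \<Longrightarrow> jac e p c d (v c) = v d"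
proof -
  note * = assms[unfolded tangent_space_iff]
  show "c \<notin> charts_at A p \<Longrightarrow> v c = 0" using * by blast
  assume "c \<in> A" "p \<in> fst c" "d \<in> A" "p \<in> fst d"
  then have "c \<in> charts_at A p" "d \<in> charts_at A p" by (simp_all add: charts_atD)
  with * have "v d = jac e p c d (v c)" by blast
  then show "jac e p c d (v c) = v d" by (rule sym)
qed

lemma tangent_eqI:
  assumes "v \<in> tangent_space A p" "w \<in> tangent_space A p" "c \<in> A" "p \<in> fst c" "v c = w c"
  shows "v = w"
proof
  fix d show "v d = w d"
  proof (cases "d \<in> A \<and> p \<in> fst d")
    case True
    then show ?thesis
      using tangentD(2)[OF assms(1,3,4), of d] tangentD(2)[OF assms(2,3,4), of d] assms(5) by simp
  next
    case False
    then have nd: "d \<notin> charts_at A p" by (auto simp: charts_atD)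
    show ?thesis
      using tangentD(1)[OF assms(1) nd] tangentD(1)[OF assms(2) nd] by simp
  qed
qed

lemma coord_field_eq: "coord_field A c x p = (\<lambda>d. if d \<in> charts_at A p then jac e p c d x else 0)"
  unfolding coord_field_def jac_def ltrans_eq(2) by (rule refl)

lemma differential_eq:
  assumes "v \<in> tangent_space A p" "c \<in> A" "p \<in> fst c"
  shows "differential A A (\<lambda>x. g \<odot> x) p v = (\<lambda>d. if d \<in> charts_at A (g \<odot> p) then jac g p c d (v c) else 0)"
proof
  fix d
  define b where "b = chart_at A p"
  have b: "b \<in> A" "p \<in> fst b" by (auto simp: b_def chart_at)
  have J: "jac g p b d w = frechet_derivative (snd d \<circ> (\<lambda>x. g \<odot> x) \<circ> chart_inv b) (at (snd b p)) w" for w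
    by (simp only: jac_def ltrans_eq(1))
  show "differential A A (\<lambda>x. g \<odot> x) p v d = (if d \<in> charts_at A (g \<odot> p) then jac g p c d (v c) else 0)"
  proof (cases "d \<in> charts_at A (g \<odot> p)")
    case True
    then have d: "d \<in> A" "g \<odot> p \<in> fst d" by (auto simp: charts_atD)
    have "jac g (e \<odot> p) c d (jac e p b c (v b)) = jac (g \<odot> e) p b d (v b)"
      by (rule jac_cocycle) (use assms b d in simp_all)
    then have "jac g p c d (v c) = jac g p b d (v b)"
      using tangentD(2)[OF assms(1) b assms(2,3)] by (simp only: mul_simps)
    then show ?thesis
      using True unfolding differential_def Let_def b_def[symmetric] J by (simp only: if_True)
  next
    case False
    then show ?thesis unfolding differential_def by (simp only: if_False)
  qed
qed

section \<open>The left invariant frame\<close>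

abbreviation c0 where "c0 \<equiv> chart_at A e"

lemmas c0 = chart_at[of e]

text \<open>The left invariant field with value \<open>x\<close> at the identity, read in the chart \<open>c0\<close>.\<close>

definition frame :: "complex^'n \<Rightarrow> 'a \<Rightarrow> ('a, 'n) tvec" where
  "frame x p = (\<lambda>d. if d \<in> charts_at A p then jac p e c0 d x else 0)"

text \<open>The components of a tangent vector at \<open>p\<close> in the left invariant frame: the vector is
  moved back to the identity.\<close>

definition frame_coord :: "'a \<Rightarrow> ('a, 'n) tvec \<Rightarrow> complex^'n" where
  "frame_coord p v = jac (iv p) p (chart_at A p) c0 (v (chart_at A p))"

lemma frame_chart: "c \<in> A \<Longrightarrow> p \<in> fst c \<Longrightarrow> frame x p c = jac p e c0 c x"
  by (simp add: frame_def charts_atD)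

lemma frame_tangent: "frame x p \<in> tangent_space A p"
  unfolding tangent_space_iff
proof (intro conjI allI impI ballI)
  fix c d assume "c \<in> charts_at A p" "d \<in> charts_at A p"
  then have cd: "c \<in> A" "p \<in> fst c" "d \<in> A" "p \<in> fst d" by (auto simp: charts_atD)
  show "frame x p d = jac e p c d (frame x p c)"
    using jac_cocycle[of c0 c d e p e x] c0 cd by (simp add: frame_chart)
qed (simp add: frame_def)

lemma frame_translate: "differential A A (\<lambda>x. g \<odot> x) p (frame x p) = frame x (g \<odot> p)"
proof
  fix d
  show "differential A A (\<lambda>x. g \<odot> x) p (frame x p) d = frame x (g \<odot> p) d"
  proof (cases "d \<in> charts_at A (g \<odot> p)")
    case True
    then show ?thesis
      using jac_cocycle[of c0 "chart_at A p" d e p g x] c0 chart_at[of p]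
      unfolding differential_eq[OF frame_tangent chart_at] frame_chart[OF chart_at]
      by (simp add: frame_def charts_atD)
  next
    case False
    then show ?thesis
      unfolding differential_eq[OF frame_tangent chart_at] by (simp add: frame_def)
  qed
qed

lemma frame_jac:
  assumes "c \<in> A" "d \<in> A" "p \<in> fst c" "g \<odot> p \<in> fst d"
  shows "jac g p c d (frame x p c) = frame x (g \<odot> p) d"
  using jac_cocycle[of c0 c d e p g x] c0 assms by (simp add: frame_chart)

lemma frame_clin: "clin (\<lambda>x. frame x p c)"
proof (cases "c \<in> charts_at A p")
  case True
  then have "(\<lambda>x. frame x p c) = jac p e c0 c" by (auto simp: frame_def)
  then show ?thesis using jac_clin[of c0 c e p] c0 True by (simp add: charts_atD)
next
  case False
  then have "(\<lambda>x. frame x p c) = (\<lambda>x. 0)" by (auto simp: frame_def)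
  then show ?thesis by (auto intro: clinI)
qed

lemmas frame_linear = clin_simps[OF frame_clin]

lemma jac_inverse:
  assumes "c \<in> A" "p \<in> fst c"
  shows "jac p e c0 c (jac (iv p) p c c0 w) = w" "jac (iv p) p c c0 (jac p e c0 c w) = w"
proof -
  have "jac p (iv p \<odot> p) c0 c (jac (iv p) p c c0 w) = jac (p \<odot> iv p) p c c w"
    by (rule jac_cocycle) (use c0 assms in simp_all)
  then show "jac p e c0 c (jac (iv p) p c c0 w) = w"
    by (simp only: mul_simps jac_id[OF assms])
  have "jac (iv p) (p \<odot> e) c c0 (jac p e c0 c w) = jac (iv p \<odot> p) e c0 c0 w"
    by (rule jac_cocycle) (use c0 assms in simp_all)
  then show "jac (iv p) p c c0 (jac p e c0 c w) = w"
    by (simp only: mul_simps jac_id[OF c0])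
qed

lemma frame_coord_frame [simp]: "frame_coord p (frame x p) = x"
  unfolding frame_coord_def frame_chart[OF chart_at] by (rule jac_inverse(2)[OF chart_at])

lemma frame_frame_coord:
  assumes "v \<in> tangent_space A p"
  shows "frame (frame_coord p v) p = v"
proof (rule tangent_eqI[OF frame_tangent assms chart_at])
  show "frame (frame_coord p v) p (chart_at A p) = v (chart_at A p)"
    unfolding frame_coord_def frame_chart[OF chart_at] by (rule jac_inverse(1)[OF chart_at])
qed

lemma frame_inj: "frame x p = frame y p \<Longrightarrow> x = y"
  using frame_coord_frame by metis

lemma frame_inj_chart:
  assumes "c \<in> A" "p \<in> fst c" "frame x p c = frame y p c"
  shows "x = y"
  using frame_inj tangent_eqI[OF frame_tangent frame_tangent assms] by blast

text \<open>The value of the frame at \<open>p\<close> is a partial derivative, in the second factor at the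
  identity, of the multiplication, and partial derivatives of holomorphic maps are holomorphic.\<close>

lemma frame_holo:
  assumes "c \<in> A"
  shows "holo_vec_on (\<lambda>u. frame x (chart_inv c u) c) (im c)"
proof -
  let ?y0 = "snd c0 e"
  have sub: "join_vec u ?y0 \<in> mult_dom c c0 c" if "u \<in> im c" for u
    using that assms c0 by (simp add: mult_dom_def)
  have "holo_vec_on (\<lambda>u. fd (mult_chart c c0 c) (join_vec u ?y0) (join_vec 0 x)) (im c)"
    by (rule holo_vec_on_compose[OF holo_vec_directional_derivative[OF mult_chart_holo mult_dom_open]])
      (use assms c0 sub in \<open>auto intro!: holo_join_vec holo_vec_on_const holo_vec_on_id\<close>)
  then show ?thesis
  proof (rule holo_vec_on_cong[OF _ chart_open(2)[OF assms]])
    fix u assume u: "u \<in> im c"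
    let ?p = "chart_inv c u"
    have p: "?p \<in> fst c" using u assms by simp
    have "jac ?p e c0 c x = fd (\<lambda>y. mult_chart c c0 c (join_vec u y)) ?y0 x"
      by (simp add: jac_def ltrans_def[abs_def] mult_chart_def)
    also have "\<dots> = fd (mult_chart c c0 c) (join_vec u ?y0) (fd (join_vec u) ?y0 x)"
    proof (rule fd_compose)
      show "mult_chart c c0 c differentiable at (join_vec u ?y0)"
        by (rule holo_vec_onD(3)[OF mult_chart_holo sub[OF u]]) (use assms c0 in auto)
      have "holo_vec_on (join_vec u) (UNIV :: (complex^'n) set)"
        by (intro holo_join_vec[of "\<lambda>_. u" _ "\<lambda>x. x", simplified] holo_vec_on_const holo_vec_on_id)
      then show "join_vec u differentiable at ?y0" using holo_vec_onD(3) by blast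
    qed
    finally show "fd (mult_chart c c0 c) (join_vec u ?y0) (join_vec 0 x) = frame x ?p c"
      using assms p by (simp add: frame_chart fd_join_vec_right)
  qed
qed

lemma frame_family:
  assumes "c \<in> A"
  shows "\<And>w. holo_vec_on (\<lambda>v. frame w (chart_inv c v) c) (im c)"
    "\<And>v. v \<in> im c \<Longrightarrow> clin (\<lambda>w. frame w (chart_inv c v) c)"
    "open (im c)"
  using frame_holo[OF assms] frame_clin chart_open(2)[OF assms] by auto

end

section \<open>The Lie algebra\<close>

context complex_lie
begin

lemma lie_bracket_chart:
  assumes "c \<in> A" "p \<in> fst c"
  shows "lie_bracket A X Y p c =
    vf_bracket (\<lambda>u. X (chart_inv c u) c) (\<lambda>u. Y (chart_inv c u) c) (snd c p)"
  using assms by (simp add: lie_bracket_def vf_bracket_def charts_atD)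

definition alg_bracket :: "complex^'n \<Rightarrow> complex^'n \<Rightarrow> complex^'n" where
  "alg_bracket x y = lie_bracket A (frame x) (frame y) e c0"

text \<open>Left invariant fields are related to themselves under left translation, so by
  naturality their bracket at \<open>p\<close> is the translate of the bracket at the identity.\<close>

lemma lie_bracket_frame: "lie_bracket A (frame x) (frame y) p = frame (alg_bracket x y) p"
proof
  fix d :: "('a, 'n) chart"
  show "lie_bracket A (frame x) (frame y) p d = frame (alg_bracket x y) p d"
  proof (cases "d \<in> charts_at A p")
    case True
    then have d: "d \<in> A" "p \<in> fst d" by (auto simp: charts_atD)
    have nat: "frame z (chart_inv d (ltrans p c0 d u)) d = fd (ltrans p c0 d) u (frame z (chart_inv c0 u) c0)"
      if u: "u \<in> ltrans_dom p c0 d" for u z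
    proof -
      have u': "u \<in> im c0" "p \<odot> chart_inv c0 u \<in> fst d" using u by (auto simp: ltrans_dom_def)
      have "fd (ltrans p c0 d) u (frame z (chart_inv c0 u) c0) = jac p (chart_inv c0 u) c0 d (frame z (chart_inv c0 u) c0)"
        using u' c0 by (simp add: jac_def)
      also have "\<dots> = frame z (p \<odot> chart_inv c0 u) d"
        by (rule frame_jac) (use c0 d u' in auto)
      also have "p \<odot> chart_inv c0 u = chart_inv d (ltrans p c0 d u)"
        using u' d by (simp add: ltrans_def)
      finally show ?thesis by simp
    qed
    have pt: "ltrans p c0 d (snd c0 e) = snd d p" using c0 by (simp add: ltrans_def)
    have sub: "ltrans_dom p c0 d \<subseteq> im c0" by (auto simp: ltrans_dom_def)
    have "vf_bracket (\<lambda>u. frame x (chart_inv d u) d) (\<lambda>u. frame y (chart_inv d u) d) (ltrans p c0 d (snd c0 e))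
      = fd (ltrans p c0 d) (snd c0 e) (vf_bracket (\<lambda>u. frame x (chart_inv c0 u) c0) (\<lambda>u. frame y (chart_inv c0 u) c0) (snd c0 e))"
    proof (rule vf_bracket_natural[where S = "ltrans_dom p c0 d" and T = "im d"])
      show "holo_vec_on (ltrans p c0 d) (ltrans_dom p c0 d)" "open (ltrans_dom p c0 d)"
        using ltrans_holo[OF c0(1) d(1)] by auto
      show "ltrans p c0 d u \<in> im d" if "u \<in> ltrans_dom p c0 d" for u
        using that by (auto simp: ltrans_dom_def ltrans_def)
      show "snd c0 e \<in> ltrans_dom p c0 d" by (rule ltrans_dom_point) (use c0 d in auto)
    qed (use nat holo_vec_on_subset[OF frame_holo[OF c0(1)] sub] frame_holo[OF d(1)] in auto)
    then show ?thesis
      unfolding pt alg_bracket_def lie_bracket_chart[OF d] lie_bracket_chart[OF c0] frame_chart[OF d] jac_def .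
  next
    case False
    then show ?thesis by (simp add: lie_bracket_def frame_def)
  qed
qed

lemma frame_field: "open W \<Longrightarrow> holo_vector_field_on A W (frame x)"
  unfolding holo_vector_field_on_def
  using frame_tangent holo_vec_on_subset[OF frame_holo] by blast

lemma frame_lie_algebra: "frame x \<in> lie_algebra H A"
  unfolding lie_algebra_def using frame_field[OF open_UNIV] frame_translate by auto

text \<open>The hypothesis concerns fields in \<open>lie_algebra\<close>; the frame fields belong to
  it, and \<open>lie_bracket_frame\<close> turns their iterated bracket into one on coordinates.\<close>

lemma alg_bracket_nilpotent:
  assumes "two_step_nilpotent H A"
  shows "alg_bracket x (alg_bracket y z) = 0"
proof -
  have "lie_bracket A (frame x) (lie_bracket A (frame y) (frame z)) = (\<lambda>p c. 0)"
    using assms frame_lie_algebra unfolding two_step_nilpotent_def by blast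
  moreover have "lie_bracket A (frame y) (frame z) = frame (alg_bracket y z)"
    using lie_bracket_frame by blast
  ultimately have "frame (alg_bracket x (alg_bracket y z)) e = (\<lambda>c. 0)"
    using lie_bracket_frame by metis
  also have "\<dots> = frame 0 e" by (simp add: fun_eq_iff frame_linear)
  finally show ?thesis by (rule frame_inj)
qed

lemma fd_frame_clin:
  assumes "c \<in> A" "p \<in> fst c"
  shows "clin (\<lambda>x. fd (\<lambda>u. frame x (chart_inv c u) c) (snd c p) v)"
  by (rule fd_family_clin[OF frame_family[OF assms(1)]]) (use assms in auto)

lemma fd_frame_direction_clin:
  assumes "c \<in> A" "p \<in> fst c"
  shows "clin (fd (\<lambda>u. frame x (chart_inv c u) c) (snd c p))"
  using holo_vec_onD(2)[OF frame_holo[OF assms(1)]] assms by blast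

lemma alg_bracket_expand: "alg_bracket x y =
   fd (\<lambda>u. frame y (chart_inv c0 u) c0) (snd c0 e) (frame x e c0)
 - fd (\<lambda>u. frame x (chart_inv c0 u) c0) (snd c0 e) (frame y e c0)"
  unfolding alg_bracket_def lie_bracket_chart[OF c0] vf_bracket_def using c0 by simp

lemma alg_bracket_bilinear:
  "alg_bracket (x + y) z = alg_bracket x z + alg_bracket y z" "alg_bracket (k *s x) z = k *s alg_bracket x z"
  "alg_bracket z (x + y) = alg_bracket z x + alg_bracket z y" "alg_bracket z (k *s x) = k *s alg_bracket z x"
  unfolding alg_bracket_expand clin_simps[OF fd_frame_clin[OF c0]]
  unfolding frame_linear clin_simps[OF fd_frame_direction_clin[OF c0]]
  by (simp_all add: vec.scale_right_diff_distrib)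

lemma alg_bracket_antisym: "alg_bracket x y = - alg_bracket y x"
  unfolding alg_bracket_expand by simp

lemma alg_bracket_self: "alg_bracket x x = 0"
  unfolding alg_bracket_expand by simp

definition holo_coords :: "'a set \<Rightarrow> ('a \<Rightarrow> complex^'n) \<Rightarrow> bool" where
  "holo_coords W \<eta> \<longleftrightarrow> (\<forall>c\<in>A. holo_vec_on (\<lambda>u. \<eta> (chart_inv c u)) (snd c ` (fst c \<inter> W)))"

abbreviation coords :: "('a \<Rightarrow> ('a, 'n) tvec) \<Rightarrow> 'a \<Rightarrow> complex^'n" where
  "coords Y \<equiv> (\<lambda>r. frame_coord r (Y r))"

lemma holo_fieldD:
  assumes "holo_vector_field_on A W Y"
  shows "p \<in> W \<Longrightarrow> Y p \<in> tangent_space A p"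
    "c \<in> A \<Longrightarrow> holo_vec_on (\<lambda>u. Y (chart_inv c u) c) (snd c ` (fst c \<inter> W))"
  using assms unfolding holo_vector_field_on_def by auto

lemma field_of_coords:
  assumes "open W" "holo_coords W \<eta>"
  shows "holo_vector_field_on A W (\<lambda>r. frame (\<eta> r) r)"
  unfolding holo_vector_field_on_def
proof (intro conjI ballI frame_tangent)
  fix c assume c: "c \<in> A"
  show "holo_vec_on (\<lambda>u. frame (\<eta> (chart_inv c u)) (chart_inv c u) c) (snd c ` (fst c \<inter> W))"
    by (rule holo_linear_family[where \<Phi> = "\<lambda>u x. frame x (chart_inv c u) c"])
      (use c assms in \<open>auto simp: holo_coords_def intro!: holo_vec_on_subset[OF frame_holo[OF c]] frame_clin chart_image_open[OF c]\<close>)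
qed

lemma coords_of_field:
  assumes "open W" "holo_vector_field_on A W Y"
  shows "holo_coords W (coords Y)"
  unfolding holo_coords_def
proof
  fix c assume c: "c \<in> A"
  show "holo_vec_on (\<lambda>u. frame_coord (chart_inv c u) (Y (chart_inv c u))) (snd c ` (fst c \<inter> W))"
  proof (rule holo_linear_solve[where \<Phi> = "\<lambda>u x. frame x (chart_inv c u) c" and Y = "\<lambda>u. Y (chart_inv c u) c"])
    fix u assume u: "u \<in> snd c ` (fst c \<inter> W)"
    then have u': "chart_inv c u \<in> fst c" "chart_inv c u \<in> W" using c by auto
    show "inj (\<lambda>x. frame x (chart_inv c u) c)"
      using frame_inj_chart[OF c u'(1)] by (auto simp: inj_def)
    show "frame (frame_coord (chart_inv c u) (Y (chart_inv c u))) (chart_inv c u) c = Y (chart_inv c u) c"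
      using frame_frame_coord[OF holo_fieldD(1)[OF assms(2) u'(2)]] by simp
  qed (use c assms in \<open>auto intro!: holo_vec_on_subset[OF frame_holo[OF c]] frame_clin chart_image_open[OF c] holo_fieldD\<close>)
qed

text \<open>The definition uses a chosen chart; the chain rule for the coordinate change
  allows any chart at \<open>p\<close>.\<close>

lemma vec_deriv_chart:
  assumes W: "open W" "p \<in> W" and f: "holo_function_on A W f" and v: "v \<in> tangent_space A p"
    and c: "c \<in> A" "p \<in> fst c"
  shows "vec_deriv A p v f = fd (\<lambda>u. f (chart_inv c u)) (snd c p) (v c)"
proof -
  define b where "b = chart_at A p"
  have b: "b \<in> A" "p \<in> fst b" by (auto simp: b_def chart_at)
  have pt: "ltrans e b c (snd b p) = snd c p" using b by (simp add: ltrans_def)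
  have "holo_fun_on (\<lambda>u. f (chart_inv c u)) (snd c ` (fst c \<inter> W))"
    using f c by (simp add: holo_function_on_def o_def)
  then have df: "(\<lambda>u. f (chart_inv c u)) differentiable at (snd c p)"
    by (rule holo_fun_onD(3)) (use c W in auto)
  have dt: "ltrans e b c differentiable at (snd b p)"
    by (rule holo_vec_onD(3)[OF ltrans_holo(2) ltrans_dom_point]) (use b c in auto)
  have "vec_deriv A p v f = fd (\<lambda>u. f (chart_inv b u)) (snd b p) (v b)"
    by (simp add: vec_deriv_def Let_def b_def o_def)
  also have "fd (\<lambda>u. f (chart_inv b u)) (snd b p) = fd (\<lambda>u. f (chart_inv c (ltrans e b c u))) (snd b p)"
  proof (rule fd_cong[OF ltrans_holo(1)[OF b(1) c(1)] ltrans_dom_point])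
    show "f (chart_inv b u) = f (chart_inv c (ltrans e b c u))" if "u \<in> ltrans_dom e b c" for u
      using that c by (simp add: ltrans_dom_def ltrans_def)
  qed (use b c in auto)
  also have "\<dots> (v b) = fd (\<lambda>u. f (chart_inv c u)) (snd c p) (fd (ltrans e b c) (snd b p) (v b))"
    using fd_compose[of "\<lambda>u. f (chart_inv c u)" "ltrans e b c" "snd b p" "v b"] df dt by (simp add: pt)
  also have "fd (ltrans e b c) (snd b p) (v b) = v c"
    using tangentD(2)[OF v b c] by (simp add: jac_def)
  finally show ?thesis .
qed

definition cderiv :: "('a \<Rightarrow> complex^'n) \<Rightarrow> 'a \<Rightarrow> ('a, 'n) tvec \<Rightarrow> complex^'n" where
  "cderiv \<eta> p v = (\<chi> i. vec_deriv A p v (\<lambda>r. \<eta> r $ i))"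

lemma cderiv_chart:
  assumes W: "open W" "p \<in> W" and \<eta>: "holo_coords W \<eta>" and v: "v \<in> tangent_space A p"
    and c: "c \<in> A" "p \<in> fst c"
  shows "cderiv \<eta> p v = fd (\<lambda>u. \<eta> (chart_inv c u)) (snd c p) (v c)"
proof -
  have h: "holo_vec_on (\<lambda>u. \<eta> (chart_inv c u)) (snd c ` (fst c \<inter> W))"
    using \<eta> c by (simp add: holo_coords_def)
  have x: "snd c p \<in> snd c ` (fst c \<inter> W)" using W c by auto
  have "holo_function_on A W (\<lambda>r. \<eta> r $ i)" for i
    using \<eta> by (simp add: holo_coords_def holo_function_on_def holo_vec_on_def o_def)
  then have "vec_deriv A p v (\<lambda>r. \<eta> r $ i) = fd (\<lambda>u. \<eta> (chart_inv c u)) (snd c p) (v c) $ i" for i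
    using vec_deriv_chart[OF W _ v c] by (simp add: holo_vec_onD(4)[OF h x])
  then show ?thesis by (simp add: cderiv_def vec_eq_iff)
qed

text \<open>In a chart a field is the frame applied to its coordinates; the product rule
  separates the derivative of the frame from that of the coordinates.\<close>

lemma field_derivative:
  assumes W: "open W" "p \<in> W" and Y: "holo_vector_field_on A W Y" and c: "c \<in> A" "p \<in> fst c"
  shows "fd (\<lambda>u. Y (chart_inv c u) c) (snd c p) v =
    fd (\<lambda>u. frame (coords Y p) (chart_inv c u) c) (snd c p) v
    + frame (fd (\<lambda>u. coords Y (chart_inv c u)) (snd c p) v) p c"
proof -
  let ?S = "snd c ` (fst c \<inter> W)"
  have x: "snd c p \<in> ?S" using W c by auto
  have S: "open ?S" by (rule chart_image_open[OF c(1) W(1)])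
  have "fd (\<lambda>u. Y (chart_inv c u) c) (snd c p) v =
    fd (\<lambda>u. frame (coords Y (chart_inv c u)) (chart_inv c u) c) (snd c p) v"
  proof (rule arg_cong[of _ _ "\<lambda>g. g v"], rule fd_cong[OF S x])
    fix u assume "u \<in> ?S"
    then have "chart_inv c u \<in> W" using c by auto
    then show "Y (chart_inv c u) c = frame (coords Y (chart_inv c u)) (chart_inv c u) c"
      using frame_frame_coord[OF holo_fieldD(1)[OF Y]] by simp
  qed
  also have "\<dots> = fd (\<lambda>u. frame (coords Y (chart_inv c (snd c p))) (chart_inv c u) c) (snd c p) v
    + frame (fd (\<lambda>u. coords Y (chart_inv c u)) (snd c p) v) (chart_inv c (snd c p)) c"
    by (rule fd_linear_family[where \<Phi> = "\<lambda>u x. frame x (chart_inv c u) c" and S = ?S])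
      (use c S x coords_of_field[OF W(1) Y] in \<open>auto simp: holo_coords_def intro!: holo_vec_on_subset[OF frame_holo[OF c(1)]] frame_clin\<close>)
  finally show ?thesis using c by simp
qed

text \<open>The Leibniz rule for the bracket of two fields with variable coordinates.\<close>

lemma lie_bracket_coords:
  assumes W: "open W" "p \<in> W" and X: "holo_vector_field_on A W X" and Y: "holo_vector_field_on A W Y"
  shows "lie_bracket A X Y p =
    frame (cderiv (coords Y) p (X p) - cderiv (coords X) p (Y p) + alg_bracket (coords X p) (coords Y p)) p"
proof
  fix d :: "('a, 'n) chart"
  show "lie_bracket A X Y p d =
    frame (cderiv (coords Y) p (X p) - cderiv (coords X) p (Y p) + alg_bracket (coords X p) (coords Y p)) p d"
  proof (cases "d \<in> charts_at A p")
    case True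
    then have d: "d \<in> A" "p \<in> fst d" by (auto simp: charts_atD)
    let ?x = "coords X p" and ?y = "coords Y p"
    have fx: "frame ?x p = X p" and fy: "frame ?y p = Y p"
      using frame_frame_coord holo_fieldD(1)[OF X] holo_fieldD(1)[OF Y] W by auto
    have "frame (alg_bracket ?x ?y) p d =
        fd (\<lambda>u. frame ?y (chart_inv d u) d) (snd d p) (X p d) - fd (\<lambda>u. frame ?x (chart_inv d u) d) (snd d p) (Y p d)"
      using lie_bracket_chart[OF d, of "frame ?x" "frame ?y"] d
      by (simp add: lie_bracket_frame vf_bracket_def fx fy)
    moreover have "cderiv (coords Y) p (X p) = fd (\<lambda>u. coords Y (chart_inv d u)) (snd d p) (X p d)"
      by (rule cderiv_chart[OF W coords_of_field[OF W(1) Y] holo_fieldD(1)[OF X W(2)] d])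
    moreover have "cderiv (coords X) p (Y p) = fd (\<lambda>u. coords X (chart_inv d u)) (snd d p) (Y p d)"
      by (rule cderiv_chart[OF W coords_of_field[OF W(1) X] holo_fieldD(1)[OF Y W(2)] d])
    moreover have "lie_bracket A X Y p d = fd (\<lambda>u. Y (chart_inv d u) d) (snd d p) (X p d)
        - fd (\<lambda>u. X (chart_inv d u) d) (snd d p) (Y p d)"
      using d by (simp add: lie_bracket_chart vf_bracket_def)
    ultimately show ?thesis
      unfolding field_derivative[OF W X d] field_derivative[OF W Y d] by (simp add: frame_linear)
  next
    case False
    then show ?thesis by (simp add: lie_bracket_def frame_def)
  qed
qed

lemma tangent_add:
  assumes "v \<in> tangent_space A p" "w \<in> tangent_space A p"
  shows "(\<lambda>c. v c + w c) \<in> tangent_space A p"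
proof -
  have "(\<lambda>c. v c + w c) = frame (frame_coord p v + frame_coord p w) p"
    using frame_frame_coord[OF assms(1)] frame_frame_coord[OF assms(2)] by (simp add: fun_eq_iff frame_linear)
  then show ?thesis using frame_tangent by simp
qed

lemma tangent_scale:
  assumes "v \<in> tangent_space A p"
  shows "(\<lambda>c. k *s v c) \<in> tangent_space A p"
proof -
  have "(\<lambda>c. k *s v c) = frame (k *s frame_coord p v) p"
    using frame_frame_coord[OF assms(1)] by (simp add: fun_eq_iff frame_linear)
  then show ?thesis using frame_tangent by simp
qed

lemma frame_coord_linear:
  "frame_coord p (\<lambda>c. v c + w c) = frame_coord p v + frame_coord p w" "frame_coord p (\<lambda>c. k *s v c) = k *s frame_coord p v"
proof -
  have cl: "clin (jac (iv p) p (chart_at A p) c0)"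
    by (rule jac_clin) (use chart_at[of p] c0 in auto)
  show "frame_coord p (\<lambda>c. v c + w c) = frame_coord p v + frame_coord p w" "frame_coord p (\<lambda>c. k *s v c) = k *s frame_coord p v"
    unfolding frame_coord_def by (simp_all add: clin_simps[OF cl])
qed

end

section \<open>The Levi-Civita connection\<close>

locale metric_lie = complex_lie H A
  for H :: "('a::{t2_space, second_countable_topology}) monoid"
    and A :: "('a, 'n::finite) chart set" +
  fixes q :: "'a \<Rightarrow> ('a, 'n) tvec \<Rightarrow> ('a, 'n) tvec \<Rightarrow> complex"
  assumes metric: "holo_riemannian_metric A q"
    and inv: "left_invariant H A q"
begin

text \<open>The inner product that the metric induces on the Lie algebra.\<close>

definition g :: "complex^'n \<Rightarrow> complex^'n \<Rightarrow> complex" where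
  "g x y = q e (frame x e) (frame y e)"

lemma q_frame: "q p (frame x p) (frame y p) = g x y"
proof -
  have "q (p \<odot> e) (differential A A (\<lambda>x. p \<odot> x) e (frame x e)) (differential A A (\<lambda>x. p \<odot> x) e (frame y e))
      = q e (frame x e) (frame y e)"
    by (rule inv[unfolded left_invariant_def, rule_format]) (rule frame_tangent)+
  then show ?thesis
    unfolding frame_translate g_def by simp
qed

lemma q_coeff:
  assumes "v \<in> tangent_space A p" "w \<in> tangent_space A p"
  shows "q p v w = g (frame_coord p v) (frame_coord p w)"
  using q_frame[of p "frame_coord p v" "frame_coord p w"] frame_frame_coord[OF assms(1)] frame_frame_coord[OF assms(2)] by simp

lemma q_linear:
  assumes "u \<in> tangent_space A p" "v \<in> tangent_space A p" "w \<in> tangent_space A p"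
  shows "q p (\<lambda>c. u c + v c) w = q p u w + q p v w" "q p (\<lambda>c. k *s v c) w = k * q p v w"
  using metric[unfolded holo_riemannian_metric_def, THEN conjunct1, rule_format, OF assms] by auto

lemma g_sym: "g x y = g y x"
  unfolding g_def
  by (rule metric[unfolded holo_riemannian_metric_def, THEN conjunct2, THEN conjunct1, rule_format])
    (rule frame_tangent)+

lemma g_add_left: "g (x + y) z = g x z + g y z"
proof -
  have "frame (x + y) e = (\<lambda>c. frame x e c + frame y e c)"
    by (simp add: fun_eq_iff frame_linear)
  then show ?thesis
    unfolding g_def by (simp only: q_linear[OF frame_tangent frame_tangent frame_tangent])
qed

lemma g_scale_left: "g (k *s x) z = k * g x z"
proof -
  have "frame (k *s x) e = (\<lambda>c. k *s frame x e c)"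
    by (simp add: fun_eq_iff frame_linear)
  then show ?thesis
    unfolding g_def by (simp only: q_linear(2)[OF frame_tangent frame_tangent frame_tangent])
qed

lemma g_add_right: "g z (x + y) = g z x + g z y"
  using g_add_left g_sym by metis

lemma g_scale_right: "g z (k *s x) = k * g z x"
  using g_scale_left g_sym by metis

lemma g_minus: "g (- x) z = - g x z" "g z (- x) = - g z x"
  using g_scale_left[of "-1" x z] g_scale_right[of z "-1" x] by simp_all

lemma g_diff: "g (x - y) z = g x z - g y z" "g z (x - y) = g z x - g z y"
  using g_add_left[of x "-y" z] g_add_right[of z x "-y"] g_minus by simp_all

lemma g_zero: "g 0 z = 0" "g z 0 = 0"
  using g_scale_left[of 0 0 z] g_scale_right[of z 0 0] by simp_all

lemmas g_simps = g_add_left g_add_right g_scale_left g_scale_right g_minus g_diff g_zero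

lemma g_nondegenerate:
  assumes "\<And>y. g x y = 0"
  shows "x = 0"
proof -
  have "q e (frame x e) w = 0" if "w \<in> tangent_space A e" for w
    using q_coeff[OF frame_tangent that, of x] assms by simp
  then have all: "\<forall>w\<in>tangent_space A e. q e (frame x e) w = 0" by blast
  have "frame x e = (\<lambda>c. 0)"
    using metric[unfolded holo_riemannian_metric_def, THEN conjunct2, THEN conjunct2, THEN conjunct1,
        THEN spec[of _ e], THEN bspec[OF _ frame_tangent], THEN mp, OF all] .
  also have "\<dots> = frame 0 e" by (simp add: fun_eq_iff frame_linear)
  finally show ?thesis by (rule frame_inj)
qed

lemma g_ext: "(\<And>z. g x z = g y z) \<Longrightarrow> x = y"
  using g_nondegenerate[of "x - y"] by (simp add: g_diff)

text \<open>A nondegenerate form is an injective linear map into the dual space, hence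
  surjective by finite dimension.\<close>

lemma g_representation:
  assumes "\<And>x y. l (x + y) = l x + l y" "\<And>k x. l (k *s x) = k * l x"
  shows "\<exists>z. \<forall>y. g z y = l y"
proof -
  have "clin (\<lambda>z. \<chi> i. g z (axis i 1))"
    by (rule clinI) (simp_all add: vec_eq_iff g_simps)
  moreover have "inj (\<lambda>z. \<chi> i. g z (axis i 1))"
  proof (rule injI, rule g_ext)
    fix x y z :: "complex^'n"
    assume "(\<chi> i. g x (axis i 1)) = (\<chi> i. g y (axis i 1))"
    then have ax: "g x (axis i 1) = g y (axis i 1)" for i by (simp add: vec_eq_iff)
    have "g x (\<Sum>i\<in>I. z $ i *s axis i 1) = g y (\<Sum>i\<in>I. z $ i *s axis i 1)" for I
      by (induction I rule: infinite_finite_induct) (simp_all add: g_simps ax)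
    from this[of UNIV] show "g x z = g y z" unfolding basis_expansion .
  qed
  ultimately have "surj (\<lambda>z. \<chi> i. g z (axis i 1))"
    by (rule vec.linear_injective_imp_surjective) (rule refl)
  from surjD[OF this, of "\<chi> i. l (axis i 1)"]
  obtain z where z: "(\<chi> i. l (axis i 1)) = (\<chi> i. g z (axis i 1))" by blast
  have z': "g z (axis i 1) = l (axis i 1)" for i using z by (simp add: vec_eq_iff)
  have l0: "l 0 = 0" using assms(2)[of 0 0] by simp
  have "g z (\<Sum>i\<in>I. y $ i *s axis i 1) = l (\<Sum>i\<in>I. y $ i *s axis i 1)" for I y
    by (induction I rule: infinite_finite_induct) (simp_all add: g_simps assms l0 z')
  from this[of _ UNIV] have "g z y = l y" for y unfolding basis_expansion .
  then show ?thesis by blast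
qed

text \<open>The Koszul formula for left invariant fields: the derivatives of inner products of frame
  fields vanish, which leaves the three bracket terms.\<close>

definition koszul :: "complex^'n \<Rightarrow> complex^'n \<Rightarrow> complex^'n" where
  "koszul x y = (SOME z. \<forall>w. g z w = (g (alg_bracket x y) w - g (alg_bracket y w) x + g (alg_bracket w x) y) / 2)"

lemma g_koszul: "g (koszul x y) w = (g (alg_bracket x y) w - g (alg_bracket y w) x + g (alg_bracket w x) y) / 2"
proof -
  have "\<exists>z. \<forall>w. g z w = (g (alg_bracket x y) w - g (alg_bracket y w) x + g (alg_bracket w x) y) / 2"
    by (rule g_representation) (simp_all add: g_simps alg_bracket_bilinear algebra_simps add_divide_distrib diff_divide_distrib)
  from someI_ex[OF this] show ?thesis unfolding koszul_def by blast
qed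

lemma koszul_bilinear:
  "koszul (x + y) z = koszul x z + koszul y z" "koszul (k *s x) z = k *s koszul x z"
  "koszul z (x + y) = koszul z x + koszul z y" "koszul z (k *s x) = k *s koszul z x"
  by (rule g_ext, simp add: g_koszul g_simps alg_bracket_bilinear algebra_simps add_divide_distrib diff_divide_distrib)+

lemma koszul_torsion: "koszul x y - koszul y x = alg_bracket x y"
proof (rule g_ext)
  fix z
  show "g (koszul x y - koszul y x) z = g (alg_bracket x y) z"
    using alg_bracket_antisym[of y x] alg_bracket_antisym[of x z] alg_bracket_antisym[of z y]
    by (simp add: g_koszul g_simps field_simps)
qed

lemma koszul_metric: "g (koszul x y) z + g y (koszul x z) = 0"
  using alg_bracket_antisym[of z y] alg_bracket_antisym[of x z] alg_bracket_antisym[of y x]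
  unfolding g_sym[of y "koszul x z"] by (simp add: g_koszul g_simps field_simps)

text \<open>Up to sign the vector field of the Euler equation, tested against \<open>z\<close>.\<close>

lemma koszul_self: "g (koszul x x) z = g x (alg_bracket z x)"
  unfolding g_koszul alg_bracket_antisym[of x z] by (simp add: alg_bracket_self g_zero g_minus g_sym[of x "alg_bracket z x"])

text \<open>The connection is fixed by its values \<open>koszul\<close> on frame fields and the Leibniz rule. The
  coordinates of the field are differentiated componentwise by \<open>cderiv\<close>.\<close>

definition conn :: "'a \<Rightarrow> ('a, 'n) tvec \<Rightarrow> ('a \<Rightarrow> ('a, 'n) tvec) \<Rightarrow> ('a, 'n) tvec" where
  "conn p v Y = frame (cderiv (coords Y) p v + koszul (frame_coord p v) (coords Y p)) p"

lemma cderiv_linear: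
  assumes W: "open W" "p \<in> W" and \<eta>: "holo_coords W \<eta>"
    and v: "v \<in> tangent_space A p" "w \<in> tangent_space A p"
  shows "cderiv \<eta> p (\<lambda>c. v c + w c) = cderiv \<eta> p v + cderiv \<eta> p w"
    "cderiv \<eta> p (\<lambda>c. k *s v c) = k *s cderiv \<eta> p v"
proof -
  define c where "c = chart_at A p"
  have c: "c \<in> A" "p \<in> fst c" by (auto simp: c_def chart_at)
  have "clin (fd (\<lambda>u. \<eta> (chart_inv c u)) (snd c p))"
    by (rule holo_vec_onD(2)[of _ "snd c ` (fst c \<inter> W)"]) (use \<eta> c W in \<open>auto simp: holo_coords_def\<close>)
  note cl = clin_simps[OF this]
  note d = cderiv_chart[OF W \<eta> _ c]
  show "cderiv \<eta> p (\<lambda>c. v c + w c) = cderiv \<eta> p v + cderiv \<eta> p w"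
    using d[OF tangent_add[OF v]] d[OF v(1)] d[OF v(2)] cl(1) by simp
  show "cderiv \<eta> p (\<lambda>c. k *s v c) = k *s cderiv \<eta> p v"
    using d[OF tangent_scale[OF v(1)]] d[OF v(1)] cl(2) by simp
qed

lemma cderiv_add:
  assumes W: "open W" "p \<in> W" and \<eta>: "holo_coords W \<eta>" "holo_coords W \<zeta>" and v: "v \<in> tangent_space A p"
  shows "cderiv (\<lambda>r. \<eta> r + \<zeta> r) p v = cderiv \<eta> p v + cderiv \<zeta> p v"
proof -
  define c where "c = chart_at A p"
  have c: "c \<in> A" "p \<in> fst c" by (auto simp: c_def chart_at)
  let ?S = "snd c ` (fst c \<inter> W)"
  have x: "snd c p \<in> ?S" using c W by auto
  have h: "holo_vec_on (\<lambda>u. \<eta> (chart_inv c u)) ?S" "holo_vec_on (\<lambda>u. \<zeta> (chart_inv c u)) ?S"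
    using \<eta> c by (auto simp: holo_coords_def)
  have s: "holo_coords W (\<lambda>r. \<eta> r + \<zeta> r)" using \<eta> by (auto simp: holo_coords_def intro: holo_vec_on_add)
  show ?thesis
    unfolding cderiv_chart[OF W \<eta>(1) v c] cderiv_chart[OF W \<eta>(2) v c] cderiv_chart[OF W s v c]
    using frechet_derivative_at[OF has_derivative_add[OF holo_vec_onD(1)[OF h(1) x] holo_vec_onD(1)[OF h(2) x]], symmetric]
    by simp
qed

lemma cderiv_scale:
  assumes W: "open W" "p \<in> W" and f: "holo_function_on A W f" and \<eta>: "holo_coords W \<eta>" and v: "v \<in> tangent_space A p"
  shows "cderiv (\<lambda>r. f r *s \<eta> r) p v = vec_deriv A p v f *s \<eta> p + f p *s cderiv \<eta> p v"
proof -
  define c where "c = chart_at A p"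
  have c: "c \<in> A" "p \<in> fst c" by (auto simp: c_def chart_at)
  let ?S = "snd c ` (fst c \<inter> W)"
  have x: "snd c p \<in> ?S" using c W by auto
  have h: "holo_vec_on (\<lambda>u. \<eta> (chart_inv c u)) ?S" "holo_fun_on (\<lambda>u. f (chart_inv c u)) ?S"
    using \<eta> f c by (auto simp: holo_coords_def holo_function_on_def o_def)
  have s: "holo_coords W (\<lambda>r. f r *s \<eta> r)"
    using \<eta> f by (auto simp: holo_coords_def holo_function_on_def o_def intro: holo_vec_on_scale)
  show ?thesis
    unfolding cderiv_chart[OF W \<eta>(1) v c] vec_deriv_chart[OF W f v c] cderiv_chart[OF W s v c]
    using frechet_derivative_at[OF bounded_bilinear.FDERIV[OF bounded_bilinear_vector_scale
          holo_fun_onD(1)[OF h(2) x] holo_vec_onD(1)[OF h(1) x]], symmetric] c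
    by simp
qed

lemma cderiv_cong:
  assumes "open W" "p \<in> W" "\<And>r. r \<in> W \<Longrightarrow> \<eta> r = \<zeta> r"
  shows "cderiv \<eta> p v = cderiv \<zeta> p v"
proof -
  define c where "c = chart_at A p"
  have c: "c \<in> A" "p \<in> fst c" by (auto simp: c_def chart_at)
  have "fd ((\<lambda>r. \<eta> r $ i) \<circ> chart_inv c) (snd c p) = fd ((\<lambda>r. \<zeta> r $ i) \<circ> chart_inv c) (snd c p)" for i
    by (rule fd_cong[OF chart_image_open[OF c(1) assms(1)]]) (use c assms in auto)
  then show ?thesis
    by (simp add: cderiv_def vec_deriv_def Let_def c_def)
qed

lemma bounded_bilinear_g: "bounded_bilinear g"
  unfolding bilinear_conv_bounded_bilinear[symmetric] bilinear_def
  by (auto intro!: linearI simp: g_simps scaleR_vector_scale scaleR_conv_of_real)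

text \<open>Frame coordinates are holomorphic exactly when the field is, so it suffices to see
  that these coordinates depend holomorphically on the point.\<close>

lemma conn_coords:
  assumes W: "open W" and X: "holo_vector_field_on A W X" and Y: "holo_vector_field_on A W Y"
  shows "holo_coords W (\<lambda>p. cderiv (coords Y) p (X p) + koszul (coords X p) (coords Y p))"
  unfolding holo_coords_def
proof
  fix c assume c: "c \<in> A"
  let ?S = "snd c ` (fst c \<inter> W)" and ?X = "\<lambda>u. X (chart_inv c u) c"
    and ?x = "\<lambda>u. coords X (chart_inv c u)" and ?y = "\<lambda>u. coords Y (chart_inv c u)"
  have S: "open ?S" by (rule chart_image_open[OF c W])
  have x: "holo_vec_on ?x ?S" and y: "holo_vec_on ?y ?S"
    using coords_of_field[OF W X] coords_of_field[OF W Y] c by (auto simp: holo_coords_def)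
  have "holo_vec_on (\<lambda>u. fd ?y u (?X u)) ?S"
    by (rule holo_linear_family[where \<Phi> = "fd ?y"])
      (use holo_vec_directional_derivative[OF y S] holo_vec_onD(2)[OF y] holo_fieldD(2)[OF X c] S in auto)
  moreover have "holo_vec_on (\<lambda>u. koszul (?x u) w) ?S" for w
    by (rule holo_linear_family[where \<Phi> = "\<lambda>u x. koszul x w"])
      (use x S in \<open>auto intro!: holo_vec_on_const clinI simp: koszul_bilinear\<close>)
  then have "holo_vec_on (\<lambda>u. koszul (?x u) (?y u)) ?S"
    by (rule holo_linear_family) (use y S in \<open>auto intro!: clinI simp: koszul_bilinear\<close>)
  ultimately have "holo_vec_on (\<lambda>u. fd ?y u (?X u) + koszul (?x u) (?y u)) ?S"
    by (rule holo_vec_on_add)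
  then show "holo_vec_on (\<lambda>u. cderiv (coords Y) (chart_inv c u) (X (chart_inv c u)) + koszul (?x u) (?y u)) ?S"
  proof (rule holo_vec_on_cong[OF _ S])
    fix u assume u: "u \<in> ?S"
    then have u': "chart_inv c u \<in> fst c" "chart_inv c u \<in> W" "snd c (chart_inv c u) = u" using c by auto
    show "fd ?y u (?X u) + koszul (?x u) (?y u) =
      cderiv (coords Y) (chart_inv c u) (X (chart_inv c u)) + koszul (?x u) (?y u)"
      using cderiv_chart[OF W u'(2) coords_of_field[OF W Y] holo_fieldD(1)[OF X u'(2)] c u'(1)] u'(3) by simp
  qed
qed

lemma conn_holo_connection: "holo_connection A conn"
  unfolding holo_connection_def
proof (intro conjI allI impI ballI)
  show "conn p v Y \<in> tangent_space A p" for p v Y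
    unfolding conn_def by (rule frame_tangent)
next
  fix W p v and Y Z :: "'a \<Rightarrow> ('a, 'n) tvec"
  assume W: "open W" and eq: "\<forall>p\<in>W. Y p = Z p" and p: "p \<in> W"
  have "cderiv (coords Y) p v = cderiv (coords Z) p v"
    by (rule cderiv_cong[OF W p]) (use eq in simp)
  then show "conn p v Y = conn p v Z"
    using eq p by (simp add: conn_def)
next
  fix W p v w k and Y :: "'a \<Rightarrow> ('a, 'n) tvec"
  assume W: "open W" and Y: "holo_vector_field_on A W Y" and p: "p \<in> W"
    and v: "v \<in> tangent_space A p" "w \<in> tangent_space A p"
  note l = cderiv_linear[OF W p coords_of_field[OF W Y] v]
  show "conn p (\<lambda>c. v c + w c) Y = (\<lambda>c. conn p v Y c + conn p w Y c)"
    unfolding conn_def l frame_coord_linear koszul_bilinear frame_linear[abs_def]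
    by (simp add: fun_eq_iff frame_linear algebra_simps)
  show "conn p (\<lambda>c. k *s v c) Y = (\<lambda>c. k *s conn p v Y c)"
    unfolding conn_def l frame_coord_linear koszul_bilinear
    by (simp add: fun_eq_iff frame_linear vec.scale_right_distrib)
next
  fix W p v and Y Z :: "'a \<Rightarrow> ('a, 'n) tvec"
  assume W: "open W" and Y: "holo_vector_field_on A W Y" and Z: "holo_vector_field_on A W Z"
    and p: "p \<in> W" and v: "v \<in> tangent_space A p"
  show "conn p v (\<lambda>r c. Y r c + Z r c) = (\<lambda>c. conn p v Y c + conn p v Z c)"
    unfolding conn_def frame_coord_linear koszul_bilinear
      cderiv_add[OF W p coords_of_field[OF W Y] coords_of_field[OF W Z] v]
    by (simp add: fun_eq_iff frame_linear algebra_simps)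
next
  fix W f p v and Y :: "'a \<Rightarrow> ('a, 'n) tvec"
  assume W: "open W" and f: "holo_function_on A W f" and Y: "holo_vector_field_on A W Y"
    and p: "p \<in> W" and v: "v \<in> tangent_space A p"
  have fy: "frame (coords Y p) p = Y p" by (rule frame_frame_coord[OF holo_fieldD(1)[OF Y p]])
  show "conn p v (\<lambda>r c. f r *s Y r c) = (\<lambda>c. vec_deriv A p v f *s Y p c + f p *s conn p v Y c)"
    unfolding conn_def frame_coord_linear koszul_bilinear cderiv_scale[OF W p f coords_of_field[OF W Y] v]
    by (simp add: fun_eq_iff frame_linear fy vec.scale_right_distrib)
next
  fix W and X Y :: "'a \<Rightarrow> ('a, 'n) tvec"
  assume W: "open W" and X: "holo_vector_field_on A W X" and Y: "holo_vector_field_on A W Y"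
  show "holo_vector_field_on A W (\<lambda>p. conn p (X p) Y)"
    unfolding conn_def by (rule field_of_coords[OF W conn_coords[OF W X Y]])
qed

lemma conn_torsion_free: "torsion_free A conn"
  unfolding torsion_free_def
proof (intro allI impI ballI)
  fix W p and X Y :: "'a \<Rightarrow> ('a, 'n) tvec"
  assume W: "open W" and X: "holo_vector_field_on A W X" and Y: "holo_vector_field_on A W Y" and p: "p \<in> W"
  show "(\<lambda>c. conn p (X p) Y c - conn p (Y p) X c) = lie_bracket A X Y p"
    unfolding lie_bracket_coords[OF W p X Y] koszul_torsion[symmetric] conn_def
    by (simp add: fun_eq_iff frame_linear algebra_simps)
qed

text \<open>Inner products of fields are inner products of their frame coordinates, with constant
  \<open>g\<close>. The product rule for \<open>g\<close> leaves the skew-symmetry of \<open>koszul\<close>.\<close>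

lemma conn_metric: "metric_connection A q conn"
  unfolding metric_connection_def
proof (intro allI impI ballI)
  fix W p v and Y Z :: "'a \<Rightarrow> ('a, 'n) tvec"
  assume W: "open W" and Y: "holo_vector_field_on A W Y" and Z: "holo_vector_field_on A W Z"
    and p: "p \<in> W" and v: "v \<in> tangent_space A p"
  define c where "c = chart_at A p"
  have c: "c \<in> A" "p \<in> fst c" by (auto simp: c_def chart_at)
  let ?S = "snd c ` (fst c \<inter> W)" and ?y = "\<lambda>u. coords Y (chart_inv c u)" and ?z = "\<lambda>u. coords Z (chart_inv c u)"
  have x: "snd c p \<in> ?S" using c p by auto
  have S: "open ?S" by (rule chart_image_open[OF c(1) W])
  have h: "holo_vec_on ?y ?S" "holo_vec_on ?z ?S"
    using coords_of_field[OF W Y] coords_of_field[OF W Z] c by (auto simp: holo_coords_def)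
  have "holo_function_on A W (\<lambda>r. q r (Y r) (Z r))"
    by (rule metric[unfolded holo_riemannian_metric_def, THEN conjunct2, THEN conjunct2, THEN conjunct2, rule_format,
          OF W Y Z])
  then have "vec_deriv A p v (\<lambda>r. q r (Y r) (Z r)) = fd (\<lambda>u. q (chart_inv c u) (Y (chart_inv c u)) (Z (chart_inv c u))) (snd c p) (v c)"
    by (rule vec_deriv_chart[OF W p _ v c])
  also have "fd (\<lambda>u. q (chart_inv c u) (Y (chart_inv c u)) (Z (chart_inv c u))) (snd c p) = fd (\<lambda>u. g (?y u) (?z u)) (snd c p)"
  proof (rule fd_cong[OF S x])
    fix u assume "u \<in> ?S"
    then have "chart_inv c u \<in> W" using c by auto
    then show "q (chart_inv c u) (Y (chart_inv c u)) (Z (chart_inv c u)) = g (?y u) (?z u)"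
      by (intro q_coeff holo_fieldD(1)[OF Y] holo_fieldD(1)[OF Z])
  qed
  also have "\<dots> (v c) = g (coords Y p) (fd ?z (snd c p) (v c)) + g (fd ?y (snd c p) (v c)) (coords Z p)"
    using frechet_derivative_at[OF bounded_bilinear.FDERIV[OF bounded_bilinear_g
          holo_vec_onD(1)[OF h(1) x] holo_vec_onD(1)[OF h(2) x]], symmetric] c by simp
  also have "\<dots> = g (coords Y p) (cderiv (coords Z) p v) + g (cderiv (coords Y) p v) (coords Z p)"
    unfolding cderiv_chart[OF W p coords_of_field[OF W Y] v c] cderiv_chart[OF W p coords_of_field[OF W Z] v c] ..
  also have "\<dots> = q p (conn p v Y) (Z p) + q p (Y p) (conn p v Z)"
    using koszul_metric[of "frame_coord p v" "coords Y p" "coords Z p"]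
      q_coeff[OF _ holo_fieldD(1)[OF Z p], of "conn p v Y"] q_coeff[OF holo_fieldD(1)[OF Y p], of "conn p v Z"]
    by (simp add: conn_def frame_tangent g_simps algebra_simps)
  finally show "vec_deriv A p v (\<lambda>r. q r (Y r) (Z r)) = q p (conn p v Y) (Z p) + q p (Y p) (conn p v Z)" .
qed

theorem conn_levi_civita: "levi_civita A q conn"
  unfolding levi_civita_def using conn_holo_connection conn_torsion_free conn_metric by blast

end

section \<open>Curves with prescribed left logarithmic derivative\<close>

context complex_lie
begin

lemma left_mult_continuous: "isCont (\<lambda>x. h \<odot> x) p"
proof -
  have "continuous_on UNIV (\<lambda>x. (\<lambda>(x, y). x \<odot> y) (h, x))"
    by (rule continuous_on_compose2[OF mult_continuous]) (auto intro!: continuous_intros)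
  then show ?thesis by (simp add: continuous_on_eq_continuous_at)
qed

lemma chart_isCont:
  assumes "c \<in> A"
  shows "p \<in> fst c \<Longrightarrow> isCont (snd c) p" "v \<in> im c \<Longrightarrow> isCont (chart_inv c) v"
  using chart_open[OF assms] by (auto simp: homeomorphism_def continuous_on_eq_continuous_at)

lemma isCont_open_nbhd:
  fixes \<gamma> :: "complex \<Rightarrow> 'b::topological_space"
  assumes "isCont \<gamma> t" "open V" "\<gamma> t \<in> V"
  obtains U where "open U" "t \<in> U" "\<And>s. s \<in> U \<Longrightarrow> \<gamma> s \<in> V"
proof -
  have "(\<gamma> \<longlongrightarrow> \<gamma> t) (nhds t)"
    using assms(1) by (simp only: isCont_def tendsto_at_iff_tendsto_nhds)
  then have "\<forall>\<^sub>F s in nhds t. \<gamma> s \<in> V" using assms(2,3) topological_tendstoD by blast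
  then show ?thesis using that unfolding eventually_nhds by blast
qed

text \<open>At the time \<open>t\<close> the curve has left logarithmic derivative \<open>u t\<close>, that is, its velocity
  has frame coordinates \<open>u t\<close>. A pointwise formulation makes the condition local, so that solutions
  can be glued.\<close>

definition solves :: "(complex \<Rightarrow> complex^'n) \<Rightarrow> (complex \<Rightarrow> 'a) \<Rightarrow> complex \<Rightarrow> bool" where
  "solves u \<gamma> t \<longleftrightarrow> isCont \<gamma> t \<and>
     (\<forall>c\<in>A. \<gamma> t \<in> fst c \<longrightarrow> curve_deriv (\<lambda>s. snd c (\<gamma> s)) (frame (u t) (\<gamma> t) c) t)"

lemma solves_cong:
  assumes "solves u \<gamma> t" "open U" "t \<in> U" "\<And>s. s \<in> U \<Longrightarrow> \<gamma> s = \<delta> s"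
  shows "solves u \<delta> t"
  unfolding solves_def
proof (intro conjI ballI impI)
  have "\<forall>\<^sub>F s in nhds t. \<gamma> s = \<delta> s" using assms eventually_nhds by blast
  then show "isCont \<delta> t" using assms(1) isCont_cong unfolding solves_def by blast
  fix c assume c: "c \<in> A" "\<delta> t \<in> fst c"
  have eq: "\<gamma> t = \<delta> t" using assms by blast
  have "curve_deriv (\<lambda>s. snd c (\<gamma> s)) (frame (u t) (\<gamma> t) c) t"
    using assms(1) c unfolding solves_def eq by blast
  then show "curve_deriv (\<lambda>s. snd c (\<delta> s)) (frame (u t) (\<delta> t) c) t"
    unfolding eq by (rule curve_deriv_cong[OF _ assms(2,3)]) (simp add: assms(4))
qed

lemma curve_deriv_isCont: "curve_deriv y v t \<Longrightarrow> isCont y t"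
  unfolding curve_deriv_iff by (rule has_derivative_continuous)

text \<open>By left invariance of the frame, left translates of solutions are solutions.\<close>

lemma solves_translate:
  assumes c: "c \<in> A" and S: "open S" "t \<in> S"
    and y: "\<And>s. s \<in> S \<Longrightarrow> y s \<in> im c" "curve_deriv y (frame (u t) (chart_inv c (y t)) c) t"
  shows "solves u (\<lambda>s. h \<odot> chart_inv c (y s)) t"
  unfolding solves_def
proof (intro conjI ballI impI)
  have yt: "y t \<in> im c" using S y by blast
  have 1: "isCont (\<lambda>s. chart_inv c (y s)) t"
    by (rule isCont_o2[OF curve_deriv_isCont[OF y(2)] chart_isCont(2)[OF c yt]])
  show cont: "isCont (\<lambda>s. h \<odot> chart_inv c (y s)) t"
    by (rule isCont_o2[OF 1 left_mult_continuous])
  fix d assume d: "d \<in> A" "h \<odot> chart_inv c (y t) \<in> fst d"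
  let ?p = "chart_inv c (y t)"
  have p: "?p \<in> fst c" "snd c ?p = y t" using yt c by auto
  have yd: "y t \<in> ltrans_dom h c d" using yt d by (simp add: ltrans_dom_def)
  have "curve_deriv (\<lambda>s. ltrans h c d (y s)) (fd (ltrans h c d) (y t) (frame (u t) ?p c)) t"
    by (rule curve_chain[OF ltrans_holo(2)[OF c d(1)] yd y(2)])
  also have "fd (ltrans h c d) (y t) (frame (u t) ?p c) = frame (u t) (h \<odot> ?p) d"
    using frame_jac[OF c d(1) p(1) d(2), of "u t"] p by (simp add: jac_def)
  finally show "curve_deriv (\<lambda>s. snd d (h \<odot> chart_inv c (y s))) (frame (u t) (h \<odot> ?p) d) t"
    by (simp add: ltrans_def[abs_def])
qed

lemma frame_lipschitz:
  assumes "c \<in> A" "x \<in> im c"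
  shows "\<exists>R K L. R > 0 \<and> K \<ge> 0 \<and> L \<ge> 0 \<and> cball x R \<subseteq> im c \<and>
    (\<forall>y w. y \<in> cball x R \<longrightarrow> norm (frame w (chart_inv c y) c) \<le> K * norm w) \<and>
    (\<forall>y z w. y \<in> cball x R \<longrightarrow> z \<in> cball x R \<longrightarrow>
      norm (frame w (chart_inv c y) c - frame w (chart_inv c z) c) \<le> L * norm w * norm (y - z))"
  by (rule linear_family_lipschitz[OF frame_family[OF assms(1)] assms(2)])

text \<open>The equation is solved in a chart at the identity only. Starting points elsewhere
  are reached by left translation, so \<open>r\<close> depends on the bound \<open>M\<close> only.\<close>

lemma local_solution:
  assumes u: "\<And>i. (\<lambda>t. u t $ i) holomorphic_on UNIV" and M: "M \<ge> 0"
  obtains r where "0 < r" "r \<le> 1"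
    "\<And>s p. (\<And>t. t \<in> ball s r \<Longrightarrow> norm (u t) \<le> M) \<Longrightarrow> \<exists>\<gamma>. \<gamma> s = p \<and> (\<forall>t\<in>ball s r. solves u \<gamma> t)"
proof -
  let ?\<Phi> = "\<lambda>v w. frame w (chart_inv c0 v) c0" and ?y0 = "snd c0 e"
  have y0: "?y0 \<in> im c0" using c0 by simp
  obtain R K L where RKL: "R > 0" "K \<ge> 0" "L \<ge> 0" "cball ?y0 R \<subseteq> im c0"
    and K: "\<And>y w. y \<in> cball ?y0 R \<Longrightarrow> norm (?\<Phi> y w) \<le> K * norm w"
    and L: "\<And>y z w. y \<in> cball ?y0 R \<Longrightarrow> z \<in> cball ?y0 R \<Longrightarrow> norm (?\<Phi> y w - ?\<Phi> z w) \<le> L * norm w * norm (y - z)"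
    using frame_lipschitz[OF c0(1) y0] by metis
  \<comment> \<open>The last two terms are the conditions of \<open>picard_disc\<close>; adding 1 keeps the denominators positive.\<close>
  define r where "r = min 1 (min (R / (K * M + 1)) (1 / (2 * (L * M + 1))))"
  have pos: "K * M + 1 > 0" "L * M + 1 > 0" "K * M \<ge> 0" "L * M \<ge> 0"
    using RKL M by (simp_all add: add_nonneg_pos)
  have r: "r > 0" "r \<le> 1" "r \<le> R / (K * M + 1)" "r \<le> 1 / (2 * (L * M + 1))"
    using RKL pos by (simp_all add: r_def)
  have rK: "r * (K * M) \<le> R"
  proof -
    have "r * (K * M + 1) \<le> R" using r(3) pos by (simp add: field_simps)
    then show ?thesis using r(1) by (simp add: algebra_simps)
  qed
  have rL: "r * (L * M) \<le> 1 / 2"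
  proof -
    have "r * (2 * (L * M + 1)) \<le> 1" using r(4) pos by (simp add: field_simps)
    then show ?thesis using r(1) by (simp add: algebra_simps)
  qed
  show ?thesis
  proof (rule that[OF r(1,2)])
    fix s p assume uM: "\<And>t. t \<in> ball s r \<Longrightarrow> norm (u t) \<le> M"
    obtain y where y: "y s = ?y0" "\<And>t. t \<in> ball s r \<Longrightarrow> y t \<in> cball ?y0 R"
      "\<And>t. t \<in> ball s r \<Longrightarrow> curve_deriv y (?\<Phi> (y t) (u t)) t"
    proof (rule picard_disc[where r = r and K = "K * M" and R = R and L = "L * M" and G = "\<lambda>t v. ?\<Phi> v (u t)"
          and ?t0.0 = s and ?y0.0 = ?y0])
      fix t v assume t: "t \<in> ball s r" and v: "v \<in> cball ?y0 R"
      show "norm (?\<Phi> v (u t)) \<le> K * M"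
        using K[OF v, of "u t"] mult_left_mono[OF uM[OF t] RKL(2)] by linarith
      fix z assume z: "z \<in> cball ?y0 R"
      have "L * norm (u t) * norm (v - z) \<le> L * M * norm (v - z)"
        by (intro mult_right_mono mult_left_mono uM[OF t] RKL) simp
      then show "norm (?\<Phi> v (u t) - ?\<Phi> z (u t)) \<le> L * M * norm (v - z)"
        using L[OF v z, of "u t"] by linarith
    next
      fix y i assume yR: "\<And>t. t \<in> ball s r \<Longrightarrow> y t \<in> cball ?y0 R"
        and hol: "\<And>i. (\<lambda>t. y t $ i) holomorphic_on ball s r"
      have "\<exists>v. curve_deriv (\<lambda>t. ?\<Phi> (y t) (u t)) v t" if t: "t \<in> ball s r" for t
      proof
        show "curve_deriv (\<lambda>t. ?\<Phi> (y t) (u t)) (fd (\<lambda>z. ?\<Phi> z (u t)) (y t) (\<chi> i. deriv (\<lambda>t. y t $ i) t)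
           + ?\<Phi> (y t) (\<chi> i. deriv (\<lambda>t. u t $ i) t)) t"
        proof (rule curve_linear_family[OF frame_family[OF c0(1)] open_ball t])
          show "y s' \<in> im c0" if "s' \<in> ball s r" for s' using yR[OF that] RKL(4) by blast
          show "curve_deriv y (\<chi> i. deriv (\<lambda>t. y t $ i) t) t" by (rule curve_holomorphicD[OF hol open_ball t])
          show "curve_deriv u (\<chi> i. deriv (\<lambda>t. u t $ i) t) t" by (rule curve_holomorphicD[OF u open_UNIV UNIV_I])
        qed
      qed
      then show "(\<lambda>t. ?\<Phi> (y t) (u t) $ i) holomorphic_on ball s r"
        unfolding holomorphic_on_open[OF open_ball] curve_deriv_def by blast
    qed (use r rK rL pos RKL in auto)
    show "\<exists>\<gamma>. \<gamma> s = p \<and> (\<forall>t\<in>ball s r. solves u \<gamma> t)"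
    proof (intro exI[of _ "\<lambda>t. p \<odot> chart_inv c0 (y t)"] conjI ballI)
      show "p \<odot> chart_inv c0 (y s) = p" using y(1) c0 by simp
      fix t assume t: "t \<in> ball s r"
      show "solves u (\<lambda>t. p \<odot> chart_inv c0 (y t)) t"
        by (rule solves_translate[where S = "ball s r" and y = y and u = u and t = t and c = c0, OF c0(1) open_ball t _ y(3)[OF t]]) (use y(2) RKL(4) in blast)
    qed
  qed
qed

lemma solution_unique_local:
  assumes u: "isCont u s" and S: "open S" "s \<in> S"
    and \<gamma>: "\<And>t. t \<in> S \<Longrightarrow> solves u \<gamma> t" and \<delta>: "\<And>t. t \<in> S \<Longrightarrow> solves u \<delta> t" and eq: "\<gamma> s = \<delta> s"
  shows "\<exists>U. open U \<and> s \<in> U \<and> U \<subseteq> S \<and> (\<forall>t\<in>U. \<gamma> t = \<delta> t)"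
proof -
  obtain c where c: "c \<in> A" "\<gamma> s \<in> fst c" using chart_cover by blast
  let ?\<Phi> = "\<lambda>v w. frame w (chart_inv c v) c" and ?y0 = "snd c (\<gamma> s)"
  have y0: "?y0 \<in> im c" using c by simp
  obtain R K L where RKL: "R > 0" "K \<ge> 0" "L \<ge> 0" "cball ?y0 R \<subseteq> im c"
    and K: "\<And>y w. y \<in> cball ?y0 R \<Longrightarrow> norm (?\<Phi> y w) \<le> K * norm w"
    and L: "\<And>y z w. y \<in> cball ?y0 R \<Longrightarrow> z \<in> cball ?y0 R \<Longrightarrow> norm (?\<Phi> y w - ?\<Phi> z w) \<le> L * norm w * norm (y - z)"
    using frame_lipschitz[OF c(1) y0] by metis
  define M where "M = norm (u s) + 1"
  have M: "M > 0" by (simp add: M_def add_nonneg_pos)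
  obtain U1 where U1: "open U1" "s \<in> U1" "\<And>t. t \<in> U1 \<Longrightarrow> u t \<in> ball (u s) 1"
    by (rule isCont_open_nbhd[OF u open_ball, of "u s" 1]) auto
  have near: "\<exists>U. open U \<and> s \<in> U \<and> (\<forall>t\<in>U. \<alpha> t \<in> fst c \<and> snd c (\<alpha> t) \<in> ball ?y0 R)"
    if "solves u \<alpha> s" "\<alpha> s = \<gamma> s" for \<alpha>
  proof -
    have a: "isCont \<alpha> s" "\<alpha> s \<in> fst c" using that c by (auto simp: solves_def)
    have b: "isCont (\<lambda>t. snd c (\<alpha> t)) s"
      by (rule isCont_o2[OF a(1) chart_isCont(1)[OF c(1) a(2)]])
    obtain V1 where V1: "open V1" "s \<in> V1" "\<And>t. t \<in> V1 \<Longrightarrow> \<alpha> t \<in> fst c"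
      by (rule isCont_open_nbhd[OF a(1) chart_open(1)[OF c(1)] a(2)]) blast
    have in0: "snd c (\<alpha> s) \<in> ball ?y0 R" using that(2) RKL by simp
    obtain V2 where V2: "open V2" "s \<in> V2" "\<And>t. t \<in> V2 \<Longrightarrow> snd c (\<alpha> t) \<in> ball ?y0 R"
      by (rule isCont_open_nbhd[OF b open_ball in0]) blast
    show ?thesis using V1 V2 by (intro exI[of _ "V1 \<inter> V2"]) auto
  qed
  obtain U2 where U2: "open U2" "s \<in> U2" "\<And>t. t \<in> U2 \<Longrightarrow> \<gamma> t \<in> fst c \<and> snd c (\<gamma> t) \<in> ball ?y0 R"
    using near[OF \<gamma>[OF S(2)] refl] by blast
  obtain U3 where U3: "open U3" "s \<in> U3" "\<And>t. t \<in> U3 \<Longrightarrow> \<delta> t \<in> fst c \<and> snd c (\<delta> t) \<in> ball ?y0 R"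
    using near[OF \<delta>[OF S(2)] eq[symmetric]] by blast
  have "open (S \<inter> U1 \<inter> U2 \<inter> U3)" "s \<in> S \<inter> U1 \<inter> U2 \<inter> U3" using S U1 U2 U3 by auto
  then obtain \<epsilon> where \<epsilon>: "\<epsilon> > 0" "ball s \<epsilon> \<subseteq> S \<inter> U1 \<inter> U2 \<inter> U3"
    using open_contains_ball by blast
  define r where "r = min \<epsilon> (1 / (2 * (L * M + 1)))"
  have pos: "L * M \<ge> 0" "L * M + 1 > 0" using RKL M by (simp_all add: add_nonneg_pos)
  have r: "r > 0" "r \<le> \<epsilon>" "r \<le> 1 / (2 * (L * M + 1))" using \<epsilon> pos by (simp_all add: r_def)
  have rL: "r * (L * M) \<le> 1 / 2"
  proof -
    have "r * (2 * (L * M + 1)) \<le> 1" using r(3) pos by (simp add: field_simps)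
    then show ?thesis using r(1) by (simp add: algebra_simps)
  qed
  have sub: "ball s r \<subseteq> S \<inter> U1 \<inter> U2 \<inter> U3" using \<epsilon> r(2) by auto
  have uM: "norm (u t) \<le> M" if "t \<in> ball s r" for t
  proof -
    have "dist (u s) (u t) < 1" using U1(3)[of t] that sub by auto
    then show ?thesis using norm_triangle_ineq2[of "u t" "u s"] by (simp add: M_def dist_norm norm_minus_commute)
  qed
  have "\<gamma> t = \<delta> t" if t: "t \<in> ball s r" for t
  proof -
    have "snd c (\<gamma> t) = snd c (\<delta> t)"
    proof (rule ode_unique_disc[where r = r and L = "L * M" and R = R and G = "\<lambda>t v. ?\<Phi> v (u t)" and ?t0.0 = s
          and ?y0.0 = ?y0 and y = "\<lambda>t. snd c (\<gamma> t)" and z = "\<lambda>t. snd c (\<delta> t)" and t = t])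
      fix t v z assume t: "t \<in> ball s r" and v: "v \<in> cball ?y0 R" and z: "z \<in> cball ?y0 R"
      have "L * norm (u t) * norm (v - z) \<le> L * M * norm (v - z)"
        by (intro mult_right_mono mult_left_mono uM[OF t] RKL) simp
      then show "norm (?\<Phi> v (u t) - ?\<Phi> z (u t)) \<le> L * M * norm (v - z)"
        using L[OF v z, of "u t"] by linarith
    next
      fix t assume t: "t \<in> ball s r"
      have g: "\<gamma> t \<in> fst c" "snd c (\<gamma> t) \<in> ball ?y0 R" using U2(3)[of t] t sub by auto
      have d: "\<delta> t \<in> fst c" "snd c (\<delta> t) \<in> ball ?y0 R" using U3(3)[of t] t sub by auto
      show "snd c (\<gamma> t) \<in> cball ?y0 R" "snd c (\<delta> t) \<in> cball ?y0 R" using g d by auto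
      have tS: "t \<in> S" using t sub by auto
      show "curve_deriv (\<lambda>t. snd c (\<gamma> t)) (?\<Phi> (snd c (\<gamma> t)) (u t)) t"
        using \<gamma>[OF tS] g c by (simp add: solves_def)
      show "curve_deriv (\<lambda>t. snd c (\<delta> t)) (?\<Phi> (snd c (\<delta> t)) (u t)) t"
        using \<delta>[OF tS] d c by (simp add: solves_def)
    qed (use r rL pos eq t in auto)
    moreover have "\<gamma> t \<in> fst c" "\<delta> t \<in> fst c" using U2(3)[of t] U3(3)[of t] t sub by auto
    ultimately show ?thesis using chart_inv_simps(1)[OF c(1)] by metis
  qed
  then show ?thesis using r sub by (intro exI[of _ "ball s r"]) auto
qed

text \<open>The set where two solutions agree is open by local uniqueness and relatively
  closed because the group is a Hausdorff space.\<close>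

lemma solution_unique:
  assumes u: "\<And>t. isCont u t" and S: "open S" "connected S" "s \<in> S" "t \<in> S"
    and \<gamma>: "\<And>t. t \<in> S \<Longrightarrow> solves u \<gamma> t" and \<delta>: "\<And>t. t \<in> S \<Longrightarrow> solves u \<delta> t" and eq: "\<gamma> s = \<delta> s"
  shows "\<gamma> t = \<delta> t"
proof (rule ccontr)
  assume ne: "\<gamma> t \<noteq> \<delta> t"
  let ?E = "{t \<in> S. \<gamma> t = \<delta> t}" and ?F = "{t \<in> S. \<gamma> t \<noteq> \<delta> t}"
  have "open ?E"
    unfolding open_subopen[of ?E]
  proof
    fix x assume "x \<in> ?E"
    then have x: "x \<in> S" "\<gamma> x = \<delta> x" by auto
    obtain U where "open U" "x \<in> U" "U \<subseteq> S" "\<forall>t\<in>U. \<gamma> t = \<delta> t"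
      using solution_unique_local[OF u S(1) x(1) \<gamma> \<delta> x(2)] by blast
    then show "\<exists>T. open T \<and> x \<in> T \<and> T \<subseteq> ?E" by (intro exI[of _ U]) auto
  qed
  moreover have "open ?F"
    unfolding open_subopen[of ?F]
  proof
    fix x assume "x \<in> ?F"
    then have x: "x \<in> S" "\<gamma> x \<noteq> \<delta> x" by auto
    obtain V W where VW: "open V" "open W" "\<gamma> x \<in> V" "\<delta> x \<in> W" "V \<inter> W = {}"
      using hausdorff[OF x(2)] by blast
    have cont: "isCont \<gamma> x" "isCont \<delta> x" using \<gamma>[OF x(1)] \<delta>[OF x(1)] by (auto simp: solves_def)
    obtain U1 where U1: "open U1" "x \<in> U1" "\<And>t. t \<in> U1 \<Longrightarrow> \<gamma> t \<in> V"
      by (rule isCont_open_nbhd[OF cont(1) VW(1,3)]) blast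
    obtain U2 where U2: "open U2" "x \<in> U2" "\<And>t. t \<in> U2 \<Longrightarrow> \<delta> t \<in> W"
      by (rule isCont_open_nbhd[OF cont(2) VW(2,4)]) blast
    have ne': "\<gamma> y \<noteq> \<delta> y" if "y \<in> U1" "y \<in> U2" for y using U1(3)[OF that(1)] U2(3)[OF that(2)] VW(5) by auto
    show "\<exists>T. open T \<and> x \<in> T \<and> T \<subseteq> ?F"
      by (intro exI[of _ "S \<inter> U1 \<inter> U2"]) (use U1 U2 S x ne' in auto)
  qed
  moreover have "?E \<inter> S \<noteq> {}" using S eq by auto
  moreover have "?F \<inter> S \<noteq> {}" using S ne by auto
  moreover have "S \<subseteq> ?E \<union> ?F" "?E \<inter> ?F \<inter> S = {}" by auto
  ultimately show False using connectedD[OF S(2)] by meson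
qed

text \<open>Every point of the larger disc lies in a disc of radius \<open>r\<close> around a point of the
  smaller one. The solutions on two such discs agree on their overlap: both agree with \<open>\<gamma>\<close> at the
  midpoint of the centres, and the overlap is convex.\<close>

lemma extend_solution:
  assumes u: "\<And>t. isCont u t" and r: "0 < r" and \<rho>: "0 < \<rho>"
    and loc: "\<And>s p. s \<in> ball 0 \<rho> \<Longrightarrow> \<exists>\<gamma>. \<gamma> s = p \<and> (\<forall>t\<in>ball s r. solves u \<gamma> t)"
    and \<gamma>: "\<And>t. t \<in> ball 0 \<rho> \<Longrightarrow> solves u \<gamma> t"
  obtains \<gamma>' where "\<gamma>' 0 = \<gamma> 0" "\<And>t. t \<in> ball 0 (\<rho> + r / 2) \<Longrightarrow> solves u \<gamma>' t"
proof -
  have "\<forall>s\<in>ball 0 \<rho>. \<exists>\<delta>. \<delta> s = \<gamma> s \<and> (\<forall>t\<in>ball s r. solves u \<delta> t)" using loc by blast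
  then obtain \<delta> where \<delta>: "\<And>s. s \<in> ball 0 \<rho> \<Longrightarrow> \<delta> s s = \<gamma> s"
    "\<And>s t. s \<in> ball 0 \<rho> \<Longrightarrow> t \<in> ball s r \<Longrightarrow> solves u (\<delta> s) t" by metis
  have \<delta>\<gamma>: "\<delta> s t = \<gamma> t" if "s \<in> ball 0 \<rho>" "t \<in> ball s r" "t \<in> ball 0 \<rho>" for s t
    by (rule solution_unique[OF u, where S = "ball 0 \<rho> \<inter> ball s r" and s = s])
      (use that \<delta> \<gamma> r in \<open>auto intro!: convex_connected convex_Int\<close>)
  have consistent: "\<delta> s t = \<delta> s' t"
    if s: "s \<in> ball 0 \<rho>" "t \<in> ball s r" and s': "s' \<in> ball 0 \<rho>" "t \<in> ball s' r" for s s' t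
  proof -
    define m where "m = midpoint s s'"
    have ds: "dist s s' < 2 * r" using s(2) s'(2) dist_triangle2[of s s' t] by (simp add: dist_commute)
    have m: "m \<in> ball s r" "m \<in> ball s' r"
      using ds by (simp_all add: m_def dist_midpoint)
    have m0: "m \<in> ball 0 \<rho>"
      using s(1) s'(1) norm_triangle_ineq[of s s'] by (simp add: m_def midpoint_def)
    have eq: "\<delta> s m = \<delta> s' m" using \<delta>\<gamma> m m0 s s' by simp
    show ?thesis
      by (rule solution_unique[OF u, where S = "ball s r \<inter> ball s' r" and s = m])
        (use m s s' \<delta>(2) eq in \<open>auto intro!: convex_connected convex_Int\<close>)
  qed
  \<comment> \<open>Radial contraction of the larger disc into the smaller one; it moves every point by less than \<open>r / 2\<close>.\<close>
  define \<sigma> where "\<sigma> = (\<lambda>t. complex_of_real (\<rho> / (\<rho> + r / 2)) * t)"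
  have \<sigma>: "\<sigma> t \<in> ball 0 \<rho>" "t \<in> ball (\<sigma> t) r" if "t \<in> ball 0 (\<rho> + r / 2)" for t
  proof -
    have pos: "\<rho> + r / 2 > 0" using r \<rho> by simp
    have t: "norm t < \<rho> + r / 2" using that by simp
    have "norm (\<sigma> t) = \<rho> / (\<rho> + r / 2) * norm t"
      unfolding \<sigma>_def norm_mult norm_of_real using pos \<rho> by simp
    also have "\<dots> < \<rho> / (\<rho> + r / 2) * (\<rho> + r / 2)"
      using t pos \<rho> by (intro mult_strict_left_mono) auto
    finally show "\<sigma> t \<in> ball 0 \<rho>" using pos by simp
    have "\<sigma> t - t = complex_of_real (\<rho> / (\<rho> + r / 2) - 1) * t" by (simp add: \<sigma>_def algebra_simps)
    also have "\<rho> / (\<rho> + r / 2) - 1 = - ((r / 2) / (\<rho> + r / 2))" using pos by (simp add: field_simps)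
    finally have eq: "\<sigma> t - t = complex_of_real (- ((r / 2) / (\<rho> + r / 2))) * t" .
    have "norm (\<sigma> t - t) = (r / 2) / (\<rho> + r / 2) * norm t"
      unfolding eq norm_mult norm_of_real using pos r by simp
    also have "\<dots> < ((r / 2) / (\<rho> + r / 2)) * (\<rho> + r / 2)"
      using t pos r by (intro mult_strict_left_mono) auto
    also have "\<dots> = r / 2"
      by (rule nonzero_divide_eq_eq[THEN iffD1, OF _ refl, symmetric]) (use pos in simp)
    finally show "t \<in> ball (\<sigma> t) r" using r by (simp add: dist_norm)
  qed
  define \<gamma>' where "\<gamma>' = (\<lambda>t. \<delta> (\<sigma> t) t)"
  show ?thesis
  proof (rule that[of \<gamma>'])
    show "\<gamma>' 0 = \<gamma> 0" using \<delta>(1)[of 0] \<rho> by (simp add: \<gamma>'_def \<sigma>_def)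
    fix t :: complex assume t: "t \<in> ball 0 (\<rho> + r / 2)"
    show "solves u \<gamma>' t"
    proof (rule solves_cong[OF \<delta>(2)[OF \<sigma>[OF t]], of "ball 0 (\<rho> + r / 2) \<inter> ball (\<sigma> t) r"])
      show "\<delta> (\<sigma> t) s = \<gamma>' s" if "s \<in> ball 0 (\<rho> + r / 2) \<inter> ball (\<sigma> t) r" for s
        unfolding \<gamma>'_def using that \<sigma>[OF t] \<sigma>[of s] by (intro consistent) auto
    qed (use t \<sigma>[OF t] in auto)
  qed
qed

text \<open>On the disc of radius \<open>N + 1\<close> the coordinates \<open>u\<close> are bounded, so finitely many
  extensions by \<open>r / 2\<close> suffice.\<close>

lemma solution_on_disc:
  assumes u: "\<And>i. (\<lambda>t. u t $ i) holomorphic_on UNIV" and uc: "\<And>t. isCont u t"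
  shows "\<exists>\<gamma>. \<gamma> 0 = p \<and> (\<forall>t\<in>ball 0 N. solves u \<gamma> t)"
proof -
  have "compact (u ` cball 0 (N + 1))"
    by (intro compact_continuous_image continuous_at_imp_continuous_on) (use uc in auto)
  then obtain M0 where M0: "\<forall>x\<in>u ` cball 0 (N + 1). norm x \<le> M0"
    using compact_imp_bounded bounded_iff by blast
  define M where "M = max M0 0"
  have M: "M \<ge> 0" "\<And>t. norm t \<le> N + 1 \<Longrightarrow> norm (u t) \<le> M"
    using M0 by (auto simp: M_def le_max_iff_disj)
  obtain r where r: "0 < r" "r \<le> 1" and loc:
    "\<And>s p. (\<And>t. t \<in> ball s r \<Longrightarrow> norm (u t) \<le> M) \<Longrightarrow> \<exists>\<gamma>. \<gamma> s = p \<and> (\<forall>t\<in>ball s r. solves u \<gamma> t)"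
    by (rule local_solution[OF u M(1)]) blast
  have loc': "\<exists>\<gamma>. \<gamma> s = p \<and> (\<forall>t\<in>ball s r. solves u \<gamma> t)" if "norm s \<le> N" for s p
  proof (rule loc)
    fix t assume "t \<in> ball s r"
    then have "norm t \<le> N + 1" using that r norm_triangle_sub[of t s] by (simp add: dist_norm norm_minus_commute)
    then show "norm (u t) \<le> M" by (rule M(2))
  qed
  have step: "\<exists>\<gamma>. \<gamma> 0 = p \<and> (\<forall>t\<in>ball 0 (min N (r / 2 * (real k + 1))). solves u \<gamma> t)" if N: "N > 0" for k
  proof (induction k)
    case 0
    obtain \<gamma> where "\<gamma> 0 = p" "\<forall>t\<in>ball 0 r. solves u \<gamma> t" using loc'[of 0 p] N by auto
    then show ?case using r by (intro exI[of _ \<gamma>]) auto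
  next
    case (Suc k)
    define \<rho> where "\<rho> = min N (r / 2 * (real k + 1))"
    obtain \<gamma> where \<gamma>: "\<gamma> 0 = p" "\<forall>t\<in>ball 0 \<rho>. solves u \<gamma> t" using Suc by (auto simp: \<rho>_def)
    have \<rho>: "\<rho> > 0" "\<rho> \<le> N" using N r by (simp_all add: \<rho>_def)
    obtain \<gamma>' where \<gamma>': "\<gamma>' 0 = \<gamma> 0" "\<And>t. t \<in> ball 0 (\<rho> + r / 2) \<Longrightarrow> solves u \<gamma>' t"
    proof (rule extend_solution[OF uc r(1) \<rho>(1), of \<gamma>])
      show "\<exists>\<gamma>. \<gamma> s = p \<and> (\<forall>t\<in>ball s r. solves u \<gamma> t)" if "s \<in> ball 0 \<rho>" for s p
        by (rule loc') (use that \<rho> in auto)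
    qed (use \<gamma> in auto)
    have "r / 2 * (real (Suc k) + 1) = r / 2 * (real k + 1) + r / 2" by (simp add: field_simps)
    then have "min N (r / 2 * (real (Suc k) + 1)) \<le> \<rho> + r / 2"
      using r unfolding \<rho>_def by linarith
    then show ?case using \<gamma>' \<gamma>(1) by (intro exI[of _ \<gamma>']) auto
  qed
  show ?thesis
  proof (cases "N > 0")
    case True
    obtain k where "N / (r / 2) < real k" using reals_Archimedean2 by blast
    then have "N \<le> r / 2 * (real k + 1)" using r by (simp add: field_simps)
    then show ?thesis using step[OF True, of k] by (simp add: min_absorb1)
  next
    case False
    show ?thesis
    proof (intro exI[of _ "\<lambda>_. p"] conjI ballI refl)
      fix t :: complex assume "t \<in> ball 0 N"
      then have "norm t < N" by simp
      with False norm_ge_zero[of t] have False by linarith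
      then show "solves u (\<lambda>_. p) t" ..
    qed
  qed
qed

text \<open>Solutions on increasing discs agree by uniqueness. Their union is realised by
  evaluating at \<open>t\<close> the solution on a disc that contains \<open>t\<close>.\<close>

lemma global_solution:
  assumes u: "\<And>i. (\<lambda>t. u t $ i) holomorphic_on UNIV" and uc: "\<And>t. isCont u t"
  obtains \<gamma> where "\<gamma> 0 = p" "\<And>t. solves u \<gamma> t"
proof -
  have "\<forall>n. \<exists>\<gamma>. \<gamma> 0 = p \<and> (\<forall>t\<in>ball 0 (real n + 1). solves u \<gamma> t)"
    using solution_on_disc[OF u uc] by blast
  then obtain \<delta> where \<delta>: "\<And>n. \<delta> n 0 = p" "\<And>n t. t \<in> ball 0 (real n + 1) \<Longrightarrow> solves u (\<delta> n) t"
    by metis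
  have eq: "\<delta> m t = \<delta> n t" if "t \<in> ball 0 (real m + 1)" "t \<in> ball 0 (real n + 1)" for m n t
    by (rule solution_unique[OF uc, where S = "ball 0 (real m + 1) \<inter> ball 0 (real n + 1)" and s = 0])
      (use that \<delta> in \<open>auto intro!: convex_connected convex_Int\<close>)
  define k where "k = (\<lambda>t::complex. nat \<lceil>norm t\<rceil>)"
  have k: "t \<in> ball 0 (real (k t) + 1)" for t
  proof -
    have "norm t \<le> real (k t)" unfolding k_def by (rule real_nat_ceiling_ge)
    then show ?thesis by simp
  qed
  show ?thesis
  proof (rule that[of "\<lambda>t. \<delta> (k t) t"])
    show "\<delta> (k 0) 0 = p" by (rule \<delta>)
    show "solves u (\<lambda>t. \<delta> (k t) t) t" for t
    proof (rule solves_cong[OF \<delta>(2)[OF k] open_ball k])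
      show "\<delta> (k t) s = \<delta> (k s) s" if "s \<in> ball 0 (real (k t) + 1)" for s
        by (rule eq[OF that k])
    qed
  qed
qed

end

section \<open>Geodesics\<close>

context complex_lie
begin

text \<open>The geodesic equation is stated with coordinate fields, so these must be admissible
  arguments of the connection on the domain of their chart.\<close>

lemma coord_field_holo:
  assumes c: "c \<in> A"
  shows "holo_vector_field_on A (fst c) (coord_field A c x)"
  unfolding holo_vector_field_on_def
proof (intro conjI ballI)
  fix p assume p: "p \<in> fst c"
  show "coord_field A c x p \<in> tangent_space A p"
    unfolding tangent_space_iff
  proof (intro conjI allI impI ballI)
    fix b d assume "b \<in> charts_at A p" "d \<in> charts_at A p"
    then have bd: "b \<in> A" "p \<in> fst b" "d \<in> A" "p \<in> fst d" by (auto simp: charts_atD)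
    have "jac e (e \<odot> p) b d (jac e p c b x) = jac (e \<odot> e) p c d x"
      by (rule jac_cocycle) (use bd c p in simp_all)
    then show "coord_field A c x p d = jac e p b d (coord_field A c x p b)"
      using bd by (simp add: coord_field_eq charts_atD)
  qed (simp add: coord_field_eq)
next
  fix d assume d: "d \<in> A"
  let ?S = "snd d ` (fst d \<inter> fst c)"
  have S: "open ?S" by (rule chart_image_open[OF d chart_open(1)[OF c]])
  have sub: "?S \<subseteq> ltrans_dom e d c" using d by (auto simp: ltrans_dom_def)
  have "holo_vec_on (\<lambda>u. fd (ltrans e c d) (ltrans e d c u) x) ?S"
  proof (rule holo_vec_on_compose[OF holo_vec_directional_derivative[OF ltrans_holo(2,1)[OF c d]]
        holo_vec_on_subset[OF ltrans_holo(2)[OF d c] sub]])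
    show "ltrans e d c u \<in> ltrans_dom e c d" if "u \<in> ?S" for u
      using that c d by (auto simp: ltrans_def ltrans_dom_def)
  qed
  then show "holo_vec_on (\<lambda>u. coord_field A c x (chart_inv d u) d) ?S"
  proof (rule holo_vec_on_cong[OF _ S])
    fix u assume "u \<in> ?S"
    then have "chart_inv d u \<in> fst d" using d by auto
    then show "fd (ltrans e c d) (ltrans e d c u) x = coord_field A c x (chart_inv d u) d"
      using d by (simp add: coord_field_eq charts_atD jac_def ltrans_def[of e d c])
  qed
qed

lemma coord_field_chart: "c \<in> A \<Longrightarrow> p \<in> fst c \<Longrightarrow> coord_field A c x p c = x"
  by (simp add: coord_field_eq charts_atD jac_id)

lemma solves_velocity:
  assumes "solves u \<gamma> z"
  shows "velocity A \<gamma> z = frame (u z) (\<gamma> z)"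
proof
  fix c :: "('a, 'n) chart"
  show "velocity A \<gamma> z c = frame (u z) (\<gamma> z) c"
  proof (cases "c \<in> charts_at A (\<gamma> z)")
    case True
    then have "curve_deriv (\<lambda>t. snd c (\<gamma> t)) (frame (u z) (\<gamma> z) c) z"
      using assms by (simp add: solves_def charts_atD)
    then have "deriv (\<lambda>t. snd c (\<gamma> t) $ i) z = frame (u z) (\<gamma> z) c $ i" for i
      unfolding curve_deriv_def using DERIV_imp_deriv by blast
    then show ?thesis using True by (simp add: velocity_def)
  qed (simp add: velocity_def frame_def)
qed

lemma solves_holo_curve:
  assumes "\<And>t. solves u \<gamma> t"
  shows "holo_curve A \<gamma>"
  unfolding holo_curve_def
proof (intro conjI ballI allI)
  show cont: "continuous_on UNIV \<gamma>"
    using assms by (auto simp: solves_def continuous_on_eq_continuous_at)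
  fix c i assume c: "c \<in> A"
  have op: "open (\<gamma> -` fst c)" by (rule open_vimage[OF chart_open(1)[OF c] cont])
  have "\<exists>v. ((\<lambda>t. snd c (\<gamma> t) $ i) has_field_derivative v) (at t)" if "t \<in> \<gamma> -` fst c" for t
    using assms[of t] that c unfolding solves_def curve_deriv_def by blast
  then show "(\<lambda>t. snd c (\<gamma> t) $ i) holomorphic_on \<gamma> -` fst c"
    unfolding holomorphic_on_open[OF op] by blast
qed

text \<open>In a chart the velocity is the frame applied to \<open>u\<close>, and the product rule
  along the curve applies.\<close>

lemma solves_second_derivative:
  assumes \<gamma>: "\<And>t. solves u \<gamma> t" and u: "curve_deriv u u' z" and c: "c \<in> A" "\<gamma> z \<in> fst c"
  shows "(\<chi> i. deriv (deriv (\<lambda>t. snd c (\<gamma> t) $ i)) z) =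
    fd (\<lambda>v. frame (u z) (chart_inv c v) c) (snd c (\<gamma> z)) (frame (u z) (\<gamma> z) c) + frame u' (\<gamma> z) c"
proof -
  let ?U = "\<gamma> -` fst c"
  have cont: "continuous_on UNIV \<gamma>" using solves_holo_curve[OF \<gamma>] by (simp add: holo_curve_def)
  have U: "open ?U" "z \<in> ?U" using open_vimage[OF chart_open(1)[OF c(1)] cont] c by auto
  have d1: "curve_deriv (\<lambda>s. snd c (\<gamma> s)) (frame (u t) (\<gamma> t) c) t" if "t \<in> ?U" for t
    using \<gamma>[of t] that c by (simp add: solves_def)
  have "curve_deriv (\<lambda>t. frame (u t) (chart_inv c (snd c (\<gamma> t))) c)
    (fd (\<lambda>v. frame (u z) (chart_inv c v) c) (snd c (\<gamma> z)) (frame (u z) (\<gamma> z) c)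
      + frame u' (chart_inv c (snd c (\<gamma> z))) c) z"
    by (rule curve_linear_family[OF frame_family[OF c(1)] U _ d1[OF U(2)] u]) auto
  then have "curve_deriv (\<lambda>t. \<chi> i. deriv (\<lambda>t. snd c (\<gamma> t) $ i) t)
    (fd (\<lambda>v. frame (u z) (chart_inv c v) c) (snd c (\<gamma> z)) (frame (u z) (\<gamma> z) c)
      + frame u' (chart_inv c (snd c (\<gamma> z))) c) z"
  proof (rule curve_deriv_cong[OF _ U])
    fix s assume s: "s \<in> ?U"
    have "deriv (\<lambda>t. snd c (\<gamma> t) $ i) s = frame (u s) (\<gamma> s) c $ i" for i
      using d1[OF s] unfolding curve_deriv_def using DERIV_imp_deriv by blast
    then show "frame (u s) (chart_inv c (snd c (\<gamma> s))) c = (\<chi> i. deriv (\<lambda>t. snd c (\<gamma> t) $ i) s)"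
      using s c by (simp add: vec_eq_iff)
  qed
  then have "deriv (\<lambda>t. deriv (\<lambda>t. snd c (\<gamma> t) $ i) t) z =
    (fd (\<lambda>v. frame (u z) (chart_inv c v) c) (snd c (\<gamma> z)) (frame (u z) (\<gamma> z) c) + frame u' (\<gamma> z) c) $ i" for i
    using c unfolding curve_deriv_def by (intro DERIV_imp_deriv) simp
  then show ?thesis by (simp add: vec_eq_iff)
qed

end

context metric_lie
begin

text \<open>The coordinate field is constant in its chart, so the product rule of
  \<open>field_derivative\<close> expresses the derivative of its frame coordinates by that of the frame.\<close>

lemma conn_coord_field:
  assumes c: "c \<in> A" "p \<in> fst c" and v: "v \<in> tangent_space A p"
  shows "conn p v (coord_field A c (v c)) c =
    - fd (\<lambda>w. frame (frame_coord p v) (chart_inv c w) c) (snd c p) (v c)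
    + frame (koszul (frame_coord p v) (frame_coord p v)) p c"
proof -
  let ?Y = "coord_field A c (v c)"
  have W: "open (fst c)" by (rule chart_open(1)[OF c(1)])
  have Y: "holo_vector_field_on A (fst c) ?Y" by (rule coord_field_holo[OF c(1)])
  have Yp: "?Y p = v"
    by (rule tangent_eqI[OF holo_fieldD(1)[OF Y c(2)] v c]) (simp add: coord_field_chart c)
  have "fd (\<lambda>w. ?Y (chart_inv c w) c) (snd c p) = fd (\<lambda>w. v c) (snd c p)"
    by (rule fd_cong[OF chart_open(2)[OF c(1)]]) (use c in \<open>auto simp: coord_field_chart\<close>)
  then have "0 = fd (\<lambda>w. frame (coords ?Y p) (chart_inv c w) c) (snd c p) (v c)
    + frame (fd (\<lambda>w. coords ?Y (chart_inv c w)) (snd c p) (v c)) p c"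
    using field_derivative[OF W c(2) Y c, of "v c"] by simp
  moreover have "cderiv (coords ?Y) p v = fd (\<lambda>w. coords ?Y (chart_inv c w)) (snd c p) (v c)"
    by (rule cderiv_chart[OF W c(2) coords_of_field[OF W Y] v c])
  ultimately have "frame (cderiv (coords ?Y) p v) p c = - fd (\<lambda>w. frame (frame_coord p v) (chart_inv c w) c) (snd c p) (v c)"
    by (simp add: Yp eq_neg_iff_add_eq_0 add.commute)
  then show ?thesis by (simp add: conn_def frame_linear Yp)
qed

text \<open>The derivative of the frame enters the second derivative of the curve
  and the Christoffel term with opposite signs. What remains is \<open>u' + koszul u u = 0\<close>.\<close>

lemma geodesic_of_euler_solution:
  assumes \<gamma>: "\<And>t. solves u \<gamma> t" and u: "\<And>t. curve_deriv u (- koszul (u t) (u t)) t"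
  shows "geodesic A conn \<gamma>"
  unfolding geodesic_def
proof (intro conjI allI ballI)
  show "holo_curve A \<gamma>" by (rule solves_holo_curve[OF \<gamma>])
  fix z c assume "c \<in> charts_at A (\<gamma> z)"
  then have c: "c \<in> A" "\<gamma> z \<in> fst c" by (auto simp: charts_atD)
  show "(\<chi> i. deriv (deriv (\<lambda>t. snd c (\<gamma> t) $ i)) z)
      + conn (\<gamma> z) (velocity A \<gamma> z) (coord_field A c (velocity A \<gamma> z c)) c = 0"
    unfolding solves_velocity[OF \<gamma>] solves_second_derivative[OF \<gamma> u c] conn_coord_field[OF c frame_tangent]
    by (simp add: frame_linear)
qed

text \<open>Let \<open>l\<close> be the linear map with \<open>g (l x) w = g u0 [x, w]\<close> and \<open>u\<close> its flow line
  through \<open>u0\<close>. Since brackets are central, \<open>g (l x) w = 0\<close> whenever \<open>w\<close> is a bracket, so \<open>g (u t) w\<close>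
  keeps its initial value. Therefore \<open>g u0 [u t, w] = g (u t) [u t, w]\<close>, and the linear equation is
  the Euler equation along \<open>u\<close>.\<close>

lemma euler_solution:
  assumes nil: "two_step_nilpotent H A"
  obtains u where "u 0 = u0" "\<And>t. curve_deriv u (- koszul (u t) (u t)) t"
proof -
  have "\<forall>x. \<exists>z. \<forall>w. g z w = g u0 (alg_bracket x w)"
    by (intro allI g_representation) (simp_all add: g_simps alg_bracket_bilinear)
  then obtain l where l: "\<And>x w. g (l x) w = g u0 (alg_bracket x w)" by metis
  have "clin l"
    by (rule clinI; rule g_ext) (simp_all add: l g_simps alg_bracket_bilinear)
  then obtain u where u: "u 0 = u0" "\<And>t. curve_deriv u (l (u t)) t"
    by (rule linear_flow_exists) blast
  have const: "g (u t) (alg_bracket x y) = g u0 (alg_bracket x y)" for t x y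
  proof -
    have "((\<lambda>t. g (u t) (alg_bracket x y)) has_field_derivative 0) (at t within UNIV)" for t
    proof -
      have "((\<lambda>t. g (u t) (alg_bracket x y)) has_derivative (\<lambda>h. g (h *s l (u t)) (alg_bracket x y))) (at t)"
        by (rule bounded_linear.has_derivative[OF bounded_bilinear.bounded_linear_left[OF bounded_bilinear_g]])
          (use u(2)[of t] in \<open>simp add: curve_deriv_iff\<close>)
      then show ?thesis
        by (simp add: has_field_derivative_def g_scale_left l alg_bracket_nilpotent[OF nil] g_zero lambda_zero)
    qed
    from has_field_derivative_zero_constant[OF convex_UNIV this]
    obtain k where "\<And>t. g (u t) (alg_bracket x y) = k" by blast
    then show ?thesis using u(1) by metis
  qed
  have "l (u t) = - koszul (u t) (u t)" for t
  proof (rule g_ext)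
    fix z
    have "g (- koszul (u t) (u t)) z = - g (u t) (alg_bracket z (u t))"
      by (simp add: g_minus koszul_self)
    also have "\<dots> = g (u t) (alg_bracket (u t) z)"
      using alg_bracket_antisym[of z "u t"] by (simp add: g_minus)
    finally show "g (l (u t)) z = g (- koszul (u t) (u t)) z"
      by (simp add: l const)
  qed
  then show ?thesis using that[of u] u by simp
qed

theorem two_step_C_complete:
  assumes "two_step_nilpotent H A"
  shows "C_complete A q"
  unfolding C_complete_def
proof (intro exI[of _ conn] conjI conn_levi_civita allI ballI)
  fix p w assume w: "w \<in> tangent_space A p"
  obtain u where u: "u 0 = frame_coord p w" "\<And>t. curve_deriv u (- koszul (u t) (u t)) t"
    by (rule euler_solution[OF assms]) blast
  have uh: "(\<lambda>t. u t $ i) holomorphic_on UNIV" for i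
    by (rule curve_deriv_holomorphic[OF u(2) open_UNIV])
  obtain \<gamma> where \<gamma>: "\<gamma> 0 = p" "\<And>t. solves u \<gamma> t"
    by (rule global_solution[OF uh curve_deriv_isCont[OF u(2)]]) blast
  have "geodesic A conn \<gamma>" by (rule geodesic_of_euler_solution[OF \<gamma>(2) u(2)])
  moreover have "velocity A \<gamma> 0 = w"
    using solves_velocity[OF \<gamma>(2)[of 0]] frame_frame_coord[OF w] by (simp add: u(1) \<gamma>(1))
  ultimately show "\<exists>\<gamma>. geodesic A conn \<gamma> \<and> \<gamma> 0 = p \<and> velocity A \<gamma> 0 = w"
    using \<gamma>(1) by blast
qed

end

theorem theorem10p4:
  fixes H :: "('a::{t2_space, second_countable_topology}) monoid"
    and A :: "('a, 'n::finite) chart set"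
    and q :: "'a \<Rightarrow> ('a, 'n) tvec \<Rightarrow> ('a, 'n) tvec \<Rightarrow> complex"
  assumes "complex_lie_group H A"
    and "two_step_nilpotent H A"
    and "holo_riemannian_metric A q"
    and "left_invariant H A q"
  shows "C_complete A q"
proof -
  interpret metric_lie H A q
    using assms by unfold_locales
  show ?thesis
    by (rule two_step_C_complete) (rule assms(2))
qed

end
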